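(* The category $\mathbf{RBLie2Alg}$ of Rota-Baxter Lie $2$-algebras and their homomorphisms and the category $\mathbf{2TermRBL}_\infty$ of $2$-term Rota-Baxter $L_\infty$-algebras and Rota-Baxter $L_\infty$-homomorphisms are equivalent.
   Context: All vector spaces are finite dimensional over an algebraically closed field $\mathbb K$ of characteristic $0$. **The category $\mathbf{RBLie2Alg}$.** A $2$-vector space $L=(L_1,L_0,s,t,i,\circ)$ is an internal category in vector spaces: a category whose objects form a vector space $L_0$ and whose morphisms form a vector space $L_1$, with source $s$, target $t$, identity assignment $i$ (write $1_x=i(x)$) and composition all linear. Juxtaposition $gf$ of morphisms means first $f$, then $g$. The arrow part of $f:x\to y$ is $\vec f=f-i(x)\in\ker s$. Linear functors are internal functors; linear natural transformations are natural transformations whose components depend (multi)linearly on the objects. A multilinear natural transformation is (completely) antisymmetric if its arrow part is. In the formulas below, sums of morphisms are taken in the vector space of morphisms, and a bare "$1$" denotes the identity morphism of the remaining summands. A Lie $2$-algebra is a $2$-vector space $L$ with a skew-symmetric bilinear functor $[\cdot,\cdot]:L\times L\to L$ and a completely antisymmetric trilinear natural isomorphism (Jacobiator) $J_{x,y,z}:[[x,y],z]\to[x,[y,z]]+[[x,z],y]$ such that $$([w,J_{x,y,z}]+1)([J_{w,y,z},x]+1)(J_{[w,y],x,z}+J_{w,[x,y],z})[J_{w,x,y},z]=(J_{w,[x,z],y}+J_{[w,z],x,y}+J_{w,x,[y,z]})([J_{w,x,z},y]+1)J_{[w,x],y,z}.$$ A homomorphism of Lie $2$-algebras $F=(F_0,F_1,F_2):L\to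 L'$ is a linear functor $(F_0,F_1)$ with a skew-symmetric bilinear natural transformation $F_2(x,y):[F_0(x),F_0(y)]\to F_0[x,y]$ such that $$F_1(J_{x,y,z})\,F_2([x,y],z)\,[F_2(x,y),1_{F_0(z)}]=(F_2(x,[y,z])+F_2([x,z],y))([1_{F_0(x)},F_2(y,z)]+[F_2(x,z),1_{F_0(y)}])J'_{F_0(x),F_0(y),F_0(z)}.$$ A Rota-Baxter Lie $2$-algebra is a triple $(L,P,\mathcal R)$ with $L$ a Lie $2$-algebra, $P=(P_0,P_1):L\to L$ a linear functor, and $\mathcal R$ an antisymmetric bilinear natural isomorphism $\mathcal R_{x,y}:[P_0(x),P_0(y)]\to P_0[P_0(x),y]+P_0[x,P_0(y)]$ such that for all objects $x,y,z$ $$\begin{aligned}&(1+P_1[\mathcal R_{x,y},1_z])(1+P_1J_{P_0(x),z,P_0(y)})(\mathcal R_{x,[P_0(y),z]}+\mathcal R_{x,[y,P_0(z)]}+\mathcal R_{[x,P_0(z)],y}+\mathcal R_{[P_0(x),z],y})\\&\quad([1_{P_0(x)},\mathcal R_{y,z}]+[\mathcal R_{x,z},1_{P_0(y)}])J_{P_0(x),P_0(y),P_0(z)}\\&=(1+P_1[\mathcal R_{x,z},1_y]+P_1[1_x,\mathcal R_{y,z}])(1+P_1J_{P_0(x),y,P_0(z)}+P_1J_{x,P_0(y),P_0(z)})\\&\quad(\mathcal R_{[P_0(x),y],z}+\mathcal R_{[x,P_0(y)],z})[\mathcal R_{x,y},1_{P_0(z)}].\end{aligned}$$ A homomorphism $(L,P,\mathcal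 R)\to(L',P',\mathcal R')$ is a Lie $2$-algebra homomorphism $(F_0,F_1,F_2)$ together with a linear natural transformation $F_3(x):P_0'(F_0(x))\to F_0(P_0(x))$ such that $$\begin{aligned}&(F_3[P_0(x),y]+F_3[x,P_0(y)])(P_1'F_2(P_0(x),y)+P_1'F_2(x,P_0(y)))(P_1'[F_3(x),1_{F_0(y)}]+P_1'[1_{F_0(x)},F_3(y)])\mathcal R'_{F_0(x),F_0(y)}\\&=F_1(\mathcal R_{x,y})F_2(P_0(x),P_0(y))[F_3(x),F_3(y)].\end{aligned}$$ The composite of $F:L\to L'$ and $G:L'\to L''$ has the composite underlying functor and $(G\circ F)_2(x,y)=G_1(F_2(x,y))\,G_2(F_0(x),F_0(y))$, $(G\circ F)_3(x)=G_1(F_3(x))\,G_3(F_0(x))$; the identity homomorphism has the identity functor and identity natural transformations. **The category $\mathbf{2TermRBL}_\infty$.** A $2$-term $L_\infty$-algebra $\mathcal G=(\mathfrak g_1,\mathfrak g_0,l_1,l_2,l_3)$ consists of a linear map $l_1:\mathfrak g_1\to\mathfrak g_0$, a skew-symmetric bilinear $l_2:\mathfrak g_i\otimes\mathfrak g_j\to\mathfrak g_{i+j}$ for $0\le i+j\le1$ (also written $[\cdot,\cdot]$, with $l_2(u,x)=-l_2(x,u)$; for two elements $u,v\in\mathfrak g_1$ one puts $l_2(u,v)=0$), and a skew-symmetric trilinear $l_3:\wedge^3\mathfrak g_0\to\mathfrak g_1$ such that for $x,y,z,x_i\in\mathfrak g_0$, $u,v\in\mathfrak g_1$: (a) $l_1l_2(x,u)=l_2(x,l_1(u))$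 and $l_2(l_1(u),v)=l_2(u,l_1(v))$; (b) $l_1l_3(x,y,z)=l_2(x,l_2(y,z))+l_2(z,l_2(x,y))+l_2(y,l_2(z,x))$; (c) $l_3(x,y,l_1(u))=l_2(x,l_2(y,u))+l_2(u,l_2(x,y))+l_2(y,l_2(u,x))$; (d) $\sum_{i=1}^4(-1)^{i+1}l_2(x_i,l_3(x_1,\dots,\hat x_i,\dots,x_4))+\sum_{i<j}(-1)^{i+j}l_3(l_2(x_i,x_j),x_1,\dots,\hat x_i,\dots,\hat x_j,\dots,x_4)=0$. An $L_\infty$-homomorphism $\phi=(\phi_0,\phi_1,\phi_2):\mathcal G\to\mathcal G'$ consists of linear maps $\phi_0:\mathfrak g_0\to\mathfrak g_0'$, $\phi_1:\mathfrak g_1\to\mathfrak g_1'$ with $l_1'\phi_1=\phi_0l_1$ and a skew-symmetric bilinear $\phi_2:\mathfrak g_0\times\mathfrak g_0\to\mathfrak g_1'$ with: $l_1'\phi_2(x,y)=\phi_0[x,y]-[\phi_0(x),\phi_0(y)]$; $\phi_2(x,l_1(u))=\phi_1[x,u]-[\phi_0(x),\phi_1(u)]$; and $[\phi_2(x,y),\phi_0(z)]+\phi_2([x,y],z)+\phi_1(l_3(x,y,z))=l_3'(\phi_0(x),\phi_0(y),\phi_0(z))+[\phi_0(x),\phi_2(y,z)]+[\phi_2(x,z),\phi_0(y)]+\phi_2(x,[y,z])+\phi_2([x,z],y)$. A Rota-Baxter operator on $\mathcal G$ is a triple $\mathfrak R=(R_0,R_1,R_2)$ with $R_0:\mathfrak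 g_0\to\mathfrak g_0$, $R_1:\mathfrak g_1\to\mathfrak g_1$ linear, $l_1R_1=R_0l_1$, and $R_2:\wedge^2\mathfrak g_0\to\mathfrak g_1$ linear, such that (1) $R_0(l_2(R_0x,y)+l_2(x,R_0y))-l_2(R_0x,R_0y)=l_1R_2(x,y)$; (2) $R_1(l_2(R_1u,x)+l_2(u,R_0x))-l_2(R_1u,R_0x)=R_2(l_1(u),x)$; (3) $\big\{l_2(R_0x_1,R_2(x_2,x_3))+R_2(x_3,l_2(R_0x_1,x_2)-l_2(R_0x_2,x_1))+R_1(l_2(R_2(x_2,x_3),x_1)-l_3(R_0x_2,R_0x_3,x_1))\big\}+\text{c.p.}+l_3(R_0x_1,R_0x_2,R_0x_3)=0$, where "c.p." means adding the cyclic permutations in $(x_1,x_2,x_3)$ of the braced expression. The pair $(\mathcal G,\mathfrak R)$ is a $2$-term Rota-Baxter $L_\infty$-algebra. A Rota-Baxter $L_\infty$-homomorphism $(\phi_0,\phi_1,\phi_2,\phi_3):(\mathcal G,\mathfrak R)\to(\mathcal G',\mathfrak R')$ is an $L_\infty$-homomorphism $(\phi_0,\phi_1,\phi_2)$ with a linear map $\phi_3:\mathfrak g_0\to\mathfrak g_1'$ such that for $x,y\in\mathfrak g_0$, $u\in\mathfrak g_1$: $l_1'(\phi_3(x))=-R_0'(\phi_0(x))+\phi_0(R_0(x))$; $\phi_3(l_1(u))=\phi_1(R_1(u))-R_1'(\phi_1(u))$; and $$\begin{aligned}&R_2'(\phi_0(x),\phi_0(y))+R_1'[\phi_3(x),\phi_0(y)]+R_1'[\phi_0(x),\phi_3(y)]+R_1'(\phi_2(R_0(x),y))+R_1'(\phi_2(x,R_0(y)))\\&\quad+\phi_3([R_0(x),y])+\phi_3([x,R_0(y)])\\&=[\phi_3(x),\phi_3(y)]+\phi_2(R_0(x),R_0(y))+\phi_1(R_2(x,y)).\end{aligned}$$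 Composition: $(\psi\circ\phi)_0=\psi_0\phi_0$, $(\psi\circ\phi)_1=\psi_1\phi_1$, $(\psi\circ\phi)_2(x,y)=\psi_2(\phi_0(x),\phi_0(y))+\psi_1(\phi_2(x,y))$, $(\psi\circ\phi)_3(x)=\psi_3(\phi_0(x))+\psi_1(\phi_3(x))$; the identity is $(\mathrm{id},\mathrm{id},0,0)$.
   Formalization: In the last condition on Rota-Baxter L∞-homomorphisms, [φ₃(x),φ₃(y)] is read as [φ₃(x),R'₀φ₀(y)]+[φ₀R₀(x),φ₃(y)] rather than as l₂ of two degree-1 elements, which is 0; with 0 the homomorphisms are not closed under composition. *)

theory Defs
  imports "HOL-Algebra.Algebraic_Closure" "Jordan_Normal_Form.Missing_VectorSpace"
begin

section \<open>Categories and equivalences\<close>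

record ('o, 'm) cat =
  cat_obj :: "'o set"
  cat_hom :: "'o \<Rightarrow> 'o \<Rightarrow> 'm set"
  cat_id :: "'o \<Rightarrow> 'm"
  cat_comp :: "'o \<Rightarrow> 'o \<Rightarrow> 'o \<Rightarrow> 'm \<Rightarrow> 'm \<Rightarrow> 'm"

text \<open>Hom-sets need not be disjoint, so composition takes the three objects:
  \<open>cat_comp C a b c g f\<close> is \<open>g\<close> after \<open>f\<close> for \<open>f : a \<rightarrow> b\<close> and \<open>g : b \<rightarrow> c\<close>.\<close>

locale category =
  fixes C :: "('o, 'm) cat"
  assumes id_hom: "a \<in> cat_obj C \<Longrightarrow> cat_id C a \<in> cat_hom C a a"
    and comp_hom: "\<lbrakk>a \<in> cat_obj C; b \<in> cat_obj C; c \<in> cat_obj C;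
        f \<in> cat_hom C a b; g \<in> cat_hom C b c\<rbrakk>
      \<Longrightarrow> cat_comp C a b c g f \<in> cat_hom C a c"
    and id_left: "\<lbrakk>a \<in> cat_obj C; b \<in> cat_obj C; f \<in> cat_hom C a b\<rbrakk>
      \<Longrightarrow> cat_comp C a b b (cat_id C b) f = f"
    and id_right: "\<lbrakk>a \<in> cat_obj C; b \<in> cat_obj C; f \<in> cat_hom C a b\<rbrakk>
      \<Longrightarrow> cat_comp C a a b f (cat_id C a) = f"
    and assoc: "\<lbrakk>a \<in> cat_obj C; b \<in> cat_obj C; c \<in> cat_obj C; d \<in> cat_obj C;
        f \<in> cat_hom C a b; g \<in> cat_hom C b c; h \<in> cat_hom C c d\<rbrakk>
      \<Longrightarrow> cat_comp C a b d (cat_comp C b c d h g) f = cat_comp C a c d h (cat_comp C a b c g f)"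

locale cat_functor =
  fixes C :: "('o, 'm) cat" and D :: "('p, 'n) cat"
    and Fo :: "'o \<Rightarrow> 'p" and Fm :: "'o \<Rightarrow> 'o \<Rightarrow> 'm \<Rightarrow> 'n"
  assumes obj: "a \<in> cat_obj C \<Longrightarrow> Fo a \<in> cat_obj D"
    and hom: "\<lbrakk>a \<in> cat_obj C; b \<in> cat_obj C; f \<in> cat_hom C a b\<rbrakk>
      \<Longrightarrow> Fm a b f \<in> cat_hom D (Fo a) (Fo b)"
    and ident: "a \<in> cat_obj C \<Longrightarrow> Fm a a (cat_id C a) = cat_id D (Fo a)"
    and comp: "\<lbrakk>a \<in> cat_obj C; b \<in> cat_obj C; c \<in> cat_obj C;
        f \<in> cat_hom C a b; g \<in> cat_hom C b c\<rbrakk>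
      \<Longrightarrow> Fm a c (cat_comp C a b c g f)
        = cat_comp D (Fo a) (Fo b) (Fo c) (Fm b c g) (Fm a b f)"

definition cat_iso :: "('o, 'm) cat \<Rightarrow> 'o \<Rightarrow> 'o \<Rightarrow> 'm \<Rightarrow> bool" where
  "cat_iso C a b f \<longleftrightarrow> f \<in> cat_hom C a b \<and>
    (\<exists>g \<in> cat_hom C b a. cat_comp C a b a g f = cat_id C a \<and> cat_comp C b a b f g = cat_id C b)"

locale cat_natural_iso =
  fixes C :: "('o, 'm) cat" and D :: "('p, 'n) cat"
    and Fo :: "'o \<Rightarrow> 'p" and Fm :: "'o \<Rightarrow> 'o \<Rightarrow> 'm \<Rightarrow> 'n"
    and Go :: "'o \<Rightarrow> 'p" and Gm :: "'o \<Rightarrow> 'o \<Rightarrow> 'm \<Rightarrow> 'n"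
    and \<eta> :: "'o \<Rightarrow> 'n"
  assumes iso: "a \<in> cat_obj C \<Longrightarrow> cat_iso D (Fo a) (Go a) (\<eta> a)"
    and natural: "\<lbrakk>a \<in> cat_obj C; b \<in> cat_obj C; f \<in> cat_hom C a b\<rbrakk>
      \<Longrightarrow> cat_comp D (Fo a) (Fo b) (Go b) (\<eta> b) (Fm a b f)
        = cat_comp D (Fo a) (Go a) (Go b) (Gm a b f) (\<eta> a)"

definition equivalent_categories :: "('o, 'm) cat \<Rightarrow> ('p, 'n) cat \<Rightarrow> bool" where
  "equivalent_categories C D \<longleftrightarrow> category C \<and> category D \<and>
    (\<exists>Fo Fm Go Gm \<eta> \<epsilon>.
      cat_functor C D Fo Fm \<and> cat_functor D C Go Gm \<and>
      cat_natural_iso C C (\<lambda>a. a) (\<lambda>a b f. f)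
        (\<lambda>a. Go (Fo a)) (\<lambda>a b f. Gm (Fo a) (Fo b) (Fm a b f)) \<eta> \<and>
      cat_natural_iso D D (\<lambda>a. Fo (Go a)) (\<lambda>a b f. Fm (Go a) (Go b) (Gm a b f))
        (\<lambda>a. a) (\<lambda>a b f. f) \<epsilon>)"


section \<open>Linear algebra\<close>

definition char_zero :: "('k, 'c) ring_scheme \<Rightarrow> bool" where
  "char_zero K \<longleftrightarrow> (\<forall>n::nat. n > 0 \<longrightarrow> [n] \<cdot>\<^bsub>K\<^esub> \<one>\<^bsub>K\<^esub> \<noteq> \<zero>\<^bsub>K\<^esub>)"

definition fd_vectorspace :: "('k, 'c) ring_scheme \<Rightarrow> ('k, 'v, 'd) module_scheme \<Rightarrow> bool" where
  "fd_vectorspace K V \<longleftrightarrow> vectorspace K V \<and> vectorspace.fin_dim K V"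

definition bilinear_map where
  "bilinear_map K U V W f \<longleftrightarrow>
    (\<forall>x \<in> carrier U. (\<lambda>y. f x y) \<in> module_hom K V W) \<and>
    (\<forall>y \<in> carrier V. (\<lambda>x. f x y) \<in> module_hom K U W)"

definition trilinear_map where
  "trilinear_map K V W f \<longleftrightarrow>
    (\<forall>y \<in> carrier V. \<forall>z \<in> carrier V. (\<lambda>x. f x y z) \<in> module_hom K V W) \<and>
    (\<forall>x \<in> carrier V. \<forall>z \<in> carrier V. (\<lambda>y. f x y z) \<in> module_hom K V W) \<and>
    (\<forall>x \<in> carrier V. \<forall>y \<in> carrier V. (\<lambda>z. f x y z) \<in> module_hom K V W)"

definition skew2 where
  "skew2 V W f \<longleftrightarrow> (\<forall>x \<in> carrier V. \<forall>y \<in> carrier V. f x y = \<ominus>\<^bsub>W\<^esub> f y x)"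

text \<open>The two adjacent transpositions generate the symmetric group on three letters.\<close>

definition skew3 where
  "skew3 V W f \<longleftrightarrow> (\<forall>x \<in> carrier V. \<forall>y \<in> carrier V. \<forall>z \<in> carrier V.
    f x y z = \<ominus>\<^bsub>W\<^esub> f y x z \<and> f x y z = \<ominus>\<^bsub>W\<^esub> f x z y)"


section \<open>2-vector spaces\<close>

record ('k, 'v) two_vect =
  Ob :: "('k, 'v) module"
  Mor :: "('k, 'v) module"
  src :: "'v \<Rightarrow> 'v"
  tgt :: "'v \<Rightarrow> 'v"
  idm :: "'v \<Rightarrow> 'v" (\<open>\<iota>\<index>\<close>)
  cmp :: "'v \<Rightarrow> 'v \<Rightarrow> 'v" (infixr \<open>\<diamondop>\<index>\<close> 60)

text \<open>\<open>g \<diamondop> f\<close> is first \<open>f\<close>, then \<open>g\<close>; it is meaningful only if the target of \<open>f\<close> is the source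
  of \<open>g\<close>. \<open>\<oplus>\<^sub>O\<close> and \<open>\<oplus>\<^sub>M\<close> are the additions of objects and of morphisms.\<close>

abbreviation ob_add (infixl \<open>\<oplus>\<^sub>O\<index>\<close> 65) where "x \<oplus>\<^sub>O\<^bsub>L\<^esub> y \<equiv> x \<oplus>\<^bsub>Ob L\<^esub> y"
abbreviation mor_add (infixl \<open>\<oplus>\<^sub>M\<index>\<close> 65) where "f \<oplus>\<^sub>M\<^bsub>L\<^esub> g \<equiv> f \<oplus>\<^bsub>Mor L\<^esub> g"

abbreviation obs where "obs L \<equiv> carrier (Ob L)"
abbreviation mors where "mors L \<equiv> carrier (Mor L)"

definition mor_between where
  "mor_between L x y = {f \<in> mors L. src L f = x \<and> tgt L f = y}"

definition composable_pairs where
  "composable_pairs L = {(g, f). g \<in> mors L \<and> f \<in> mors L \<and> tgt L f = src L g}"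

definition arrow_part where
  "arrow_part L f = f \<ominus>\<^bsub>Mor L\<^esub> \<iota>\<^bsub>L\<^esub> (src L f)"

definition invertible_mor where
  "invertible_mor L f \<longleftrightarrow> f \<in> mors L \<and> (\<exists>g \<in> mor_between L (tgt L f) (src L f).
    g \<diamondop>\<^bsub>L\<^esub> f = \<iota>\<^bsub>L\<^esub> (src L f) \<and> f \<diamondop>\<^bsub>L\<^esub> g = \<iota>\<^bsub>L\<^esub> (tgt L f))"

text \<open>The composition of an internal category is a linear map on the pullback of \<open>tgt\<close> and
  \<open>src\<close>, here a subspace of the direct sum.\<close>

locale two_vector_space =
  fixes K :: "('k, 'c) ring_scheme" and L :: "('k, 'v, 'd) two_vect_scheme" (structure)
  assumes ob_space: "fd_vectorspace K (Ob L)"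
    and mor_space: "fd_vectorspace K (Mor L)"
    and src_linear: "src L \<in> module_hom K (Mor L) (Ob L)"
    and tgt_linear: "tgt L \<in> module_hom K (Mor L) (Ob L)"
    and idm_linear: "idm L \<in> module_hom K (Ob L) (Mor L)"
    and cmp_linear: "(\<lambda>(g, f). g \<diamondop> f)
      \<in> module_hom K ((direct_sum (Mor L) (Mor L))\<lparr>carrier := composable_pairs L\<rparr>) (Mor L)"
    and src_idm: "x \<in> obs L \<Longrightarrow> src L (\<iota> x) = x"
    and tgt_idm: "x \<in> obs L \<Longrightarrow> tgt L (\<iota> x) = x"
    and src_cmp: "(g, f) \<in> composable_pairs L \<Longrightarrow> src L (g \<diamondop> f) = src L f"
    and tgt_cmp: "(g, f) \<in> composable_pairs L \<Longrightarrow> tgt L (g \<diamondop> f) = tgt L g"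
    and idm_left: "f \<in> mors L \<Longrightarrow> \<iota> (tgt L f) \<diamondop> f = f"
    and idm_right: "f \<in> mors L \<Longrightarrow> f \<diamondop> \<iota> (src L f) = f"
    and cmp_assoc: "\<lbrakk>(h, g) \<in> composable_pairs L; (g, f) \<in> composable_pairs L\<rbrakk>
      \<Longrightarrow> (h \<diamondop> g) \<diamondop> f = h \<diamondop> (g \<diamondop> f)"

locale linear_functor =
  fixes K :: "('k, 'c) ring_scheme"
    and L :: "('k, 'v, 'd) two_vect_scheme" and L' :: "('k, 'v, 'e) two_vect_scheme"
    and F0 F1 :: "'v \<Rightarrow> 'v"
  assumes F0_linear: "F0 \<in> module_hom K (Ob L) (Ob L')"
    and F1_linear: "F1 \<in> module_hom K (Mor L) (Mor L')"
    and F_src: "f \<in> mors L \<Longrightarrow> src L' (F1 f) = F0 (src L f)"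
    and F_tgt: "f \<in> mors L \<Longrightarrow> tgt L' (F1 f) = F0 (tgt L f)"
    and F_idm: "x \<in> obs L \<Longrightarrow> F1 (\<iota>\<^bsub>L\<^esub> x) = \<iota>\<^bsub>L'\<^esub> (F0 x)"
    and F_cmp: "(g, f) \<in> composable_pairs L \<Longrightarrow> F1 (g \<diamondop>\<^bsub>L\<^esub> f) = F1 g \<diamondop>\<^bsub>L'\<^esub> F1 f"

locale bilinear_functor =
  fixes K :: "('k, 'c) ring_scheme" and L :: "('k, 'v, 'd) two_vect_scheme" (structure)
    and B0 B1 :: "'v \<Rightarrow> 'v \<Rightarrow> 'v"
  assumes B0_bilinear: "bilinear_map K (Ob L) (Ob L) (Ob L) B0"
    and B1_bilinear: "bilinear_map K (Mor L) (Mor L) (Mor L) B1"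
    and B_src: "\<lbrakk>f \<in> mors L; g \<in> mors L\<rbrakk> \<Longrightarrow> src L (B1 f g) = B0 (src L f) (src L g)"
    and B_tgt: "\<lbrakk>f \<in> mors L; g \<in> mors L\<rbrakk> \<Longrightarrow> tgt L (B1 f g) = B0 (tgt L f) (tgt L g)"
    and B_idm: "\<lbrakk>x \<in> obs L; y \<in> obs L\<rbrakk> \<Longrightarrow> B1 (\<iota> x) (\<iota> y) = \<iota> (B0 x y)"
    and B_cmp: "\<lbrakk>(f', f) \<in> composable_pairs L; (g', g) \<in> composable_pairs L\<rbrakk>
      \<Longrightarrow> B1 (f' \<diamondop> f) (g' \<diamondop> g) = B1 f' g' \<diamondop> B1 f g"


section \<open>Lie 2-algebras\<close>

record ('k, 'v) lie_two_alg = "('k, 'v) two_vect" +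
  ob_br :: "'v \<Rightarrow> 'v \<Rightarrow> 'v" (\<open>\<langle>_, _\<rangle>\<^sub>O\<index>\<close>)
  mor_br :: "'v \<Rightarrow> 'v \<Rightarrow> 'v" (\<open>\<langle>_, _\<rangle>\<^sub>M\<index>\<close>)
  jac :: "'v \<Rightarrow> 'v \<Rightarrow> 'v \<Rightarrow> 'v" (\<open>J\<index>\<close>)

text \<open>In the two coherence laws for algebras below, an explicit identity morphism is the
  bare \<open>1\<close> of the usual notation, i.e. the identity of the summands left unchanged.\<close>

locale lie_two_algebra = two_vector_space K L
  for K :: "('k, 'c) ring_scheme" and L :: "('k, 'v, 'd) lie_two_alg_scheme" (structure) +
  assumes br_functor: "bilinear_functor K L (ob_br L) (mor_br L)"
    and ob_br_skew: "skew2 (Ob L) (Ob L) (ob_br L)"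
    and mor_br_skew: "skew2 (Mor L) (Mor L) (mor_br L)"
    and jac_trilinear: "trilinear_map K (Ob L) (Mor L) (jac L)"
    and jac_skew: "skew3 (Ob L) (Mor L) (\<lambda>x y z. arrow_part L (jac L x y z))"
    and jac_between: "\<lbrakk>x \<in> obs L; y \<in> obs L; z \<in> obs L\<rbrakk> \<Longrightarrow>
      J x y z \<in> mor_between L \<langle>\<langle>x, y\<rangle>\<^sub>O, z\<rangle>\<^sub>O (\<langle>x, \<langle>y, z\<rangle>\<^sub>O\<rangle>\<^sub>O \<oplus>\<^sub>O \<langle>\<langle>x, z\<rangle>\<^sub>O, y\<rangle>\<^sub>O)"
    and jac_invertible: "\<lbrakk>x \<in> obs L; y \<in> obs L; z \<in> obs L\<rbrakk> \<Longrightarrow> invertible_mor L (J x y z)"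
    and jac_natural: "\<lbrakk>f \<in> mors L; g \<in> mors L; h \<in> mors L\<rbrakk> \<Longrightarrow>
      J (tgt L f) (tgt L g) (tgt L h) \<diamondop> \<langle>\<langle>f, g\<rangle>\<^sub>M, h\<rangle>\<^sub>M
      = (\<langle>f, \<langle>g, h\<rangle>\<^sub>M\<rangle>\<^sub>M \<oplus>\<^sub>M \<langle>\<langle>f, h\<rangle>\<^sub>M, g\<rangle>\<^sub>M) \<diamondop> J (src L f) (src L g) (src L h)"
    and jac_coherence: "\<lbrakk>w \<in> obs L; x \<in> obs L; y \<in> obs L; z \<in> obs L\<rbrakk> \<Longrightarrow>
      (\<langle>\<iota> w, J x y z\<rangle>\<^sub>M \<oplus>\<^sub>M
          \<iota> (\<langle>\<langle>w, y\<rangle>\<^sub>O, \<langle>x, z\<rangle>\<^sub>O\<rangle>\<^sub>O \<oplus>\<^sub>O \<langle>\<langle>w, \<langle>y, z\<rangle>\<^sub>O\<rangle>\<^sub>O, x\<rangle>\<^sub>O \<oplus>\<^sub>O \<langle>\<langle>\<langle>w, z\<rangle>\<^sub>O, y\<rangle>\<^sub>O, x\<rangle>\<^sub>O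
             \<oplus>\<^sub>O \<langle>\<langle>w, z\<rangle>\<^sub>O, \<langle>x, y\<rangle>\<^sub>O\<rangle>\<^sub>O))
      \<diamondop> (\<langle>J w y z, \<iota> x\<rangle>\<^sub>M \<oplus>\<^sub>M
          \<iota> (\<langle>\<langle>w, y\<rangle>\<^sub>O, \<langle>x, z\<rangle>\<^sub>O\<rangle>\<^sub>O \<oplus>\<^sub>O \<langle>w, \<langle>\<langle>x, y\<rangle>\<^sub>O, z\<rangle>\<^sub>O\<rangle>\<^sub>O \<oplus>\<^sub>O \<langle>\<langle>w, z\<rangle>\<^sub>O, \<langle>x, y\<rangle>\<^sub>O\<rangle>\<^sub>O))
      \<diamondop> (J \<langle>w, y\<rangle>\<^sub>O x z \<oplus>\<^sub>M J w \<langle>x, y\<rangle>\<^sub>O z)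
      \<diamondop> \<langle>J w x y, \<iota> z\<rangle>\<^sub>M
      = (J w \<langle>x, z\<rangle>\<^sub>O y \<oplus>\<^sub>M J \<langle>w, z\<rangle>\<^sub>O x y \<oplus>\<^sub>M J w x \<langle>y, z\<rangle>\<^sub>O)
      \<diamondop> (\<langle>J w x z, \<iota> y\<rangle>\<^sub>M \<oplus>\<^sub>M \<iota> \<langle>\<langle>w, x\<rangle>\<^sub>O, \<langle>y, z\<rangle>\<^sub>O\<rangle>\<^sub>O)
      \<diamondop> J \<langle>w, x\<rangle>\<^sub>O y z"


section \<open>Rota-Baxter Lie 2-algebras\<close>

record ('k, 'v) rb_lie_two_alg = "('k, 'v) lie_two_alg" +
  rb_ob :: "'v \<Rightarrow> 'v" (\<open>P\<^sub>0\<index>\<close>)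
  rb_mor :: "'v \<Rightarrow> 'v" (\<open>P\<^sub>1\<index>\<close>)
  rb_nat :: "'v \<Rightarrow> 'v \<Rightarrow> 'v" (\<open>\<R>\<index>\<close>)

locale rb_lie_two_algebra = lie_two_algebra K L
  for K :: "('k, 'c) ring_scheme" and L :: "('k, 'v, 'd) rb_lie_two_alg_scheme" (structure) +
  assumes rb_functor: "linear_functor K L L (rb_ob L) (rb_mor L)"
    and rb_bilinear: "bilinear_map K (Ob L) (Ob L) (Mor L) (rb_nat L)"
    and rb_skew: "skew2 (Ob L) (Mor L) (\<lambda>x y. arrow_part L (rb_nat L x y))"
    and rb_between: "\<lbrakk>x \<in> obs L; y \<in> obs L\<rbrakk> \<Longrightarrow>
      \<R> x y \<in> mor_between L \<langle>P\<^sub>0 x, P\<^sub>0 y\<rangle>\<^sub>O (P\<^sub>0 \<langle>P\<^sub>0 x, y\<rangle>\<^sub>O \<oplus>\<^sub>O P\<^sub>0 \<langle>x, P\<^sub>0 y\<rangle>\<^sub>O)"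
    and rb_invertible: "\<lbrakk>x \<in> obs L; y \<in> obs L\<rbrakk> \<Longrightarrow> invertible_mor L (\<R> x y)"
    and rb_natural: "\<lbrakk>f \<in> mors L; g \<in> mors L\<rbrakk> \<Longrightarrow>
      \<R> (tgt L f) (tgt L g) \<diamondop> \<langle>P\<^sub>1 f, P\<^sub>1 g\<rangle>\<^sub>M
      = (P\<^sub>1 \<langle>P\<^sub>1 f, g\<rangle>\<^sub>M \<oplus>\<^sub>M P\<^sub>1 \<langle>f, P\<^sub>1 g\<rangle>\<^sub>M) \<diamondop> \<R> (src L f) (src L g)"
    \<comment> \<open>The first identity on the left omits \<open>P\<^sub>0 \<langle>P\<^sub>0 x, \<langle>P\<^sub>0 y, z\<rangle>\<rangle>\<close>: it cancels against the summand
        \<open>P\<^sub>0 \<langle>P\<^sub>0 x, \<langle>z, P\<^sub>0 y\<rangle>\<rangle>\<close> of the target of the Jacobiator applied just before.\<close>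
    and rb_coherence: "\<lbrakk>x \<in> obs L; y \<in> obs L; z \<in> obs L\<rbrakk> \<Longrightarrow>
      (\<iota> (P\<^sub>0 \<langle>x, P\<^sub>0 \<langle>P\<^sub>0 y, z\<rangle>\<^sub>O\<rangle>\<^sub>O \<oplus>\<^sub>O P\<^sub>0 \<langle>P\<^sub>0 x, \<langle>y, P\<^sub>0 z\<rangle>\<^sub>O\<rangle>\<^sub>O \<oplus>\<^sub>O P\<^sub>0 \<langle>x, P\<^sub>0 \<langle>y, P\<^sub>0 z\<rangle>\<^sub>O\<rangle>\<^sub>O
          \<oplus>\<^sub>O P\<^sub>0 \<langle>P\<^sub>0 \<langle>x, P\<^sub>0 z\<rangle>\<^sub>O, y\<rangle>\<^sub>O \<oplus>\<^sub>O P\<^sub>0 \<langle>\<langle>x, P\<^sub>0 z\<rangle>\<^sub>O, P\<^sub>0 y\<rangle>\<^sub>O \<oplus>\<^sub>O P\<^sub>0 \<langle>P\<^sub>0 \<langle>P\<^sub>0 x, z\<rangle>\<^sub>O, y\<rangle>\<^sub>O)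
        \<oplus>\<^sub>M P\<^sub>1 \<langle>\<R> x y, \<iota> z\<rangle>\<^sub>M)
      \<diamondop> (\<iota> (P\<^sub>0 \<langle>P\<^sub>0 x, \<langle>P\<^sub>0 y, z\<rangle>\<^sub>O\<rangle>\<^sub>O \<oplus>\<^sub>O P\<^sub>0 \<langle>x, P\<^sub>0 \<langle>P\<^sub>0 y, z\<rangle>\<^sub>O\<rangle>\<^sub>O
          \<oplus>\<^sub>O P\<^sub>0 \<langle>P\<^sub>0 x, \<langle>y, P\<^sub>0 z\<rangle>\<^sub>O\<rangle>\<^sub>O \<oplus>\<^sub>O P\<^sub>0 \<langle>x, P\<^sub>0 \<langle>y, P\<^sub>0 z\<rangle>\<^sub>O\<rangle>\<^sub>O
          \<oplus>\<^sub>O P\<^sub>0 \<langle>P\<^sub>0 \<langle>x, P\<^sub>0 z\<rangle>\<^sub>O, y\<rangle>\<^sub>O \<oplus>\<^sub>O P\<^sub>0 \<langle>\<langle>x, P\<^sub>0 z\<rangle>\<^sub>O, P\<^sub>0 y\<rangle>\<^sub>O \<oplus>\<^sub>O P\<^sub>0 \<langle>P\<^sub>0 \<langle>P\<^sub>0 x, z\<rangle>\<^sub>O, y\<rangle>\<^sub>O)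
        \<oplus>\<^sub>M P\<^sub>1 (J (P\<^sub>0 x) z (P\<^sub>0 y)))
      \<diamondop> (\<R> x \<langle>P\<^sub>0 y, z\<rangle>\<^sub>O \<oplus>\<^sub>M \<R> x \<langle>y, P\<^sub>0 z\<rangle>\<^sub>O \<oplus>\<^sub>M \<R> \<langle>x, P\<^sub>0 z\<rangle>\<^sub>O y \<oplus>\<^sub>M \<R> \<langle>P\<^sub>0 x, z\<rangle>\<^sub>O y)
      \<diamondop> (\<langle>\<iota> (P\<^sub>0 x), \<R> y z\<rangle>\<^sub>M \<oplus>\<^sub>M \<langle>\<R> x z, \<iota> (P\<^sub>0 y)\<rangle>\<^sub>M)
      \<diamondop> J (P\<^sub>0 x) (P\<^sub>0 y) (P\<^sub>0 z)
      = (\<iota> (P\<^sub>0 \<langle>P\<^sub>0 \<langle>P\<^sub>0 x, y\<rangle>\<^sub>O, z\<rangle>\<^sub>O \<oplus>\<^sub>O P\<^sub>0 \<langle>P\<^sub>0 \<langle>x, P\<^sub>0 y\<rangle>\<^sub>O, z\<rangle>\<^sub>O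
          \<oplus>\<^sub>O P\<^sub>0 \<langle>P\<^sub>0 x, \<langle>y, P\<^sub>0 z\<rangle>\<^sub>O\<rangle>\<^sub>O \<oplus>\<^sub>O P\<^sub>0 \<langle>\<langle>x, P\<^sub>0 z\<rangle>\<^sub>O, P\<^sub>0 y\<rangle>\<^sub>O)
        \<oplus>\<^sub>M P\<^sub>1 \<langle>\<R> x z, \<iota> y\<rangle>\<^sub>M \<oplus>\<^sub>M P\<^sub>1 \<langle>\<iota> x, \<R> y z\<rangle>\<^sub>M)
      \<diamondop> (\<iota> (P\<^sub>0 \<langle>P\<^sub>0 \<langle>P\<^sub>0 x, y\<rangle>\<^sub>O, z\<rangle>\<^sub>O \<oplus>\<^sub>O P\<^sub>0 \<langle>P\<^sub>0 \<langle>x, P\<^sub>0 y\<rangle>\<^sub>O, z\<rangle>\<^sub>O)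
        \<oplus>\<^sub>M P\<^sub>1 (J (P\<^sub>0 x) y (P\<^sub>0 z)) \<oplus>\<^sub>M P\<^sub>1 (J x (P\<^sub>0 y) (P\<^sub>0 z)))
      \<diamondop> (\<R> \<langle>P\<^sub>0 x, y\<rangle>\<^sub>O z \<oplus>\<^sub>M \<R> \<langle>x, P\<^sub>0 y\<rangle>\<^sub>O z)
      \<diamondop> \<langle>\<R> x y, \<iota> (P\<^sub>0 z)\<rangle>\<^sub>M"


section \<open>Homomorphisms of Rota-Baxter Lie 2-algebras\<close>

locale lie_two_homomorphism = linear_functor K L L' F0 F1
  for K :: "('k, 'c) ring_scheme"
    and L' :: "('k, 'v, 'e) lie_two_alg_scheme" (structure)
    and L :: "('k, 'v, 'd) lie_two_alg_scheme"
    and F0 F1 :: "'v \<Rightarrow> 'v" +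
  fixes F2 :: "'v \<Rightarrow> 'v \<Rightarrow> 'v"
  assumes F2_bilinear: "bilinear_map K (Ob L) (Ob L) (Mor L') F2"
    and F2_skew: "skew2 (Ob L) (Mor L') (\<lambda>x y. arrow_part L' (F2 x y))"
    and F2_between: "\<lbrakk>x \<in> obs L; y \<in> obs L\<rbrakk> \<Longrightarrow>
      F2 x y \<in> mor_between L' \<langle>F0 x, F0 y\<rangle>\<^sub>O (F0 \<langle>x, y\<rangle>\<^sub>O\<^bsub>L\<^esub>)"
    and F2_natural: "\<lbrakk>f \<in> mors L; g \<in> mors L\<rbrakk> \<Longrightarrow>
      F2 (tgt L f) (tgt L g) \<diamondop> \<langle>F1 f, F1 g\<rangle>\<^sub>M
      = F1 \<langle>f, g\<rangle>\<^sub>M\<^bsub>L\<^esub> \<diamondop> F2 (src L f) (src L g)"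
    and F2_coherence: "\<lbrakk>x \<in> obs L; y \<in> obs L; z \<in> obs L\<rbrakk> \<Longrightarrow>
      F1 (J\<^bsub>L\<^esub> x y z) \<diamondop> F2 \<langle>x, y\<rangle>\<^sub>O\<^bsub>L\<^esub> z \<diamondop> \<langle>F2 x y, \<iota> (F0 z)\<rangle>\<^sub>M
      = (F2 x \<langle>y, z\<rangle>\<^sub>O\<^bsub>L\<^esub> \<oplus>\<^sub>M F2 \<langle>x, z\<rangle>\<^sub>O\<^bsub>L\<^esub> y)
      \<diamondop> (\<langle>\<iota> (F0 x), F2 y z\<rangle>\<^sub>M \<oplus>\<^sub>M \<langle>F2 x z, \<iota> (F0 y)\<rangle>\<^sub>M)
      \<diamondop> J (F0 x) (F0 y) (F0 z)"

locale rb_lie_two_homomorphism = lie_two_homomorphism K L' L F0 F1 F2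
  for K :: "('k, 'c) ring_scheme"
    and L' :: "('k, 'v, 'e) rb_lie_two_alg_scheme" (structure)
    and L :: "('k, 'v, 'd) rb_lie_two_alg_scheme"
    and F0 F1 :: "'v \<Rightarrow> 'v" and F2 :: "'v \<Rightarrow> 'v \<Rightarrow> 'v" +
  fixes F3 :: "'v \<Rightarrow> 'v"
  assumes F3_linear: "F3 \<in> module_hom K (Ob L) (Mor L')"
    and F3_between: "x \<in> obs L \<Longrightarrow> F3 x \<in> mor_between L' (P\<^sub>0 (F0 x)) (F0 (P\<^sub>0\<^bsub>L\<^esub> x))"
    and F3_natural: "f \<in> mors L \<Longrightarrow>
      F3 (tgt L f) \<diamondop> P\<^sub>1 (F1 f) = F1 (P\<^sub>1\<^bsub>L\<^esub> f) \<diamondop> F3 (src L f)"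
    and F3_coherence: "\<lbrakk>x \<in> obs L; y \<in> obs L\<rbrakk> \<Longrightarrow>
      (F3 \<langle>P\<^sub>0\<^bsub>L\<^esub> x, y\<rangle>\<^sub>O\<^bsub>L\<^esub> \<oplus>\<^sub>M F3 \<langle>x, P\<^sub>0\<^bsub>L\<^esub> y\<rangle>\<^sub>O\<^bsub>L\<^esub>)
      \<diamondop> (P\<^sub>1 (F2 (P\<^sub>0\<^bsub>L\<^esub> x) y) \<oplus>\<^sub>M P\<^sub>1 (F2 x (P\<^sub>0\<^bsub>L\<^esub> y)))
      \<diamondop> (P\<^sub>1 \<langle>F3 x, \<iota> (F0 y)\<rangle>\<^sub>M \<oplus>\<^sub>M P\<^sub>1 \<langle>\<iota> (F0 x), F3 y\<rangle>\<^sub>M)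
      \<diamondop> \<R> (F0 x) (F0 y)
      = F1 (\<R>\<^bsub>L\<^esub> x y) \<diamondop> F2 (P\<^sub>0\<^bsub>L\<^esub> x) (P\<^sub>0\<^bsub>L\<^esub> y) \<diamondop> \<langle>F3 x, F3 y\<rangle>\<^sub>M"


section \<open>2-term Rota-Baxter L-infinity-algebras\<close>

record ('k, 'v) two_term =
  G0 :: "('k, 'v) module"
  G1 :: "('k, 'v) module"
  diff :: "'v \<Rightarrow> 'v" (\<open>l\<^sub>1\<index>\<close>)
  br00 :: "'v \<Rightarrow> 'v \<Rightarrow> 'v" (\<open>\<lbrakk>_, _\<rbrakk>\<^sub>0\<^sub>0\<index>\<close>)
  br01 :: "'v \<Rightarrow> 'v \<Rightarrow> 'v" (\<open>\<lbrakk>_, _\<rbrakk>\<^sub>0\<^sub>1\<index>\<close>)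
  tern :: "'v \<Rightarrow> 'v \<Rightarrow> 'v \<Rightarrow> 'v" (\<open>l\<^sub>3\<index>\<close>)

text \<open>The subscripts of a bracket are the degrees of its arguments.\<close>

abbreviation br10 (\<open>\<lbrakk>_, _\<rbrakk>\<^sub>1\<^sub>0\<index>\<close>) where "\<lbrakk>u, x\<rbrakk>\<^sub>1\<^sub>0\<^bsub>G\<^esub> \<equiv> \<ominus>\<^bsub>G1 G\<^esub> \<lbrakk>x, u\<rbrakk>\<^sub>0\<^sub>1\<^bsub>G\<^esub>"

abbreviation g0_add (infixl \<open>\<oplus>\<^sub>0\<index>\<close> 65) where "x \<oplus>\<^sub>0\<^bsub>G\<^esub> y \<equiv> x \<oplus>\<^bsub>G0 G\<^esub> y"
abbreviation g0_diff (infixl \<open>\<ominus>\<^sub>0\<index>\<close> 65) where "x \<ominus>\<^sub>0\<^bsub>G\<^esub> y \<equiv> x \<ominus>\<^bsub>G0 G\<^esub> y"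
abbreviation g1_add (infixl \<open>\<oplus>\<^sub>1\<index>\<close> 65) where "u \<oplus>\<^sub>1\<^bsub>G\<^esub> v \<equiv> u \<oplus>\<^bsub>G1 G\<^esub> v"
abbreviation g1_diff (infixl \<open>\<ominus>\<^sub>1\<index>\<close> 65) where "u \<ominus>\<^sub>1\<^bsub>G\<^esub> v \<equiv> u \<ominus>\<^bsub>G1 G\<^esub> v"

abbreviation deg0 where "deg0 G \<equiv> carrier (G0 G)"
abbreviation deg1 where "deg1 G \<equiv> carrier (G1 G)"

locale two_term_linf_algebra =
  fixes K :: "('k, 'c) ring_scheme" and G :: "('k, 'v, 'd) two_term_scheme" (structure)
  assumes G0_space: "fd_vectorspace K (G0 G)"
    and G1_space: "fd_vectorspace K (G1 G)"
    and diff_linear: "diff G \<in> module_hom K (G1 G) (G0 G)"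
    and br00_bilinear: "bilinear_map K (G0 G) (G0 G) (G0 G) (br00 G)"
    and br00_skew: "skew2 (G0 G) (G0 G) (br00 G)"
    and br01_bilinear: "bilinear_map K (G0 G) (G1 G) (G1 G) (br01 G)"
    and tern_trilinear: "trilinear_map K (G0 G) (G1 G) (tern G)"
    and tern_skew: "skew3 (G0 G) (G1 G) (tern G)"
    and diff_br: "\<lbrakk>x \<in> deg0 G; u \<in> deg1 G\<rbrakk> \<Longrightarrow> l\<^sub>1 \<lbrakk>x, u\<rbrakk>\<^sub>0\<^sub>1 = \<lbrakk>x, l\<^sub>1 u\<rbrakk>\<^sub>0\<^sub>0"
    and br_diff: "\<lbrakk>u \<in> deg1 G; v \<in> deg1 G\<rbrakk> \<Longrightarrow> \<lbrakk>l\<^sub>1 u, v\<rbrakk>\<^sub>0\<^sub>1 = \<lbrakk>u, l\<^sub>1 v\<rbrakk>\<^sub>1\<^sub>0"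
    and diff_tern: "\<lbrakk>x \<in> deg0 G; y \<in> deg0 G; z \<in> deg0 G\<rbrakk> \<Longrightarrow>
      l\<^sub>1 (l\<^sub>3 x y z) = \<lbrakk>x, \<lbrakk>y, z\<rbrakk>\<^sub>0\<^sub>0\<rbrakk>\<^sub>0\<^sub>0 \<oplus>\<^sub>0 \<lbrakk>z, \<lbrakk>x, y\<rbrakk>\<^sub>0\<^sub>0\<rbrakk>\<^sub>0\<^sub>0 \<oplus>\<^sub>0 \<lbrakk>y, \<lbrakk>z, x\<rbrakk>\<^sub>0\<^sub>0\<rbrakk>\<^sub>0\<^sub>0"
    and tern_diff: "\<lbrakk>x \<in> deg0 G; y \<in> deg0 G; u \<in> deg1 G\<rbrakk> \<Longrightarrow>
      l\<^sub>3 x y (l\<^sub>1 u) = \<lbrakk>x, \<lbrakk>y, u\<rbrakk>\<^sub>0\<^sub>1\<rbrakk>\<^sub>0\<^sub>1 \<oplus>\<^sub>1 \<lbrakk>u, \<lbrakk>x, y\<rbrakk>\<^sub>0\<^sub>0\<rbrakk>\<^sub>1\<^sub>0 \<oplus>\<^sub>1 \<lbrakk>y, \<lbrakk>u, x\<rbrakk>\<^sub>1\<^sub>0\<rbrakk>\<^sub>0\<^sub>1"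
    \<comment> \<open>The signs are \<open>(-1)\<^sup>i\<^sup>+\<^sup>1\<close> in the first sum and \<open>(-1)\<^sup>i\<^sup>+\<^sup>j\<close> in the second.\<close>
    and tern_coherence:
      "\<lbrakk>x1 \<in> deg0 G; x2 \<in> deg0 G; x3 \<in> deg0 G; x4 \<in> deg0 G\<rbrakk> \<Longrightarrow>
      (\<lbrakk>x1, l\<^sub>3 x2 x3 x4\<rbrakk>\<^sub>0\<^sub>1 \<ominus>\<^sub>1 \<lbrakk>x2, l\<^sub>3 x1 x3 x4\<rbrakk>\<^sub>0\<^sub>1
        \<oplus>\<^sub>1 \<lbrakk>x3, l\<^sub>3 x1 x2 x4\<rbrakk>\<^sub>0\<^sub>1 \<ominus>\<^sub>1 \<lbrakk>x4, l\<^sub>3 x1 x2 x3\<rbrakk>\<^sub>0\<^sub>1)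
      \<oplus>\<^sub>1 (\<ominus>\<^bsub>G1 G\<^esub> l\<^sub>3 \<lbrakk>x1, x2\<rbrakk>\<^sub>0\<^sub>0 x3 x4 \<oplus>\<^sub>1 l\<^sub>3 \<lbrakk>x1, x3\<rbrakk>\<^sub>0\<^sub>0 x2 x4 \<ominus>\<^sub>1 l\<^sub>3 \<lbrakk>x1, x4\<rbrakk>\<^sub>0\<^sub>0 x2 x3
        \<ominus>\<^sub>1 l\<^sub>3 \<lbrakk>x2, x3\<rbrakk>\<^sub>0\<^sub>0 x1 x4 \<oplus>\<^sub>1 l\<^sub>3 \<lbrakk>x2, x4\<rbrakk>\<^sub>0\<^sub>0 x1 x3 \<ominus>\<^sub>1 l\<^sub>3 \<lbrakk>x3, x4\<rbrakk>\<^sub>0\<^sub>0 x1 x2)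
      = \<zero>\<^bsub>G1 G\<^esub>"

record ('k, 'v) rb_two_term = "('k, 'v) two_term" +
  rop0 :: "'v \<Rightarrow> 'v" (\<open>R\<^sub>0\<index>\<close>)
  rop1 :: "'v \<Rightarrow> 'v" (\<open>R\<^sub>1\<index>\<close>)
  rop2 :: "'v \<Rightarrow> 'v \<Rightarrow> 'v" (\<open>R\<^sub>2\<index>\<close>)

definition rop_cyclic_summand ::
  "('k, 'v, 'd) rb_two_term_scheme \<Rightarrow> 'v \<Rightarrow> 'v \<Rightarrow> 'v \<Rightarrow> 'v" where
  "rop_cyclic_summand G x1 x2 x3 =
    \<lbrakk>R\<^sub>0 x1, R\<^sub>2 x2 x3\<rbrakk>\<^sub>0\<^sub>1
    \<oplus>\<^sub>1 R\<^sub>2 x3 (\<lbrakk>R\<^sub>0 x1, x2\<rbrakk>\<^sub>0\<^sub>0 \<ominus>\<^sub>0 \<lbrakk>R\<^sub>0 x2, x1\<rbrakk>\<^sub>0\<^sub>0)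
    \<oplus>\<^sub>1 R\<^sub>1 (\<lbrakk>R\<^sub>2 x2 x3, x1\<rbrakk>\<^sub>1\<^sub>0 \<ominus>\<^sub>1 l\<^sub>3 (R\<^sub>0 x2) (R\<^sub>0 x3) x1)" for G (structure)

locale rb_two_term_linf_algebra = two_term_linf_algebra K G
  for K :: "('k, 'c) ring_scheme" and G :: "('k, 'v, 'd) rb_two_term_scheme" (structure) +
  assumes rop0_linear: "rop0 G \<in> module_hom K (G0 G) (G0 G)"
    and rop1_linear: "rop1 G \<in> module_hom K (G1 G) (G1 G)"
    and diff_rop: "u \<in> deg1 G \<Longrightarrow> l\<^sub>1 (R\<^sub>1 u) = R\<^sub>0 (l\<^sub>1 u)"
    and rop2_bilinear: "bilinear_map K (G0 G) (G0 G) (G1 G) (rop2 G)"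
    and rop2_skew: "skew2 (G0 G) (G1 G) (rop2 G)"
    and rop_br00: "\<lbrakk>x \<in> deg0 G; y \<in> deg0 G\<rbrakk> \<Longrightarrow>
      R\<^sub>0 (\<lbrakk>R\<^sub>0 x, y\<rbrakk>\<^sub>0\<^sub>0 \<oplus>\<^sub>0 \<lbrakk>x, R\<^sub>0 y\<rbrakk>\<^sub>0\<^sub>0) \<ominus>\<^sub>0 \<lbrakk>R\<^sub>0 x, R\<^sub>0 y\<rbrakk>\<^sub>0\<^sub>0 = l\<^sub>1 (R\<^sub>2 x y)"
    and rop_br10: "\<lbrakk>u \<in> deg1 G; x \<in> deg0 G\<rbrakk> \<Longrightarrow>
      R\<^sub>1 (\<lbrakk>R\<^sub>1 u, x\<rbrakk>\<^sub>1\<^sub>0 \<oplus>\<^sub>1 \<lbrakk>u, R\<^sub>0 x\<rbrakk>\<^sub>1\<^sub>0) \<ominus>\<^sub>1 \<lbrakk>R\<^sub>1 u, R\<^sub>0 x\<rbrakk>\<^sub>1\<^sub>0 = R\<^sub>2 (l\<^sub>1 u) x"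
    and rop_coherence: "\<lbrakk>x1 \<in> deg0 G; x2 \<in> deg0 G; x3 \<in> deg0 G\<rbrakk> \<Longrightarrow>
      rop_cyclic_summand G x1 x2 x3 \<oplus>\<^sub>1 rop_cyclic_summand G x2 x3 x1
        \<oplus>\<^sub>1 rop_cyclic_summand G x3 x1 x2 \<oplus>\<^sub>1 l\<^sub>3 (R\<^sub>0 x1) (R\<^sub>0 x2) (R\<^sub>0 x3)
      = \<zero>\<^bsub>G1 G\<^esub>"


section \<open>Homomorphisms of 2-term Rota-Baxter L-infinity-algebras\<close>

locale linf_homomorphism =
  fixes K :: "('k, 'c) ring_scheme"
    and G' :: "('k, 'v, 'e) two_term_scheme" (structure)
    and G :: "('k, 'v, 'd) two_term_scheme"
    and \<phi>0 \<phi>1 :: "'v \<Rightarrow> 'v" and \<phi>2 :: "'v \<Rightarrow> 'v \<Rightarrow> 'v"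
  assumes \<phi>0_linear: "\<phi>0 \<in> module_hom K (G0 G) (G0 G')"
    and \<phi>1_linear: "\<phi>1 \<in> module_hom K (G1 G) (G1 G')"
    and \<phi>_diff: "u \<in> deg1 G \<Longrightarrow> l\<^sub>1 (\<phi>1 u) = \<phi>0 (l\<^sub>1\<^bsub>G\<^esub> u)"
    and \<phi>2_bilinear: "bilinear_map K (G0 G) (G0 G) (G1 G') \<phi>2"
    and \<phi>2_skew: "skew2 (G0 G) (G1 G') \<phi>2"
    and diff_\<phi>2: "\<lbrakk>x \<in> deg0 G; y \<in> deg0 G\<rbrakk> \<Longrightarrow>
      l\<^sub>1 (\<phi>2 x y) = \<phi>0 \<lbrakk>x, y\<rbrakk>\<^sub>0\<^sub>0\<^bsub>G\<^esub> \<ominus>\<^sub>0 \<lbrakk>\<phi>0 x, \<phi>0 y\<rbrakk>\<^sub>0\<^sub>0"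
    and \<phi>2_diff: "\<lbrakk>x \<in> deg0 G; u \<in> deg1 G\<rbrakk> \<Longrightarrow>
      \<phi>2 x (l\<^sub>1\<^bsub>G\<^esub> u) = \<phi>1 \<lbrakk>x, u\<rbrakk>\<^sub>0\<^sub>1\<^bsub>G\<^esub> \<ominus>\<^sub>1 \<lbrakk>\<phi>0 x, \<phi>1 u\<rbrakk>\<^sub>0\<^sub>1"
    and \<phi>2_coherence: "\<lbrakk>x \<in> deg0 G; y \<in> deg0 G; z \<in> deg0 G\<rbrakk> \<Longrightarrow>
      \<lbrakk>\<phi>2 x y, \<phi>0 z\<rbrakk>\<^sub>1\<^sub>0 \<oplus>\<^sub>1 \<phi>2 \<lbrakk>x, y\<rbrakk>\<^sub>0\<^sub>0\<^bsub>G\<^esub> z \<oplus>\<^sub>1 \<phi>1 (l\<^sub>3\<^bsub>G\<^esub> x y z)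
      = l\<^sub>3 (\<phi>0 x) (\<phi>0 y) (\<phi>0 z) \<oplus>\<^sub>1 \<lbrakk>\<phi>0 x, \<phi>2 y z\<rbrakk>\<^sub>0\<^sub>1 \<oplus>\<^sub>1 \<lbrakk>\<phi>2 x z, \<phi>0 y\<rbrakk>\<^sub>1\<^sub>0
        \<oplus>\<^sub>1 \<phi>2 x \<lbrakk>y, z\<rbrakk>\<^sub>0\<^sub>0\<^bsub>G\<^esub> \<oplus>\<^sub>1 \<phi>2 \<lbrakk>x, z\<rbrakk>\<^sub>0\<^sub>0\<^bsub>G\<^esub> y"

text \<open>Elements \<open>a, b\<close> of degree 0 and \<open>u, v\<close> of degree 1 give arrows \<open>u : a \<rightarrow> a + l\<^sub>1 u\<close> and
  \<open>v : b \<rightarrow> b + l\<^sub>1 v\<close> of the Lie 2-algebra on \<open>\<gg>\<^sub>0\<close> and \<open>\<gg>\<^sub>0 \<oplus> \<gg>\<^sub>1\<close>. The bracket of these arrows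
  starts at \<open>[a, b]\<close>; by functoriality of the bracket its arrow part is
  \<open>[u, b] + [a + l\<^sub>1 u, v]\<close>, which is also \<open>[u, b + l\<^sub>1 v] + [a, v]\<close>.\<close>

definition arrow_br ::
  "('k, 'v, 'd) two_term_scheme \<Rightarrow> 'v \<Rightarrow> 'v \<Rightarrow> 'v \<Rightarrow> 'v \<Rightarrow> 'v" where
  "arrow_br G a u b v = \<lbrakk>u, b\<rbrakk>\<^sub>1\<^sub>0 \<oplus>\<^sub>1 \<lbrakk>a \<oplus>\<^sub>0 l\<^sub>1 u, v\<rbrakk>\<^sub>0\<^sub>1" for G (structure)

text \<open>In the last condition below, the usual notation for the first term on the right is
  \<open>[\<phi>\<^sub>3(x), \<phi>\<^sub>3(y)]\<close>. It is the bracket of the arrows \<open>\<phi>\<^sub>3(x) : R'\<^sub>0(\<phi>\<^sub>0 x) \<rightarrow> \<phi>\<^sub>0(R\<^sub>0 x)\<close> and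
  \<open>\<phi>\<^sub>3(y)\<close>, equal to \<open>[\<phi>\<^sub>3 x, R'\<^sub>0 \<phi>\<^sub>0 y] + [\<phi>\<^sub>0 R\<^sub>0 x, \<phi>\<^sub>3 y]\<close>. It must not be read as \<open>l\<^sub>2(u, v) = 0\<close>
  for \<open>u, v\<close> of degree 1: the homomorphisms would then not be closed under composition.\<close>

locale rb_linf_homomorphism = linf_homomorphism K G' G \<phi>0 \<phi>1 \<phi>2
  for K :: "('k, 'c) ring_scheme"
    and G' :: "('k, 'v, 'e) rb_two_term_scheme" (structure)
    and G :: "('k, 'v, 'd) rb_two_term_scheme"
    and \<phi>0 \<phi>1 :: "'v \<Rightarrow> 'v" and \<phi>2 :: "'v \<Rightarrow> 'v \<Rightarrow> 'v" +
  fixes \<phi>3 :: "'v \<Rightarrow> 'v"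
  assumes \<phi>3_linear: "\<phi>3 \<in> module_hom K (G0 G) (G1 G')"
    and diff_\<phi>3: "x \<in> deg0 G \<Longrightarrow> l\<^sub>1 (\<phi>3 x) = \<ominus>\<^bsub>G0 G'\<^esub> R\<^sub>0 (\<phi>0 x) \<oplus>\<^sub>0 \<phi>0 (R\<^sub>0\<^bsub>G\<^esub> x)"
    and \<phi>3_diff: "u \<in> deg1 G \<Longrightarrow> \<phi>3 (l\<^sub>1\<^bsub>G\<^esub> u) = \<phi>1 (R\<^sub>1\<^bsub>G\<^esub> u) \<ominus>\<^sub>1 R\<^sub>1 (\<phi>1 u)"
    and \<phi>3_coherence: "\<lbrakk>x \<in> deg0 G; y \<in> deg0 G\<rbrakk> \<Longrightarrow>
      R\<^sub>2 (\<phi>0 x) (\<phi>0 y) \<oplus>\<^sub>1 R\<^sub>1 \<lbrakk>\<phi>3 x, \<phi>0 y\<rbrakk>\<^sub>1\<^sub>0 \<oplus>\<^sub>1 R\<^sub>1 \<lbrakk>\<phi>0 x, \<phi>3 y\<rbrakk>\<^sub>0\<^sub>1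
        \<oplus>\<^sub>1 R\<^sub>1 (\<phi>2 (R\<^sub>0\<^bsub>G\<^esub> x) y) \<oplus>\<^sub>1 R\<^sub>1 (\<phi>2 x (R\<^sub>0\<^bsub>G\<^esub> y))
        \<oplus>\<^sub>1 \<phi>3 \<lbrakk>R\<^sub>0\<^bsub>G\<^esub> x, y\<rbrakk>\<^sub>0\<^sub>0\<^bsub>G\<^esub> \<oplus>\<^sub>1 \<phi>3 \<lbrakk>x, R\<^sub>0\<^bsub>G\<^esub> y\<rbrakk>\<^sub>0\<^sub>0\<^bsub>G\<^esub>
      = arrow_br G' (R\<^sub>0 (\<phi>0 x)) (\<phi>3 x) (R\<^sub>0 (\<phi>0 y)) (\<phi>3 y)
        \<oplus>\<^sub>1 \<phi>2 (R\<^sub>0\<^bsub>G\<^esub> x) (R\<^sub>0\<^bsub>G\<^esub> y) \<oplus>\<^sub>1 \<phi>1 (R\<^sub>2\<^bsub>G\<^esub> x y)"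


section \<open>The two categories\<close>

text \<open>The objects are all structures whose underlying vector spaces have their carriers in the
  universe \<open>'v\<close>, an arbitrary type. Both kinds of homomorphism are quadruples of maps, made
  \<^const>\<open>undefined\<close> outside the carriers so that equality of homomorphisms is equality of maps
  on the carriers.\<close>

record 'v hom_maps =
  map0 :: "'v \<Rightarrow> 'v"
  map1 :: "'v \<Rightarrow> 'v"
  map2 :: "'v \<Rightarrow> 'v \<Rightarrow> 'v"
  map3 :: "'v \<Rightarrow> 'v"

definition restrict_maps :: "'v set \<Rightarrow> 'v set \<Rightarrow> 'v hom_maps \<Rightarrow> 'v hom_maps" where
  "restrict_maps A B F =
    \<lparr>map0 = restrict (map0 F) A, map1 = restrict (map1 F) B,
     map2 = (\<lambda>x y. if x \<in> A \<and> y \<in> A then map2 F x y else undefined),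
     map3 = restrict (map3 F) A\<rparr>"

definition RBLie2Alg ::
  "('k, 'c) ring_scheme \<Rightarrow> (('k, 'v) rb_lie_two_alg, 'v hom_maps) cat" where
  "RBLie2Alg K =
    \<lparr>cat_obj = {L. rb_lie_two_algebra K L},
     cat_hom = (\<lambda>L L'. {F. rb_lie_two_homomorphism K L' L (map0 F) (map1 F) (map2 F) (map3 F)
       \<and> restrict_maps (obs L) (mors L) F = F}),
     cat_id = (\<lambda>L. restrict_maps (obs L) (mors L)
       \<lparr>map0 = (\<lambda>x. x), map1 = (\<lambda>f. f), map2 = (\<lambda>x y. \<iota>\<^bsub>L\<^esub> \<langle>x, y\<rangle>\<^sub>O\<^bsub>L\<^esub>),
        map3 = (\<lambda>x. \<iota>\<^bsub>L\<^esub> (P\<^sub>0\<^bsub>L\<^esub> x))\<rparr>),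
     cat_comp = (\<lambda>L L' L'' G F. restrict_maps (obs L) (mors L)
       \<lparr>map0 = (\<lambda>x. map0 G (map0 F x)), map1 = (\<lambda>f. map1 G (map1 F f)),
        map2 = (\<lambda>x y. map1 G (map2 F x y) \<diamondop>\<^bsub>L''\<^esub> map2 G (map0 F x) (map0 F y)),
        map3 = (\<lambda>x. map1 G (map3 F x) \<diamondop>\<^bsub>L''\<^esub> map3 G (map0 F x))\<rparr>)\<rparr>"

definition TwoTermRBL ::
  "('k, 'c) ring_scheme \<Rightarrow> (('k, 'v) rb_two_term, 'v hom_maps) cat" where
  "TwoTermRBL K =
    \<lparr>cat_obj = {G. rb_two_term_linf_algebra K G},
     cat_hom = (\<lambda>G G'. {\<phi>. rb_linf_homomorphism K G' G (map0 \<phi>) (map1 \<phi>) (map2 \<phi>) (map3 \<phi>)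
       \<and> restrict_maps (deg0 G) (deg1 G) \<phi> = \<phi>}),
     cat_id = (\<lambda>G. restrict_maps (deg0 G) (deg1 G)
       \<lparr>map0 = (\<lambda>x. x), map1 = (\<lambda>u. u), map2 = (\<lambda>x y. \<zero>\<^bsub>G1 G\<^esub>), map3 = (\<lambda>x. \<zero>\<^bsub>G1 G\<^esub>)\<rparr>),
     cat_comp = (\<lambda>G G' G'' \<psi> \<phi>. restrict_maps (deg0 G) (deg1 G)
       \<lparr>map0 = (\<lambda>x. map0 \<psi> (map0 \<phi> x)), map1 = (\<lambda>u. map1 \<psi> (map1 \<phi> u)),
        map2 = (\<lambda>x y. map2 \<psi> (map0 \<phi> x) (map0 \<phi> y) \<oplus>\<^sub>1\<^bsub>G''\<^esub> map1 \<psi> (map2 \<phi> x y)),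
        map3 = (\<lambda>x. map3 \<psi> (map0 \<phi> x) \<oplus>\<^sub>1\<^bsub>G''\<^esub> map1 \<psi> (map3 \<phi> x))\<rparr>)\<rparr>"

end

theory Submission
  imports Defs
begin

text \<open>An arrow \<open>f\<close> of a 2-vector space is determined by its source and its arrow part
  \<open>f - i (s f)\<close>, and linearity of the composition forces \<open>g f = g + f - i (t f)\<close>, so that
  arrow parts add up under composition. Taking arrow parts therefore turns every naturality
  condition and every coherence law of Rota-Baxter Lie 2-algebras into a linear identity in
  \<open>ker s\<close>, and these are exactly the laws of a 2-term Rota-Baxter \<open>L\<^sub>\<infinity>\<close>-algebra on
  \<open>\<gg>\<^sub>0 = L\<^sub>0\<close>, \<open>\<gg>\<^sub>1 = ker s\<close>. The same dictionary is a bijection on homomorphisms. Conversely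
  \<open>\<gg>\<^sub>0\<close> and \<open>\<gg>\<^sub>0 \<oplus> \<gg>\<^sub>1\<close> carry a Lie 2-algebra that is sent back to an isomorphic copy of \<open>\<gg>\<close>.

  In characteristic 0 the additive maps to the rationals separate the points of a vector space, so
  each linear identity is checked as a linear identity between rational numbers.\<close>

text \<open>The category axioms are checked only on the 2-term side. Identities and composition of
  \<open>RBLie2Alg\<close> turn out to be the ones transported along the bijections on hom-sets, so
  its axioms follow by faithfulness.

  The two directions are not symmetric. Passing to \<open>ker s\<close> stays inside the given
  morphism space, whereas the way back needs a space of pairs whose elements lie again in the type
  of the carriers. An encoding of pairs is therefore chosen separately for each 2-term algebra,
  which suffices for essential surjectivity.

  The delicate term is \<open>[\<phi>3 x, \<phi>3 y]\<close>, a bracket of arrows. Its arrow part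
  has two expressions, and the relation \<open>[l\<^sub>1 u, v] = [u, l\<^sub>1 v]\<close>
  reconciles them; the same relation gives the interchange law and the skewness of the bracket on
  pairs, and closure under composition.

  Rational functionals serve every ground field, because the identities to be checked have integer
  coefficients. Scalars of the field enter through the linearity clauses and through the absence of
  torsion.\<close>

section \<open>Equivalences from fully faithful, essentially surjective functors\<close>

text \<open>Only \<open>D\<close> is assumed to be a category. \<open>Tm\<close> and
  \<open>Um\<close> are inverse bijections on hom-sets, and \<open>ident\<close> and
  \<open>comp\<close> say that \<open>C\<close> carries the structure pulled back from
  \<open>D\<close>; hence each law of \<open>C\<close> can be tested after applying
  \<open>Tm\<close>. The quasi-inverse comes from choosing, for each object of \<open>D\<close>, a
  preimage up to isomorphism.\<close>

lemma equivalent_categoriesI: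
  fixes C :: "('o, 'm) cat" and D :: "('p, 'n) cat"
  assumes D: "category D"
    and obj: "\<And>a. a \<in> cat_obj C \<Longrightarrow> T a \<in> cat_obj D"
    and hom: "\<And>a b f. \<lbrakk>a \<in> cat_obj C; b \<in> cat_obj C; f \<in> cat_hom C a b\<rbrakk>
      \<Longrightarrow> Tm a b f \<in> cat_hom D (T a) (T b)"
    and inv_hom: "\<And>a b g. \<lbrakk>a \<in> cat_obj C; b \<in> cat_obj C; g \<in> cat_hom D (T a) (T b)\<rbrakk>
      \<Longrightarrow> Um a b g \<in> cat_hom C a b"
    and UT: "\<And>a b f. \<lbrakk>a \<in> cat_obj C; b \<in> cat_obj C; f \<in> cat_hom C a b\<rbrakk>
      \<Longrightarrow> Um a b (Tm a b f) = f"
    and TU: "\<And>a b g. \<lbrakk>a \<in> cat_obj C; b \<in> cat_obj C; g \<in> cat_hom D (T a) (T b)\<rbrakk>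
      \<Longrightarrow> Tm a b (Um a b g) = g"
    and ident: "\<And>a. a \<in> cat_obj C \<Longrightarrow> cat_id C a = Um a a (cat_id D (T a))"
    and comp: "\<And>a b c f g. \<lbrakk>a \<in> cat_obj C; b \<in> cat_obj C; c \<in> cat_obj C;
        f \<in> cat_hom C a b; g \<in> cat_hom C b c\<rbrakk>
      \<Longrightarrow> cat_comp C a b c g f = Um a c (cat_comp D (T a) (T b) (T c) (Tm b c g) (Tm a b f))"
    and surj: "\<And>d. d \<in> cat_obj D \<Longrightarrow> \<exists>a \<in> cat_obj C. \<exists>f. cat_iso D (T a) d f"
  shows "equivalent_categories C D"
proof -
  interpret D: category D by (fact D)
  have Tid: "Tm a a (cat_id C a) = cat_id D (T a)" if "a \<in> cat_obj C" for a
    using that by (simp add: ident TU D.id_hom obj)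
  have Tcomp: "Tm a c (cat_comp C a b c g f)
      = cat_comp D (T a) (T b) (T c) (Tm b c g) (Tm a b f)"
    if "a \<in> cat_obj C" "b \<in> cat_obj C" "c \<in> cat_obj C" "f \<in> cat_hom C a b" "g \<in> cat_hom C b c"
    for a b c f g
    using that by (simp add: comp TU D.comp_hom[of _ "T b"] obj hom)
  have Ccomp: "cat_comp C a b c g f \<in> cat_hom C a c"
    if "a \<in> cat_obj C" "b \<in> cat_obj C" "c \<in> cat_obj C" "f \<in> cat_hom C a b" "g \<in> cat_hom C b c"
    for a b c f g
    using that by (simp add: comp inv_hom D.comp_hom[of _ "T b"] obj hom)
  have Cid: "cat_id C a \<in> cat_hom C a a" if "a \<in> cat_obj C" for a
    using that by (simp add: ident inv_hom D.id_hom obj)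
  have faithful: "f = g" if "a \<in> cat_obj C" "b \<in> cat_obj C" "f \<in> cat_hom C a b"
    "g \<in> cat_hom C a b" "Tm a b f = Tm a b g" for a b f g
    using that UT by metis
  interpret C: category C
  proof
    fix a b f assume *: "a \<in> cat_obj C" "b \<in> cat_obj C" "f \<in> cat_hom C a b"
    show "cat_comp C a b b (cat_id C b) f = f"
      by (rule faithful[of a b]) (simp_all add: * Cid Ccomp Tcomp Tid D.id_left obj hom)
    show "cat_comp C a a b f (cat_id C a) = f"
      by (rule faithful[of a b]) (simp_all add: * Cid Ccomp Tcomp Tid D.id_right obj hom)
  next
    fix a b c d f g h
    assume *: "a \<in> cat_obj C" "b \<in> cat_obj C" "c \<in> cat_obj C" "d \<in> cat_obj C"
      "f \<in> cat_hom C a b" "g \<in> cat_hom C b c" "h \<in> cat_hom C c d"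
    show "cat_comp C a b d (cat_comp C b c d h g) f = cat_comp C a c d h (cat_comp C a b c g f)"
      by (rule faithful[of a d])
        (simp_all add: * Ccomp[of b c d] Ccomp[of a b c] Ccomp[of a b d] Ccomp[of a c d] Tcomp
          D.assoc[of "T a" "T b" "T c" "T d"] obj hom)
  qed (simp_all add: Cid Ccomp)
  obtain Go where Go: "\<And>d. d \<in> cat_obj D \<Longrightarrow> Go d \<in> cat_obj C \<and> (\<exists>f. cat_iso D (T (Go d)) d f)"
    using surj by metis
  then obtain \<epsilon> where eps: "\<And>d. d \<in> cat_obj D \<Longrightarrow> cat_iso D (T (Go d)) d (\<epsilon> d)"
    by metis
  then obtain \<delta> where del: "\<And>d. d \<in> cat_obj D \<Longrightarrow> \<delta> d \<in> cat_hom D d (T (Go d))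
      \<and> cat_comp D (T (Go d)) d (T (Go d)) (\<delta> d) (\<epsilon> d) = cat_id D (T (Go d))
      \<and> cat_comp D d (T (Go d)) d (\<epsilon> d) (\<delta> d) = cat_id D d"
    unfolding cat_iso_def by metis
  have Go_obj: "Go d \<in> cat_obj C" if "d \<in> cat_obj D" for d using Go that by simp
  have eps_hom: "\<epsilon> d \<in> cat_hom D (T (Go d)) d" if "d \<in> cat_obj D" for d
    using eps that by (simp add: cat_iso_def)
  \<comment> \<open>Conjugation of \<open>f\<close> by the chosen isomorphisms: this is forced if
    \<open>\<epsilon>\<close> is to be natural.\<close>
  define Gt where "Gt d e f = cat_comp D (T (Go d)) d (T (Go e))
      (cat_comp D d e (T (Go e)) (\<delta> e) f) (\<epsilon> d)" for d e f
  define Gm where "Gm d e f = Um (Go d) (Go e) (Gt d e f)" for d e f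
  \<comment> \<open>The inverse of the counit at \<open>T a\<close> is an arrow between objects in
    the image of \<open>T\<close>, so fullness provides the arrow of \<open>C\<close> that serves as
    unit.\<close>
  define \<eta> where "\<eta> a = Um a (Go (T a)) (\<delta> (T a))" for a
  have Gt_hom: "Gt d e f \<in> cat_hom D (T (Go d)) (T (Go e))"
    if "d \<in> cat_obj D" "e \<in> cat_obj D" "f \<in> cat_hom D d e" for d e f
    using that
    by (simp add: Gt_def D.comp_hom[of _ d] D.comp_hom[of _ e] obj Go_obj eps_hom del)
  have Gm_hom: "Gm d e f \<in> cat_hom C (Go d) (Go e)"
    if "d \<in> cat_obj D" "e \<in> cat_obj D" "f \<in> cat_hom D d e" for d e f
    using that by (simp add: Gm_def inv_hom Go_obj Gt_hom)
  have TGm: "Tm (Go d) (Go e) (Gm d e f) = Gt d e f"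
    if "d \<in> cat_obj D" "e \<in> cat_obj D" "f \<in> cat_hom D d e" for d e f
    using that by (simp add: Gm_def TU Go_obj Gt_hom)
  have Gt_nat: "cat_comp D (T (Go d)) (T (Go e)) e (\<epsilon> e) (Gt d e f)
      = cat_comp D (T (Go d)) d e f (\<epsilon> d)"
    if "d \<in> cat_obj D" "e \<in> cat_obj D" "f \<in> cat_hom D d e" for d e f
  proof -
    have "cat_comp D (T (Go d)) (T (Go e)) e (\<epsilon> e) (Gt d e f)
        = cat_comp D (T (Go d)) d e (cat_comp D d (T (Go e)) e (\<epsilon> e)
            (cat_comp D d e (T (Go e)) (\<delta> e) f)) (\<epsilon> d)"
      unfolding Gt_def using that
      by (intro D.assoc[symmetric]) (simp_all add: D.comp_hom[of _ e] obj Go_obj eps_hom del)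
    also have "cat_comp D d (T (Go e)) e (\<epsilon> e) (cat_comp D d e (T (Go e)) (\<delta> e) f)
        = cat_comp D d e e (cat_comp D e (T (Go e)) e (\<epsilon> e) (\<delta> e)) f"
      using that by (intro D.assoc[symmetric]) (simp_all add: obj Go_obj eps_hom del)
    finally show ?thesis using that by (simp add: del D.id_left)
  qed
  \<comment> \<open>Each counit component is left cancellable, having the left inverse
    \<open>\<delta> d\<close>. Functoriality of \<open>Gt\<close> can therefore be tested after
    composition with the counit, where \<open>Gt_nat\<close> reduces it to associativity.\<close>
  have mono: "f = g"
    if "d \<in> cat_obj D" "x \<in> cat_obj D" "f \<in> cat_hom D x (T (Go d))" "g \<in> cat_hom D x (T (Go d))"
      "cat_comp D x (T (Go d)) d (\<epsilon> d) f = cat_comp D x (T (Go d)) d (\<epsilon> d) g" for d x f g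
  proof -
    have "cat_comp D x d (T (Go d)) (\<delta> d) (cat_comp D x (T (Go d)) d (\<epsilon> d) h) = h"
      if "h \<in> cat_hom D x (T (Go d))" for h
      using that \<open>d \<in> cat_obj D\<close> \<open>x \<in> cat_obj D\<close>
      by (subst D.assoc[symmetric]) (simp_all add: obj Go_obj eps_hom del D.id_left)
    with that show ?thesis by metis
  qed
  have Tfun: "cat_functor C D T Tm"
    by standard (simp_all add: obj hom Tid Tcomp)
  have Gfun: "cat_functor D C Go Gm"
  proof
    fix d assume d: "d \<in> cat_obj D"
    have "Gt d d (cat_id D d) = cat_id D (T (Go d))"
      using d by (simp add: Gt_def del D.id_right obj Go_obj)
    then show "Gm d d (cat_id D d) = cat_id C (Go d)"
      using d by (simp add: Gm_def ident Go_obj)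
  next
    fix d e x f g
    assume *: "d \<in> cat_obj D" "e \<in> cat_obj D" "x \<in> cat_obj D"
      "f \<in> cat_hom D d e" "g \<in> cat_hom D e x"
    have gf: "cat_comp D d e x g f \<in> cat_hom D d x"
      using * by (simp add: D.comp_hom[of _ e])
    have "cat_comp D (T (Go d)) (T (Go x)) x (\<epsilon> x) (Gt d x (cat_comp D d e x g f))
        = cat_comp D (T (Go d)) e x g (cat_comp D (T (Go d)) d e f (\<epsilon> d))"
      using * by (simp add: Gt_nat gf D.assoc[of _ d e] obj Go_obj eps_hom)
    also have "cat_comp D (T (Go d)) d e f (\<epsilon> d)
      = cat_comp D (T (Go d)) (T (Go e)) e (\<epsilon> e) (Gt d e f)"
      using * by (intro Gt_nat[symmetric])
    also have "cat_comp D (T (Go d)) e x g \<dots>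
        = cat_comp D (T (Go d)) (T (Go e)) x (cat_comp D (T (Go e)) e x g (\<epsilon> e)) (Gt d e f)"
      using * by (intro D.assoc[symmetric]) (simp_all add: Gt_hom obj Go_obj eps_hom)
    also have "cat_comp D (T (Go e)) e x g (\<epsilon> e)
        = cat_comp D (T (Go e)) (T (Go x)) x (\<epsilon> x) (Gt e x g)"
      using * by (intro Gt_nat[symmetric])
    also have "cat_comp D (T (Go d)) (T (Go e)) x \<dots> (Gt d e f)
        = cat_comp D (T (Go d)) (T (Go x)) x (\<epsilon> x)
        (cat_comp D (T (Go d)) (T (Go e)) (T (Go x)) (Gt e x g) (Gt d e f))"
      using * by (intro D.assoc) (simp_all add: Gt_hom obj Go_obj eps_hom)
    finally have "Gt d x (cat_comp D d e x g f)
        = cat_comp D (T (Go d)) (T (Go e)) (T (Go x)) (Gt e x g) (Gt d e f)"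
      using * gf by - (rule mono[of x "T (Go d)"],
        simp_all add: Gt_hom D.comp_hom[of _ "T (Go e)"] obj Go_obj)
    then show "Gm d x (cat_comp D d e x g f)
        = cat_comp C (Go d) (Go e) (Go x) (Gm e x g) (Gm d e f)"
      using * by (simp add: comp Go_obj Gm_hom TGm) (simp add: Gm_def)
  qed (simp_all add: Go_obj Gm_hom)
  have eta_hom: "\<eta> a \<in> cat_hom C a (Go (T a))" if "a \<in> cat_obj C" for a
    using that by (simp add: \<eta>_def inv_hom obj Go_obj del)
  have Teta: "Tm a (Go (T a)) (\<eta> a) = \<delta> (T a)" if "a \<in> cat_obj C" for a
    using that by (simp add: \<eta>_def TU obj Go_obj del)
  have "cat_natural_iso C C (\<lambda>a. a) (\<lambda>a b f. f)
      (\<lambda>a. Go (T a)) (\<lambda>a b f. Gm (T a) (T b) (Tm a b f)) \<eta>"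
  proof
    fix a assume a: "a \<in> cat_obj C"
    let ?g = "Um (Go (T a)) a (\<epsilon> (T a))"
    have g: "?g \<in> cat_hom C (Go (T a)) a"
      using a by (simp add: inv_hom obj Go_obj eps_hom)
    have Tg: "Tm (Go (T a)) a ?g = \<epsilon> (T a)"
      using a by (simp add: TU obj Go_obj eps_hom)
    show "cat_iso C a (Go (T a)) (\<eta> a)"
      unfolding cat_iso_def
    proof (intro conjI bexI[of _ ?g])
      show "cat_comp C a (Go (T a)) a ?g (\<eta> a) = cat_id C a"
        using a by (subst comp) (simp_all add: g Tg eta_hom Teta del obj Go_obj ident)
      show "cat_comp C (Go (T a)) a (Go (T a)) (\<eta> a) ?g = cat_id C (Go (T a))"
        using a by (subst comp) (simp_all add: g Tg eta_hom Teta del obj Go_obj ident)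
    qed (simp_all add: g eta_hom a)
  next
    fix a b f assume *: "a \<in> cat_obj C" "b \<in> cat_obj C" "f \<in> cat_hom C a b"
    have "cat_comp D (T a) (T (Go (T a))) (T (Go (T b))) (Gt (T a) (T b) (Tm a b f)) (\<delta> (T a))
       = cat_comp D (T a) (T a) (T (Go (T b))) (cat_comp D (T a) (T b) (T (Go (T b))) (\<delta> (T b))
         (Tm a b f))
         (cat_comp D (T a) (T (Go (T a))) (T a) (\<epsilon> (T a)) (\<delta> (T a)))"
      unfolding Gt_def using *
      by (intro D.assoc) (simp_all add: D.comp_hom[of _ "T b"] obj hom Go_obj eps_hom del)
    also have "\<dots> = cat_comp D (T a) (T b) (T (Go (T b))) (\<delta> (T b)) (Tm a b f)"
      using * by (simp add: del obj Go_obj hom D.id_right D.comp_hom[of _ "T b"])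
    finally show "cat_comp C a b (Go (T b)) (\<eta> b) f
        = cat_comp C a (Go (T a)) (Go (T b)) (Gm (T a) (T b) (Tm a b f)) (\<eta> a)"
      using * by (simp add: comp Gm_hom TGm Teta eta_hom obj Go_obj hom)
  qed
  moreover have "cat_natural_iso D D (\<lambda>a. T (Go a)) (\<lambda>a b f. Tm (Go a) (Go b) (Gm a b f))
      (\<lambda>a. a) (\<lambda>a b f. f) \<epsilon>"
    by standard (simp_all add: eps TGm Gt_nat)
  ultimately show ?thesis
    unfolding equivalent_categories_def using D C.category_axioms Tfun Gfun by blast
qed

section \<open>Separating additive functionals\<close>

lemma (in abelian_group) neg_zero: "\<ominus> \<zero> = \<zero>"
  using r_neg[of \<zero>] by simp

text \<open>Zorn's lemma gives a subgroup \<open>H\<close> that is maximal among those with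
  torsion-free quotient and without \<open>v\<close>. Maximality makes the quotient of rank one:
  every \<open>x\<close> satisfies a relation \<open>n x = m v\<close> modulo \<open>H\<close> with
  \<open>n\<close> nonzero, and the functional sends \<open>x\<close> to
  \<open>m / n\<close>.\<close>

lemma (in abelian_group) separating_functional:
  assumes torsion_free: "\<And>x n. \<lbrakk>x \<in> carrier G; n \<noteq> (0::int); [n] \<cdot> x = \<zero>\<rbrakk> \<Longrightarrow> x = \<zero>"
    and v: "v \<in> carrier G" "v \<noteq> \<zero>"
  obtains h :: "'a \<Rightarrow> rat"
  where "\<And>x y. \<lbrakk>x \<in> carrier G; y \<in> carrier G\<rbrakk> \<Longrightarrow> h (x \<oplus> y) = h x + h y" and "h v \<noteq> 0"
proof -
  note pow_simps = add.int_pow_closed add.int_pow_distrib add.int_pow_inv add.int_pow_pow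
    add.int_pow_mult
  have pow_0: "[(0::int)] \<cdot> x = \<zero>" for x
    by (simp add: add_pow_int_ge)
  \<comment> \<open>Pure subgroups are those with torsion-free quotient. Purity permits dividing a
    relation modulo \<open>H\<close> by a nonzero integer.\<close>
  define pure where "pure H \<longleftrightarrow> H \<subseteq> carrier G \<and> \<zero> \<in> H \<and> (\<forall>x\<in>H. \<forall>y\<in>H. x \<ominus> y \<in> H)
      \<and> (\<forall>x\<in>carrier G. \<forall>n::int. n \<noteq> 0 \<longrightarrow> [n] \<cdot> x \<in> H \<longrightarrow> x \<in> H)" for H
  define S where "S = {H. pure H \<and> v \<notin> H}"
  have "pure {\<zero>}"
    using torsion_free by (auto simp: pure_def a_minus_def)
  then have "{\<zero>} \<in> S" using v by (simp add: S_def)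
  then have "S \<noteq> {}" by blast
  then have "\<exists>H\<in>S. \<forall>W\<in>S. H \<subseteq> W \<longrightarrow> W = H"
  proof (rule subset_Zorn_nonempty)
    fix Ch assume Ch: "Ch \<noteq> {}" "subset.chain S Ch"
    have "x \<ominus> y \<in> \<Union>Ch" if "x \<in> \<Union>Ch" "y \<in> \<Union>Ch" for x y
    proof -
      obtain W Y where "W \<in> Ch" "Y \<in> Ch" "x \<in> W" "y \<in> Y" using \<open>x \<in> \<Union>Ch\<close> \<open>y \<in> \<Union>Ch\<close> by blast
      then obtain Z where "Z \<in> Ch" "x \<in> Z" "y \<in> Z" using Ch(2) unfolding subset.chain_def by blast
      moreover have "pure Z" using \<open>Z \<in> Ch\<close> Ch(2) by (auto simp: subset.chain_def S_def)
      ultimately show ?thesis by (auto simp: pure_def)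
    qed
    moreover have pure: "\<forall>W\<in>Ch. pure W \<and> v \<notin> W"
      using Ch(2) by (auto simp: subset.chain_def S_def)
    then have "\<Union>Ch \<subseteq> carrier G" by (auto simp: pure_def)
    moreover have "\<zero> \<in> \<Union>Ch" using Ch(1) pure by (auto simp: pure_def)
    moreover have "x \<in> \<Union>Ch" if "x \<in> carrier G" "n \<noteq> 0" "[n] \<cdot> x \<in> \<Union>Ch" for x and n :: int
      using that pure by (auto simp: pure_def)
    ultimately have "pure (\<Union>Ch)" unfolding pure_def by blast
    then show "\<Union>Ch \<in> S" using pure by (simp add: S_def)
  qed
  then obtain H where H: "pure H" "v \<notin> H" and maximal: "\<And>W. \<lbrakk>pure W; v \<notin> W; H \<subseteq> W\<rbrakk> \<Longrightarrow> W = H"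
    by (auto simp: S_def)
  have H_sub: "x \<in> carrier G" if "x \<in> H" for x using that H by (auto simp: pure_def)
  have H_zero: "\<zero> \<in> H" using H by (simp add: pure_def)
  have H_diff: "x \<ominus> y \<in> H" if "x \<in> H" "y \<in> H" for x y using that H by (simp add: pure_def)
  have H_neg: "\<ominus> x \<in> H" if "x \<in> H" for x
    using H_diff[OF H_zero that] that H_sub by (simp add: a_minus_def)
  have H_add: "x \<oplus> y \<in> H" if "x \<in> H" "y \<in> H" for x y
    using H_diff[OF that(1) H_neg[OF that(2)]] that H_sub by (simp add: a_minus_def)
  have H_npow: "[n] \<cdot> x \<in> H" if "x \<in> H" for n :: nat and x
    using that by (induction n) (auto simp: add.nat_pow_Suc H_zero H_add)
  have H_pow: "[n] \<cdot> x \<in> H" if "x \<in> H" for n :: int and x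
    using H_npow[OF that] H_neg
    by (cases "n \<ge> 0") (auto simp: add_pow_int_ge add_pow_int_lt)
  have H_pure: "x \<in> H" if "[n] \<cdot> x \<in> H" "x \<in> carrier G" "n \<noteq> 0" for n :: int and x
    using that H unfolding pure_def by blast
  have scale: "[k] \<cdot> ([n] \<cdot> a \<ominus> [m] \<cdot> b) = [(k * n)] \<cdot> a \<ominus> [(k * m)] \<cdot> b"
    if "a \<in> carrier G" "b \<in> carrier G" for k n m :: int and a b
    using that by (simp add: a_minus_def pow_simps mult.commute)
  have join: "([n] \<cdot> a \<ominus> [m] \<cdot> b) \<oplus> ([n] \<cdot> a' \<ominus> [m'] \<cdot> b) = [n] \<cdot> (a \<oplus> a') \<ominus> [(m + m')] \<cdot> b"
    if "a \<in> carrier G" "a' \<in> carrier G" "b \<in> carrier G" for n m m' :: int and a a' b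
    using that by (simp add: a_minus_def pow_simps minus_add a_ac)
  have sum_mem: "[(n * n')] \<cdot> (a \<oplus> a') \<ominus> [(n' * m + n * m')] \<cdot> b \<in> H"
    if "a \<in> carrier G" "a' \<in> carrier G" "b \<in> carrier G"
      "[n] \<cdot> a \<ominus> [m] \<cdot> b \<in> H" "[n'] \<cdot> a' \<ominus> [m'] \<cdot> b \<in> H" for n n' m m' :: int and a a' b
    using H_add[OF H_pow[OF that(4), of n'] H_pow[OF that(5), of n]] that
    by (simp add: scale join mult.commute)
  have neg_mem: "[n] \<cdot> (\<ominus> a) \<ominus> [(- m)] \<cdot> b \<in> H"
    if "a \<in> carrier G" "b \<in> carrier G" "[n] \<cdot> a \<ominus> [m] \<cdot> b \<in> H" for n m :: int and a b
    using H_neg[OF that(3)] that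
    by (simp add: a_minus_def pow_simps minus_add add.int_pow_neg)
  \<comment> \<open>\<open>W\<close> is the pure closure of \<open>H\<close> together with
    \<open>x\<close>. If it misses \<open>v\<close>, maximality gives \<open>W = H\<close>, so
    \<open>x\<close> lies in \<open>H\<close> and \<open>m = 0\<close> works. Otherwise
    \<open>v\<close> has a multiple congruent to a multiple of \<open>x\<close>, and this relation
    is turned around.\<close>
  have total: "\<exists>n m. n \<noteq> 0 \<and> [(n::int)] \<cdot> x \<ominus> [(m::int)] \<cdot> v \<in> H" if x: "x \<in> carrier G" for x
  proof -
    define W where "W = {y \<in> carrier G. \<exists>n m. n \<noteq> 0 \<and> [(n::int)] \<cdot> y \<ominus> [(m::int)] \<cdot> x \<in> H}"
    have H_W: "y \<in> W" if "y \<in> H" for y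
    proof -
      have "(1::int) \<noteq> 0" "[(1::int)] \<cdot> y \<ominus> [(0::int)] \<cdot> x \<in> H"
        using that H_sub x by (simp_all add: a_minus_def pow_0 neg_zero)
      then show ?thesis using H_sub[OF that] unfolding W_def by blast
    qed
    have "(1::int) \<noteq> 0" "[(1::int)] \<cdot> x \<ominus> [(1::int)] \<cdot> x \<in> H"
      using x H_zero by (simp_all add: a_minus_def r_neg)
    then have "x \<in> W" using x unfolding W_def by blast
    have "pure W"
      unfolding pure_def
    proof (intro conjI ballI allI impI)
      show "W \<subseteq> carrier G" by (auto simp: W_def)
      show "\<zero> \<in> W" using H_W H_zero by blast
    next
      fix y z assume "y \<in> W" "z \<in> W"
      then obtain n m n' m' where *: "y \<in> carrier G" "z \<in> carrier G" "n \<noteq> 0" "n' \<noteq> 0"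
        "[(n::int)] \<cdot> y \<ominus> [(m::int)] \<cdot> x \<in> H" "[(n'::int)] \<cdot> z \<ominus> [(m'::int)] \<cdot> x \<in> H"
        unfolding W_def by blast
      have "[(n * n')] \<cdot> (y \<oplus> \<ominus> z) \<ominus> [(n' * m + n * - m')] \<cdot> x \<in> H"
        using * x by (intro sum_mem neg_mem) simp_all
      moreover have "n * n' \<noteq> 0" using * by simp
      ultimately show "y \<ominus> z \<in> W"
        unfolding W_def a_minus_def[of G y z] using * by blast
    next
      fix y and n :: int assume "y \<in> carrier G" "n \<noteq> 0" "[n] \<cdot> y \<in> W"
      then obtain k m where "k \<noteq> 0" "[(k::int)] \<cdot> ([n] \<cdot> y) \<ominus> [(m::int)] \<cdot> x \<in> H"
        unfolding W_def by blast
      then have "n * k \<noteq> 0" "[(n * k)] \<cdot> y \<ominus> [m] \<cdot> x \<in> H"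
        using \<open>n \<noteq> 0\<close> \<open>y \<in> carrier G\<close> by (simp_all add: pow_simps)
      then show "y \<in> W" unfolding W_def using \<open>y \<in> carrier G\<close> by blast
    qed
    show ?thesis
    proof (cases "v \<in> W")
      case False
      then have "W = H" using maximal \<open>pure W\<close> H_W by blast
      then have "(1::int) \<noteq> 0" "[(1::int)] \<cdot> x \<ominus> [(0::int)] \<cdot> v \<in> H"
        using \<open>x \<in> W\<close> x v by (simp_all add: a_minus_def pow_0 neg_zero)
      then show ?thesis by blast
    next
      case True
      then obtain n m where nm: "n \<noteq> 0" "[(n::int)] \<cdot> v \<ominus> [(m::int)] \<cdot> x \<in> H"
        unfolding W_def by blast
      \<comment> \<open>For \<open>m = 0\<close> a nonzero multiple of \<open>v\<close> would lie in
        \<open>H\<close>, and purity would put \<open>v\<close> there as well.\<close>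
      have "m \<noteq> 0"
      proof
        assume "m = 0"
        then have "[n] \<cdot> v \<in> H" using nm x v by (simp add: a_minus_def pow_0 neg_zero)
        then show False using H_pure nm(1) v H(2) by blast
      qed
      moreover have "[m] \<cdot> x \<ominus> [n] \<cdot> v \<in> H"
        using H_neg[OF nm(2)] x v by (simp add: a_minus_def minus_add a_ac)
      ultimately show ?thesis by blast
    qed
  qed
  \<comment> \<open>Cross-multiplying the two relations eliminates \<open>x\<close> and leaves
    \<open>m' * n - m * n'\<close> times \<open>v\<close> in \<open>H\<close>. Were this integer
    nonzero, purity would give \<open>v\<close> in \<open>H\<close>.\<close>
  have unique: "m * n' = m' * n"
    if "x \<in> carrier G" "[n] \<cdot> x \<ominus> [m] \<cdot> v \<in> H" "[n'] \<cdot> x \<ominus> [m'] \<cdot> v \<in> H" for n n' m m' :: int and x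
  proof (rule ccontr)
    assume "m * n' \<noteq> m' * n"
    have "([n'] \<cdot> ([n] \<cdot> x \<ominus> [m] \<cdot> v)) \<ominus> ([n] \<cdot> ([n'] \<cdot> x \<ominus> [m'] \<cdot> v)) \<in> H"
      by (rule H_diff[OF H_pow[OF that(2)] H_pow[OF that(3)]])
    also have "([n'] \<cdot> ([n] \<cdot> x \<ominus> [m] \<cdot> v)) \<ominus> ([n] \<cdot> ([n'] \<cdot> x \<ominus> [m'] \<cdot> v))
        = [(m' * n - m * n')] \<cdot> v"
    proof -
      have "(a \<ominus> b) \<ominus> (a \<ominus> c) = c \<oplus> \<ominus> b"
        if "a \<in> carrier G" "b \<in> carrier G" "c \<in> carrier G" for a b c
      proof -
        have "(a \<ominus> b) \<ominus> (a \<ominus> c) = (c \<oplus> \<ominus> b) \<oplus> (a \<oplus> \<ominus> a)"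
          using that by (simp only: a_minus_def minus_add minus_minus a_ac a_inv_closed a_closed)
        then show ?thesis using that by (simp add: r_neg)
      qed
      moreover have "[(m' * n - m * n')] \<cdot> v = [(n * m')] \<cdot> v \<oplus> \<ominus> ([(n' * m)] \<cdot> v)"
        using v by (simp add: add.int_pow_diff mult.commute)
      ultimately show ?thesis using that v by (simp add: scale mult.commute)
    qed
    finally show False
      using H_pure[of "m' * n - m * n'" v] \<open>m * n' \<noteq> m' * n\<close> v H(2) by simp
  qed
  obtain N M where NM: "\<And>x. x \<in> carrier G \<Longrightarrow> N x \<noteq> 0 \<and> [(N x::int)] \<cdot> x \<ominus> [(M x::int)] \<cdot> v \<in> H"
    using total by metis
  \<comment> \<open>The coordinate of \<open>x\<close> in the rank-one quotient, measured in units
    of \<open>v\<close>; in particular \<open>v\<close> gets the value 1.\<close>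
  define h where "h x = rat_of_int (M x) / rat_of_int (N x)" for x
  have h_eq: "h x = rat_of_int m / rat_of_int n"
    if "x \<in> carrier G" "n \<noteq> 0" "[n] \<cdot> x \<ominus> [m] \<cdot> v \<in> H" for n m :: int and x
  proof -
    have "M x * n = m * N x" using unique[OF that(1), of "N x" "M x"] NM[OF that(1)] that by blast
    then have "rat_of_int (M x) * rat_of_int n = rat_of_int m * rat_of_int (N x)"
      by (metis of_int_mult)
    then show ?thesis using that NM[OF that(1)] by (simp add: h_def frac_eq_eq)
  qed
  show thesis
  proof (rule that[of h])
    fix x y assume xy: "x \<in> carrier G" "y \<in> carrier G"
    have "h (x \<oplus> y) = rat_of_int (N y * M x + N x * M y) / rat_of_int (N x * N y)"
      using xy NM[of x] NM[of y] v by (intro h_eq sum_mem) simp_all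
    also have "\<dots> = h x + h y"
      using NM[OF xy(1)] NM[OF xy(2)] by (simp add: h_def field_simps)
    finally show "h (x \<oplus> y) = h x + h y" .
  next
    have "h v = rat_of_int 1 / rat_of_int 1"
      using v H_zero by (intro h_eq) (simp_all add: a_minus_def r_neg)
    then show "h v \<noteq> 0" by simp
  qed
qed

text \<open>Additivity alone is imposed, since the identities to be tested have integer
  coefficients; the rational values make linear arithmetic available for an arbitrary ground field.
  The condition is confined to the carrier, so every rewriting step comes with membership
  conditions.\<close>

definition additive_functionals :: "('k, 'v, 'd) module_scheme \<Rightarrow> ('v \<Rightarrow> rat) set" where
  "additive_functionals V = {h. \<forall>x \<in> carrier V. \<forall>y \<in> carrier V. h (x \<oplus>\<^bsub>V\<^esub> y) = h x + h y}"

lemma fd_vectorspace_module: "fd_vectorspace K V \<Longrightarrow> Module.module K V"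
  by (simp add: fd_vectorspace_def vectorspace_def)

lemma additive_functional_add:
  "\<lbrakk>h \<in> additive_functionals V; x \<in> carrier V; y \<in> carrier V\<rbrakk> \<Longrightarrow> h (x \<oplus>\<^bsub>V\<^esub> y) = h x + h y"
  by (simp add: additive_functionals_def)

lemma additive_functional_zero:
  assumes "h \<in> additive_functionals V" "abelian_group V"
  shows "h \<zero>\<^bsub>V\<^esub> = 0"
proof -
  interpret abelian_group V by fact
  show ?thesis using additive_functional_add[OF assms(1), of "\<zero>\<^bsub>V\<^esub>" "\<zero>\<^bsub>V\<^esub>"] by simp
qed

lemma additive_functional_neg:
  assumes "h \<in> additive_functionals V" "abelian_group V" "x \<in> carrier V"
  shows "h (\<ominus>\<^bsub>V\<^esub> x) = - h x"
proof -
  interpret abelian_group V by fact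
  have "h x + h (\<ominus>\<^bsub>V\<^esub> x) = 0"
    using additive_functional_add[OF assms(1,3), of "\<ominus>\<^bsub>V\<^esub> x"]
      additive_functional_zero[OF assms(1,2)]
      assms(3) by (simp add: r_neg)
  then show ?thesis by linarith
qed

lemmas additive_functional_simps =
  additive_functional_add additive_functional_zero additive_functional_neg

text \<open>A positive integer multiple is the action of the scalar \<open>k\<close> times 1, which
  is nonzero in characteristic 0 and hence invertible. The sign of \<open>n\<close> is absorbed by
  passing to its absolute value.\<close>

lemma vectorspace_torsion_free:
  assumes "vectorspace K V" "char_zero K" "x \<in> carrier V" "n \<noteq> (0::int)" "[n] \<cdot>\<^bsub>V\<^esub> x = \<zero>\<^bsub>V\<^esub>"
  shows "x = \<zero>\<^bsub>V\<^esub>"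
proof -
  interpret vectorspace K V by fact
  define k where "k = nat \<bar>n\<bar>"
  have nat_smult: "([m] \<cdot>\<^bsub>K\<^esub> \<one>\<^bsub>K\<^esub>) \<odot>\<^bsub>V\<^esub> x = [m] \<cdot>\<^bsub>V\<^esub> x" for m :: nat
    using \<open>x \<in> carrier V\<close>
    by (induction m) (auto simp: smult_l_distr)
  have "[k] \<cdot>\<^bsub>V\<^esub> x = \<zero>\<^bsub>V\<^esub>"
    using assms(3-5) by (cases "n \<ge> 0") (simp_all add: k_def add_pow_int_ge add_pow_int_lt)
  moreover have "[k] \<cdot>\<^bsub>K\<^esub> \<one>\<^bsub>K\<^esub> \<in> carrier K" by simp
  moreover have "[k] \<cdot>\<^bsub>K\<^esub> \<one>\<^bsub>K\<^esub> \<noteq> \<zero>\<^bsub>K\<^esub>"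
    using assms(2,4) by (simp add: char_zero_def k_def)
  ultimately have c: "[k] \<cdot>\<^bsub>K\<^esub> \<one>\<^bsub>K\<^esub> \<in> Units K" "([k] \<cdot>\<^bsub>K\<^esub> \<one>\<^bsub>K\<^esub>) \<odot>\<^bsub>V\<^esub> x = \<zero>\<^bsub>V\<^esub>"
    by (simp_all add: field_Units nat_smult)
  have "x = (inv\<^bsub>K\<^esub> ([k] \<cdot>\<^bsub>K\<^esub> \<one>\<^bsub>K\<^esub>) \<otimes>\<^bsub>K\<^esub> ([k] \<cdot>\<^bsub>K\<^esub> \<one>\<^bsub>K\<^esub>)) \<odot>\<^bsub>V\<^esub> x"
    by (subst R.Units_l_inv[OF c(1)]) (simp add: \<open>x \<in> carrier V\<close>)
  also have "\<dots> = \<zero>\<^bsub>V\<^esub>"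
    using c \<open>x \<in> carrier V\<close> by (subst smult_assoc1) simp_all
  finally show ?thesis .
qed

text \<open>A nonzero difference would be seen by a functional from
  \<open>separating_functional\<close>. In use this is an extensionality rule that replaces an
  equation of vectors by equations of rational numbers.\<close>

lemma eq_by_additive_functionals:
  assumes "fd_vectorspace K V" "char_zero K" "x \<in> carrier V" "y \<in> carrier V"
    and "\<And>h. h \<in> additive_functionals V \<Longrightarrow> h x = h y"
  shows "x = y"
proof (rule ccontr)
  assume "x \<noteq> y"
  interpret vectorspace K V using assms(1) by (simp add: fd_vectorspace_def)
  have nonzero: "x \<ominus>\<^bsub>V\<^esub> y \<noteq> \<zero>\<^bsub>V\<^esub>" using \<open>x \<noteq> y\<close> assms(3,4) by simp
  have closed: "x \<ominus>\<^bsub>V\<^esub> y \<in> carrier V" using assms(3,4) by simp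
  have torsion_free: "z = \<zero>\<^bsub>V\<^esub>"
    if "z \<in> carrier V" "n \<noteq> 0" "[n] \<cdot>\<^bsub>V\<^esub> z = \<zero>\<^bsub>V\<^esub>" for z and n :: int
    using vectorspace_torsion_free[OF vectorspace_axioms assms(2)] that by blast
  obtain h :: "_ \<Rightarrow> rat"
    where "\<And>a b. \<lbrakk>a \<in> carrier V; b \<in> carrier V\<rbrakk> \<Longrightarrow> h (a \<oplus>\<^bsub>V\<^esub> b) = h a + h b"
      and nonzero: "h (x \<ominus>\<^bsub>V\<^esub> y) \<noteq> 0"
    by (rule M.separating_functional[OF _ closed nonzero], (rule torsion_free; assumption),
      (rule that; assumption))
  then have h: "h \<in> additive_functionals V" by (simp add: additive_functionals_def)
  moreover have "h (x \<ominus>\<^bsub>V\<^esub> y) = h x - h y"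
    using h assms(3,4)
    by (simp add: a_minus_def additive_functional_simps M.abelian_group_axioms)
  ultimately show False using assms(5) h nonzero by simp
qed

section \<open>Linear and multilinear maps\<close>

lemma module_hom_simps:
  assumes "Module.module K V" "Module.module K W" "f \<in> module_hom K V W"
  shows "x \<in> carrier V \<Longrightarrow> f x \<in> carrier W"
    and "\<lbrakk>x \<in> carrier V; y \<in> carrier V\<rbrakk> \<Longrightarrow> f (x \<oplus>\<^bsub>V\<^esub> y) = f x \<oplus>\<^bsub>W\<^esub> f y"
    and "x \<in> carrier V \<Longrightarrow> f (\<ominus>\<^bsub>V\<^esub> x) = \<ominus>\<^bsub>W\<^esub> f x"
    and "f \<zero>\<^bsub>V\<^esub> = \<zero>\<^bsub>W\<^esub>"
    and "\<lbrakk>c \<in> carrier K; x \<in> carrier V\<rbrakk> \<Longrightarrow> f (c \<odot>\<^bsub>V\<^esub> x) = c \<odot>\<^bsub>W\<^esub> f x"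
  using mod_hom.f_im[of K V W f] module_hom_add[OF assms(3)] module_hom_smult[OF assms(3)]
    mod_hom.f_neg[of K V W f] mod_hom.f0_is_0[of K V W f] assms
  by (auto simp: mod_hom_def mod_hom_axioms_def)

lemma module_homI:
  assumes "\<And>x. x \<in> carrier V \<Longrightarrow> f x \<in> carrier W"
    and "\<And>x y. \<lbrakk>x \<in> carrier V; y \<in> carrier V\<rbrakk> \<Longrightarrow> f (x \<oplus>\<^bsub>V\<^esub> y) = f x \<oplus>\<^bsub>W\<^esub> f y"
    and "\<And>c x. \<lbrakk>c \<in> carrier K; x \<in> carrier V\<rbrakk> \<Longrightarrow> f (c \<odot>\<^bsub>V\<^esub> x) = c \<odot>\<^bsub>W\<^esub> f x"
  shows "f \<in> module_hom K V W"
  using assms by (auto simp: module_hom_def)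

lemma bilinear_map_simps:
  assumes "Module.module K U" "Module.module K V" "Module.module K W" "bilinear_map K U V W f"
  shows "\<lbrakk>x \<in> carrier U; y \<in> carrier V\<rbrakk> \<Longrightarrow> f x y \<in> carrier W"
    and "\<lbrakk>x \<in> carrier U; x' \<in> carrier U; y \<in> carrier V\<rbrakk> \<Longrightarrow> f (x \<oplus>\<^bsub>U\<^esub> x') y = f x y \<oplus>\<^bsub>W\<^esub> f x' y"
    and "\<lbrakk>x \<in> carrier U; y \<in> carrier V; y' \<in> carrier V\<rbrakk> \<Longrightarrow> f x (y \<oplus>\<^bsub>V\<^esub> y') = f x y \<oplus>\<^bsub>W\<^esub> f x y'"
    and "\<lbrakk>x \<in> carrier U; y \<in> carrier V\<rbrakk> \<Longrightarrow> f (\<ominus>\<^bsub>U\<^esub> x) y = \<ominus>\<^bsub>W\<^esub> f x y"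
    and "\<lbrakk>x \<in> carrier U; y \<in> carrier V\<rbrakk> \<Longrightarrow> f x (\<ominus>\<^bsub>V\<^esub> y) = \<ominus>\<^bsub>W\<^esub> f x y"
    and "y \<in> carrier V \<Longrightarrow> f \<zero>\<^bsub>U\<^esub> y = \<zero>\<^bsub>W\<^esub>"
    and "x \<in> carrier U \<Longrightarrow> f x \<zero>\<^bsub>V\<^esub> = \<zero>\<^bsub>W\<^esub>"
    and "\<lbrakk>c \<in> carrier K; x \<in> carrier U; y \<in> carrier V\<rbrakk> \<Longrightarrow> f (c \<odot>\<^bsub>U\<^esub> x) y = c \<odot>\<^bsub>W\<^esub> f x y"
    and "\<lbrakk>c \<in> carrier K; x \<in> carrier U; y \<in> carrier V\<rbrakk> \<Longrightarrow> f x (c \<odot>\<^bsub>V\<^esub> y) = c \<odot>\<^bsub>W\<^esub> f x y"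
  by (rule module_hom_simps[OF assms(1,3) conjunct2[OF assms(4)[unfolded bilinear_map_def],
    rule_format]]
      module_hom_simps[OF assms(2,3) conjunct1[OF assms(4)[unfolded bilinear_map_def],
        rule_format]];
      assumption)+

lemma bilinear_mapI:
  assumes "\<And>x y. \<lbrakk>x \<in> carrier U; y \<in> carrier V\<rbrakk> \<Longrightarrow> f x y \<in> carrier W"
    and "\<And>x x' y. \<lbrakk>x \<in> carrier U; x' \<in> carrier U; y \<in> carrier V\<rbrakk> \<Longrightarrow> f (x \<oplus>\<^bsub>U\<^esub> x') y
      = f x y \<oplus>\<^bsub>W\<^esub> f x' y"
    and "\<And>x y y'. \<lbrakk>x \<in> carrier U; y \<in> carrier V; y' \<in> carrier V\<rbrakk> \<Longrightarrow> f x (y \<oplus>\<^bsub>V\<^esub> y')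
      = f x y \<oplus>\<^bsub>W\<^esub> f x y'"
    and "\<And>c x y. \<lbrakk>c \<in> carrier K; x \<in> carrier U; y \<in> carrier V\<rbrakk> \<Longrightarrow> f (c \<odot>\<^bsub>U\<^esub> x) y = c \<odot>\<^bsub>W\<^esub> f x y"
    and "\<And>c x y. \<lbrakk>c \<in> carrier K; x \<in> carrier U; y \<in> carrier V\<rbrakk> \<Longrightarrow> f x (c \<odot>\<^bsub>V\<^esub> y) = c \<odot>\<^bsub>W\<^esub> f x y"
  shows "bilinear_map K U V W f"
  using assms by (auto simp: bilinear_map_def intro!: module_homI)

lemma trilinear_map_simps:
  assumes "Module.module K V" "Module.module K W" "trilinear_map K V W f"
    and "y \<in> carrier V" "z \<in> carrier V"
  shows "x \<in> carrier V \<Longrightarrow> f x y z \<in> carrier W"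
    and "\<lbrakk>x \<in> carrier V; x' \<in> carrier V\<rbrakk> \<Longrightarrow> f (x \<oplus>\<^bsub>V\<^esub> x') y z = f x y z \<oplus>\<^bsub>W\<^esub> f x' y z"
    and "\<lbrakk>x \<in> carrier V; x' \<in> carrier V\<rbrakk> \<Longrightarrow> f y (x \<oplus>\<^bsub>V\<^esub> x') z = f y x z \<oplus>\<^bsub>W\<^esub> f y x' z"
    and "\<lbrakk>x \<in> carrier V; x' \<in> carrier V\<rbrakk> \<Longrightarrow> f y z (x \<oplus>\<^bsub>V\<^esub> x') = f y z x \<oplus>\<^bsub>W\<^esub> f y z x'"
    and "x \<in> carrier V \<Longrightarrow> f (\<ominus>\<^bsub>V\<^esub> x) y z = \<ominus>\<^bsub>W\<^esub> f x y z"
    and "x \<in> carrier V \<Longrightarrow> f y (\<ominus>\<^bsub>V\<^esub> x) z = \<ominus>\<^bsub>W\<^esub> f y x z"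
    and "x \<in> carrier V \<Longrightarrow> f y z (\<ominus>\<^bsub>V\<^esub> x) = \<ominus>\<^bsub>W\<^esub> f y z x"
    and "f \<zero>\<^bsub>V\<^esub> y z = \<zero>\<^bsub>W\<^esub>" and "f y \<zero>\<^bsub>V\<^esub> z = \<zero>\<^bsub>W\<^esub>" and "f y z \<zero>\<^bsub>V\<^esub> = \<zero>\<^bsub>W\<^esub>"
    and "\<lbrakk>c \<in> carrier K; x \<in> carrier V\<rbrakk> \<Longrightarrow> f (c \<odot>\<^bsub>V\<^esub> x) y z = c \<odot>\<^bsub>W\<^esub> f x y z"
    and "\<lbrakk>c \<in> carrier K; x \<in> carrier V\<rbrakk> \<Longrightarrow> f y (c \<odot>\<^bsub>V\<^esub> x) z = c \<odot>\<^bsub>W\<^esub> f y x z"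
    and "\<lbrakk>c \<in> carrier K; x \<in> carrier V\<rbrakk> \<Longrightarrow> f y z (c \<odot>\<^bsub>V\<^esub> x) = c \<odot>\<^bsub>W\<^esub> f y z x"
proof -
  have h: "(\<lambda>x. f x y z) \<in> module_hom K V W" "(\<lambda>x. f y x z) \<in> module_hom K V W"
    "(\<lambda>x. f y z x) \<in> module_hom K V W"
    using assms by (simp_all add: trilinear_map_def)
  note s = module_hom_simps[OF assms(1,2) h(1)] module_hom_simps[OF assms(1,2) h(2)]
    module_hom_simps[OF assms(1,2) h(3)]
  show "x \<in> carrier V \<Longrightarrow> f x y z \<in> carrier W"
    "\<lbrakk>x \<in> carrier V; x' \<in> carrier V\<rbrakk> \<Longrightarrow> f (x \<oplus>\<^bsub>V\<^esub> x') y z = f x y z \<oplus>\<^bsub>W\<^esub> f x' y z"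
    "\<lbrakk>x \<in> carrier V; x' \<in> carrier V\<rbrakk> \<Longrightarrow> f y (x \<oplus>\<^bsub>V\<^esub> x') z = f y x z \<oplus>\<^bsub>W\<^esub> f y x' z"
    "\<lbrakk>x \<in> carrier V; x' \<in> carrier V\<rbrakk> \<Longrightarrow> f y z (x \<oplus>\<^bsub>V\<^esub> x') = f y z x \<oplus>\<^bsub>W\<^esub> f y z x'"
    "x \<in> carrier V \<Longrightarrow> f (\<ominus>\<^bsub>V\<^esub> x) y z = \<ominus>\<^bsub>W\<^esub> f x y z"
    "x \<in> carrier V \<Longrightarrow> f y (\<ominus>\<^bsub>V\<^esub> x) z = \<ominus>\<^bsub>W\<^esub> f y x z"
    "x \<in> carrier V \<Longrightarrow> f y z (\<ominus>\<^bsub>V\<^esub> x) = \<ominus>\<^bsub>W\<^esub> f y z x"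
    "f \<zero>\<^bsub>V\<^esub> y z = \<zero>\<^bsub>W\<^esub>" "f y \<zero>\<^bsub>V\<^esub> z = \<zero>\<^bsub>W\<^esub>" "f y z \<zero>\<^bsub>V\<^esub> = \<zero>\<^bsub>W\<^esub>"
    "\<lbrakk>c \<in> carrier K; x \<in> carrier V\<rbrakk> \<Longrightarrow> f (c \<odot>\<^bsub>V\<^esub> x) y z = c \<odot>\<^bsub>W\<^esub> f x y z"
    "\<lbrakk>c \<in> carrier K; x \<in> carrier V\<rbrakk> \<Longrightarrow> f y (c \<odot>\<^bsub>V\<^esub> x) z = c \<odot>\<^bsub>W\<^esub> f y x z"
    "\<lbrakk>c \<in> carrier K; x \<in> carrier V\<rbrakk> \<Longrightarrow> f y z (c \<odot>\<^bsub>V\<^esub> x) = c \<odot>\<^bsub>W\<^esub> f y z x"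
    by (rule s; assumption)+
qed

text \<open>The preimage of the span of \<open>S\<close> is a submodule containing the spanning set
  \<open>A\<close>, hence all of \<open>U\<close>.\<close>

lemma module_hom_image_span:
  assumes "vectorspace K U" "vectorspace K W" "f \<in> module_hom K U W"
    and A: "A \<subseteq> carrier U" "module.span K U A = carrier U"
    and S: "f ` A \<subseteq> S" "S \<subseteq> carrier W"
  shows "f ` carrier U \<subseteq> module.span K W S"
proof -
  interpret U: vectorspace K U by fact
  interpret W: vectorspace K W by fact
  interpret f: mod_hom K U W f
    using assms(3) U.module_axioms W.module_axioms by (simp add: mod_hom_def mod_hom_axioms_def)
  interpret S: submodule K "W.span S" W using S(2) by (rule W.span_is_submodule)
  have "submodule K {x \<in> carrier U. f x \<in> W.span S} U"
    by (rule submodule.intro) (auto simp: U.module_axioms)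
  moreover have "A \<subseteq> {x \<in> carrier U. f x \<in> W.span S}"
    using A(1) S W.in_own_span[OF S(2)] by auto
  ultimately have "U.span A \<subseteq> {x \<in> carrier U. f x \<in> W.span S}"
    by (intro U.span_is_subset)
  then show ?thesis using A(2) by auto
qed

text \<open>Images of finite spanning sets of \<open>V\<close> and \<open>V'\<close> together span
  \<open>W\<close>. This serves twice: for the kernel of the source map, as the image of the arrow
  part, and for the space of pairs, as the sum of its two factors.\<close>

lemma fin_dim_sum:
  assumes V: "fd_vectorspace K V" and V': "fd_vectorspace K V'" and W: "vectorspace K W"
    and i: "i \<in> module_hom K V W" and j: "j \<in> module_hom K V' W"
    and sum: "\<And>w. w \<in> carrier W \<Longrightarrow> \<exists>x \<in> carrier V. \<exists>y \<in> carrier V'. w = i x \<oplus>\<^bsub>W\<^esub> j y"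
  shows "fd_vectorspace K W"
proof -
  interpret W: vectorspace K W by fact
  obtain A where A: "finite A" "A \<subseteq> carrier V" "module.span K V A = carrier V"
    using V by (auto simp: fd_vectorspace_def vectorspace.fin_dim_def)
  obtain B where B: "finite B" "B \<subseteq> carrier V'" "module.span K V' B = carrier V'"
    using V' by (auto simp: fd_vectorspace_def vectorspace.fin_dim_def)
  let ?S = "i ` A \<union> j ` B"
  have S: "?S \<subseteq> carrier W"
    using A(2) B(2) module_hom_closed[OF i] module_hom_closed[OF j] by auto
  interpret S: submodule K "W.span ?S" W using S by (rule W.span_is_submodule)
  have "i ` carrier V \<subseteq> W.span ?S" "j ` carrier V' \<subseteq> W.span ?S"
    using V V' module_hom_image_span[OF _ W i A(2,3), of ?S]
      module_hom_image_span[OF _ W j B(2,3), of ?S] S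
    by (simp_all add: fd_vectorspace_def)
  then have "carrier W \<subseteq> W.span ?S" using sum by fast
  then have "W.span ?S = carrier W" using W.span_is_subset2[OF S] by blast
  then have "W.fin_dim"
    using A(1) B(1) S unfolding W.fin_dim_def by (intro exI[of _ ?S]) simp
  then show ?thesis using W by (simp add: fd_vectorspace_def)
qed

section \<open>Composition in a 2-vector space\<close>

context two_vector_space
begin

lemma Ob_module: "Module.module K (Ob L)"
  using ob_space by (rule fd_vectorspace_module)

lemma Mor_module: "Module.module K (Mor L)"
  using mor_space by (rule fd_vectorspace_module)

sublocale Ob: Module.module K "Ob L" by (rule Ob_module)
sublocale Mor: Module.module K "Mor L" by (rule Mor_module)

lemmas src_simps [simp] = module_hom_simps[OF Mor_module Ob_module src_linear]
lemmas tgt_simps [simp] = module_hom_simps[OF Mor_module Ob_module tgt_linear]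
lemmas idm_simps [simp] = module_hom_simps[OF Ob_module Mor_module idm_linear]

declare src_idm [simp] tgt_idm [simp]

lemmas Ob_functional_simps [simp] =
  additive_functional_add[where V = "Ob L"]
  additive_functional_zero[OF _ Ob.abelian_group_axioms]
  additive_functional_neg[OF _ Ob.abelian_group_axioms]
lemmas Mor_functional_simps [simp] =
  additive_functional_add[where V = "Mor L"]
  additive_functional_zero[OF _ Mor.abelian_group_axioms]
  additive_functional_neg[OF _ Mor.abelian_group_axioms]

lemma composable_pairs_iff:
  "(g, f) \<in> composable_pairs L \<longleftrightarrow> g \<in> mors L \<and> f \<in> mors L \<and> tgt L f = src L g"
  by (simp add: composable_pairs_def)

text \<open>The pair \<open>(g, f)\<close> is the sum of \<open>(g, \<iota> y)\<close> and \<open>(0, f - \<iota> y)\<close>, where \<open>y\<close> is the common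
  endpoint, and both summands have a trivial composite.\<close>

lemma cmp_eq:
  assumes "g \<in> mors L" "f \<in> mors L" "tgt L f = src L g"
  shows "g \<diamondop> f = g \<oplus>\<^sub>M (f \<oplus>\<^sub>M \<ominus>\<^bsub>Mor L\<^esub> \<iota> (tgt L f))"
proof -
  let ?k = "f \<oplus>\<^sub>M \<ominus>\<^bsub>Mor L\<^esub> \<iota> (tgt L f)"
  have k: "?k \<in> mors L" "tgt L ?k = \<zero>\<^bsub>Ob L\<^esub>"
    using assms by (simp_all add: Ob.r_neg)
  have "(g \<oplus>\<^sub>M \<zero>\<^bsub>Mor L\<^esub>) \<diamondop> (\<iota> (src L g) \<oplus>\<^sub>M ?k) = (g \<diamondop> \<iota> (src L g)) \<oplus>\<^sub>M (\<zero>\<^bsub>Mor L\<^esub> \<diamondop> ?k)"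
    using module_hom_add[OF cmp_linear, of "(g, \<iota> (src L g))" "(\<zero>\<^bsub>Mor L\<^esub>, ?k)"] assms k
    by (simp add: composable_pairs_iff direct_sum_def)
  moreover have "\<zero>\<^bsub>Mor L\<^esub> \<diamondop> ?k = ?k"
    using idm_left[OF k(1)] k(2) by simp
  moreover have "\<iota> (src L g) \<oplus>\<^sub>M ?k = f"
    using assms by (simp add: Mor.a_lcomm[of "\<iota> (src L g)"] Mor.r_neg)
  ultimately show ?thesis
    using assms by (simp add: idm_right)
qed

lemma cmp_between:
  assumes "g \<in> mor_between L y z" "f \<in> mor_between L x y"
  shows "g \<diamondop> f = g \<oplus>\<^sub>M (f \<oplus>\<^sub>M \<ominus>\<^bsub>Mor L\<^esub> \<iota> y)" and "g \<diamondop> f \<in> mor_between L x z"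
proof -
  show eq: "g \<diamondop> f = g \<oplus>\<^sub>M (f \<oplus>\<^sub>M \<ominus>\<^bsub>Mor L\<^esub> \<iota> y)"
    using assms cmp_eq by (auto simp: mor_between_def)
  have "(g, f) \<in> composable_pairs L"
    using assms by (auto simp: composable_pairs_iff mor_between_def)
  moreover have "g \<diamondop> f \<in> mors L"
    unfolding eq using assms by (auto simp: mor_between_def)
  ultimately show "g \<diamondop> f \<in> mor_between L x z"
    using assms src_cmp[of g f] tgt_cmp[of g f] by (simp add: mor_between_def)
qed

lemma arrow_part_eq: "arrow_part L f = f \<oplus>\<^sub>M \<ominus>\<^bsub>Mor L\<^esub> \<iota> (src L f)"
  by (simp add: arrow_part_def a_minus_def)

lemma arrow_part_closed [simp]: "f \<in> mors L \<Longrightarrow> arrow_part L f \<in> mors L"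
  by (simp add: arrow_part_eq)

lemma src_arrow_part [simp]: "f \<in> mors L \<Longrightarrow> src L (arrow_part L f) = \<zero>\<^bsub>Ob L\<^esub>"
  by (simp add: arrow_part_eq Ob.r_neg)

lemma arrow_part_linear: "arrow_part L \<in> module_hom K (Mor L) (Mor L)"
  by (rule module_homI) (simp_all add: arrow_part_eq Mor.minus_add Mor.a_ac Mor.smult_r_distr
      Mor.smult_r_minus)

end

locale char0_two_vector_space = two_vector_space +
  assumes char0: "char_zero K"
begin

lemma Ob_eqI:
  assumes "x \<in> obs L" "y \<in> obs L" "\<And>h. h \<in> additive_functionals (Ob L) \<Longrightarrow> h x = h y"
  shows "x = y"
  using eq_by_additive_functionals[OF ob_space char0] assms by blast

lemma Mor_eqI:
  assumes "f \<in> mors L" "g \<in> mors L" "\<And>h. h \<in> additive_functionals (Mor L) \<Longrightarrow> h f = h g"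
  shows "f = g"
  using eq_by_additive_functionals[OF mor_space char0] assms by blast

end

section \<open>Rewriting rules for Lie 2-algebras and Rota-Baxter structures\<close>

context lie_two_algebra
begin

sublocale br: bilinear_functor K L "ob_br L" "mor_br L" by (rule br_functor)

lemmas ob_br_simps [simp] = bilinear_map_simps[OF Ob_module Ob_module Ob_module br.B0_bilinear]
lemmas mor_br_simps [simp] = bilinear_map_simps[OF Mor_module Mor_module Mor_module br.B1_bilinear]
lemmas jac_simps [simp] = trilinear_map_simps[OF Ob_module Mor_module jac_trilinear]

declare br.B_src [simp] br.B_tgt [simp] br.B_idm [simp]

lemma src_jac [simp]: "\<lbrakk>x \<in> obs L; y \<in> obs L; z \<in> obs L\<rbrakk> \<Longrightarrow> src L (J x y z) = \<langle>\<langle>x, y\<rangle>\<^sub>O, z\<rangle>\<^sub>O"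
  using jac_between[of x y z] by (simp add: mor_between_def)

lemma tgt_jac [simp]: "\<lbrakk>x \<in> obs L; y \<in> obs L; z \<in> obs L\<rbrakk> \<Longrightarrow>
    tgt L (J x y z) = \<langle>x, \<langle>y, z\<rangle>\<^sub>O\<rangle>\<^sub>O \<oplus>\<^sub>O \<langle>\<langle>x, z\<rangle>\<^sub>O, y\<rangle>\<^sub>O"
  using jac_between[of x y z] by (simp add: mor_between_def)

lemma ob_br_swap: "\<lbrakk>x \<in> obs L; y \<in> obs L\<rbrakk> \<Longrightarrow> \<langle>x, y\<rangle>\<^sub>O = \<ominus>\<^bsub>Ob L\<^esub> \<langle>y, x\<rangle>\<^sub>O"
  using ob_br_skew unfolding skew2_def by blast

lemma mor_br_swap: "\<lbrakk>f \<in> mors L; g \<in> mors L\<rbrakk> \<Longrightarrow> \<langle>f, g\<rangle>\<^sub>M = \<ominus>\<^bsub>Mor L\<^esub> \<langle>g, f\<rangle>\<^sub>M"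
  using mor_br_skew unfolding skew2_def by blast

text \<open>Functoriality of the bracket, applied to \<open>u = \<iota> (t u) \<diamondop> u\<close> and \<open>v = v \<diamondop> 0\<close>.\<close>

lemma mor_br_slide_left:
  assumes "u \<in> mors L" "v \<in> mors L" "src L u = \<zero>\<^bsub>Ob L\<^esub>" "src L v = \<zero>\<^bsub>Ob L\<^esub>"
  shows "\<langle>u, v\<rangle>\<^sub>M = \<langle>\<iota> (tgt L u), v\<rangle>\<^sub>M"
proof -
  have "\<langle>\<iota> (tgt L u) \<diamondop> u, v \<diamondop> \<iota> (src L v)\<rangle>\<^sub>M = \<langle>\<iota> (tgt L u), v\<rangle>\<^sub>M \<diamondop> \<langle>u, \<iota> (src L v)\<rangle>\<^sub>M"
    using assms by (intro br.B_cmp) (simp_all add: composable_pairs_iff)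
  then have "\<langle>u, v\<rangle>\<^sub>M = \<langle>\<iota> (tgt L u), v\<rangle>\<^sub>M \<diamondop> \<zero>\<^bsub>Mor L\<^esub>"
    unfolding idm_left[OF assms(1)] idm_right[OF assms(2)] using assms by simp
  also have "\<dots> = \<langle>\<iota> (tgt L u), v\<rangle>\<^sub>M"
    using assms by (subst cmp_eq) (simp_all add: Mor.r_neg)
  finally show ?thesis .
qed

lemma mor_br_slide_right:
  assumes "u \<in> mors L" "v \<in> mors L" "src L u = \<zero>\<^bsub>Ob L\<^esub>" "src L v = \<zero>\<^bsub>Ob L\<^esub>"
  shows "\<langle>u, v\<rangle>\<^sub>M = \<langle>u, \<iota> (tgt L v)\<rangle>\<^sub>M"
proof -
  have "\<langle>u, v\<rangle>\<^sub>M = \<ominus>\<^bsub>Mor L\<^esub> \<langle>v, u\<rangle>\<^sub>M" using assms by (intro mor_br_swap)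
  also have "\<dots> = \<ominus>\<^bsub>Mor L\<^esub> \<langle>\<iota> (tgt L v), u\<rangle>\<^sub>M" using assms by (simp add: mor_br_slide_left[of v u])
  also have "\<dots> = \<langle>u, \<iota> (tgt L v)\<rangle>\<^sub>M" using assms by (intro mor_br_swap[symmetric]) simp_all
  finally show ?thesis .
qed

end

context rb_lie_two_algebra
begin

sublocale rb: linear_functor K L L "rb_ob L" "rb_mor L" by (rule rb_functor)

lemmas rb_ob_simps [simp] = module_hom_simps[OF Ob_module Ob_module rb.F0_linear]
lemmas rb_mor_simps [simp] = module_hom_simps[OF Mor_module Mor_module rb.F1_linear]
lemmas rb_nat_simps [simp] = bilinear_map_simps[OF Ob_module Ob_module Mor_module rb_bilinear]

declare rb.F_src [simp] rb.F_tgt [simp] rb.F_idm [simp]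

lemma src_rb_nat [simp]: "\<lbrakk>x \<in> obs L; y \<in> obs L\<rbrakk> \<Longrightarrow> src L (\<R> x y) = \<langle>P\<^sub>0 x, P\<^sub>0 y\<rangle>\<^sub>O"
  using rb_between[of x y] by (simp add: mor_between_def)

lemma tgt_rb_nat [simp]: "\<lbrakk>x \<in> obs L; y \<in> obs L\<rbrakk> \<Longrightarrow>
    tgt L (\<R> x y) = P\<^sub>0 \<langle>P\<^sub>0 x, y\<rangle>\<^sub>O \<oplus>\<^sub>O P\<^sub>0 \<langle>x, P\<^sub>0 y\<rangle>\<^sub>O"
  using rb_between[of x y] by (simp add: mor_between_def)

end

section \<open>Arrow parts of sums, brackets and composites\<close>

context two_vector_space
begin

lemma arrow_part_simps [simp]:
  "\<lbrakk>f \<in> mors L; g \<in> mors L\<rbrakk> \<Longrightarrow> arrow_part L (f \<oplus>\<^sub>M g) = arrow_part L f \<oplus>\<^sub>M arrow_part L g"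
  "f \<in> mors L \<Longrightarrow> arrow_part L (\<ominus>\<^bsub>Mor L\<^esub> f) = \<ominus>\<^bsub>Mor L\<^esub> arrow_part L f"
  "\<lbrakk>c \<in> carrier K; f \<in> mors L\<rbrakk> \<Longrightarrow> arrow_part L (c \<odot>\<^bsub>Mor L\<^esub> f) = c \<odot>\<^bsub>Mor L\<^esub> arrow_part L f"
  "x \<in> obs L \<Longrightarrow> arrow_part L (\<iota> x) = \<zero>\<^bsub>Mor L\<^esub>"
  using module_hom_simps[OF Mor_module Mor_module arrow_part_linear]
  by (simp_all add: arrow_part_eq[of "\<iota> x"] Mor.r_neg)

lemma arrow_part_id: "\<lbrakk>u \<in> mors L; src L u = \<zero>\<^bsub>Ob L\<^esub>\<rbrakk> \<Longrightarrow> arrow_part L u = u"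
  using module_hom_simps(4)[OF Ob_module Mor_module idm_linear]
    Mor.r_neg[of "\<zero>\<^bsub>Mor L\<^esub>"] by (simp add: arrow_part_eq)

lemma decomp: "f \<in> mors L \<Longrightarrow> f = \<iota> (src L f) \<oplus>\<^sub>M arrow_part L f"
  by (simp add: arrow_part_eq Mor.a_lcomm[of "\<iota> (src L f)"] Mor.r_neg)

lemma tgt_arrow_part [simp]:
  "f \<in> mors L \<Longrightarrow> tgt L (arrow_part L f) = tgt L f \<oplus>\<^sub>O \<ominus>\<^bsub>Ob L\<^esub> src L f"
  by (simp add: arrow_part_eq)

lemma mor_eqI:
  assumes "f \<in> mors L" "g \<in> mors L" "src L f = src L g" "arrow_part L f = arrow_part L g"
  shows "f = g"
  using decomp[OF assms(1)] decomp[OF assms(2)] assms(3,4) by simp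

lemma cmp_simps:
  assumes "g \<in> mors L" "f \<in> mors L" "tgt L f = src L g"
  shows "g \<diamondop> f \<in> mors L" and "src L (g \<diamondop> f) = src L f" and "tgt L (g \<diamondop> f) = tgt L g"
    and "arrow_part L (g \<diamondop> f) = arrow_part L g \<oplus>\<^sub>M arrow_part L f"
proof -
  have b: "g \<in> mor_between L (src L g) (tgt L g)" "f \<in> mor_between L (src L f) (src L g)"
    using assms by (simp_all add: mor_between_def)
  show "g \<diamondop> f \<in> mors L" "src L (g \<diamondop> f) = src L f" "tgt L (g \<diamondop> f) = tgt L g"
    using cmp_between(2)[OF b] by (simp_all add: mor_between_def)
  show "arrow_part L (g \<diamondop> f) = arrow_part L g \<oplus>\<^sub>M arrow_part L f"
    unfolding cmp_between(1)[OF b] using assms by simp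
qed

text \<open>One rule for each length of composite collects the endpoint conditions of a whole
  coherence law as premises, so that they can be proved once and reused instead of arising as nested
  side conditions of rewriting.\<close>

lemma arrow_cmp3:
  assumes "a \<in> mors L" "b \<in> mors L" "c \<in> mors L" "tgt L c = src L b" "tgt L b = src L a"
  shows "arrow_part L (a \<diamondop> b \<diamondop> c) = arrow_part L a \<oplus>\<^sub>M (arrow_part L b \<oplus>\<^sub>M arrow_part L c)"
  using assms by (simp add: cmp_simps)

lemma arrow_cmp4:
  assumes "a \<in> mors L" "b \<in> mors L" "c \<in> mors L" "d \<in> mors L"
    "tgt L d = src L c" "tgt L c = src L b" "tgt L b = src L a"
  shows "arrow_part L (a \<diamondop> b \<diamondop> c \<diamondop> d)
    = arrow_part L a \<oplus>\<^sub>M (arrow_part L b \<oplus>\<^sub>M (arrow_part L c \<oplus>\<^sub>M arrow_part L d))"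
  using assms by (simp add: cmp_simps)

lemma arrow_cmp5:
  assumes "a \<in> mors L" "b \<in> mors L" "c \<in> mors L" "d \<in> mors L" "e \<in> mors L"
    "tgt L e = src L d" "tgt L d = src L c" "tgt L c = src L b" "tgt L b = src L a"
  shows "arrow_part L (a \<diamondop> b \<diamondop> c \<diamondop> d \<diamondop> e) = arrow_part L a \<oplus>\<^sub>M
    (arrow_part L b \<oplus>\<^sub>M (arrow_part L c \<oplus>\<^sub>M (arrow_part L d \<oplus>\<^sub>M arrow_part L e)))"
  using assms by (simp add: cmp_simps)

end

locale char0_rb_lie_two_algebra = rb_lie_two_algebra +
  assumes char0: "char_zero K"
begin

sublocale char0_two_vector_space K L
  by standard (rule char0)

end

context lie_two_algebra
begin

text \<open>Split both morphisms into identity and arrow part. The bracket of the identities is an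
  identity and disappears; the bracket of the two arrow parts is what moves the second summand from
  the source of \<open>f\<close> to its target. The result is the formula of
  \<open>arrow_br\<close>.\<close>

lemma arrow_part_mor_br:
  assumes "f \<in> mors L" "g \<in> mors L"
  shows "arrow_part L \<langle>f, g\<rangle>\<^sub>M
    = \<langle>arrow_part L f, \<iota> (src L g)\<rangle>\<^sub>M \<oplus>\<^sub>M \<langle>\<iota> (tgt L f), arrow_part L g\<rangle>\<^sub>M"
proof -
  let ?u = "arrow_part L f" and ?v = "arrow_part L g"
  have "\<langle>f, g\<rangle>\<^sub>M = \<langle>\<iota> (src L f) \<oplus>\<^sub>M ?u, \<iota> (src L g) \<oplus>\<^sub>M ?v\<rangle>\<^sub>M"
    using assms decomp by simp
  also have "\<dots> = \<iota> \<langle>src L f, src L g\<rangle>\<^sub>O \<oplus>\<^sub>M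
      (\<langle>?u, \<iota> (src L g)\<rangle>\<^sub>M \<oplus>\<^sub>M (\<langle>\<iota> (src L f), ?v\<rangle>\<^sub>M \<oplus>\<^sub>M \<langle>?u, ?v\<rangle>\<^sub>M))"
    using assms by (simp add: Mor.a_ac)
  \<comment> \<open>Sliding replaces the first arrow part by the identity of its target, so this
    term can be added to the one over the source of \<open>f\<close>; source plus displacement is
    the target of \<open>f\<close>.\<close>
  also have "\<langle>?u, ?v\<rangle>\<^sub>M = \<langle>\<iota> (tgt L ?u), ?v\<rangle>\<^sub>M"
    using assms by (intro mor_br_slide_left) simp_all
  also have "\<langle>\<iota> (src L f), ?v\<rangle>\<^sub>M \<oplus>\<^sub>M \<dots> = \<langle>\<iota> (src L f) \<oplus>\<^sub>M \<iota> (tgt L ?u), ?v\<rangle>\<^sub>M"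
    using assms by simp
  also have "\<iota> (src L f) \<oplus>\<^sub>M \<iota> (tgt L ?u) = \<iota> (src L f \<oplus>\<^sub>O (tgt L f \<oplus>\<^sub>O \<ominus>\<^bsub>Ob L\<^esub> src L f))"
    using assms by simp
  also have "src L f \<oplus>\<^sub>O (tgt L f \<oplus>\<^sub>O \<ominus>\<^bsub>Ob L\<^esub> src L f) = tgt L f"
    using assms by (simp add: Ob.a_lcomm[of "src L f"] Ob.r_neg)
  finally have "\<langle>f, g\<rangle>\<^sub>M = \<iota> \<langle>src L f, src L g\<rangle>\<^sub>O \<oplus>\<^sub>M
      (\<langle>?u, \<iota> (src L g)\<rangle>\<^sub>M \<oplus>\<^sub>M \<langle>\<iota> (tgt L f), ?v\<rangle>\<^sub>M)" .
  then have "arrow_part L \<langle>f, g\<rangle>\<^sub>M = arrow_part L (\<langle>?u, \<iota> (src L g)\<rangle>\<^sub>M \<oplus>\<^sub>M \<langle>\<iota> (tgt L f), ?v\<rangle>\<^sub>M)"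
    using assms by simp
  also have "\<dots> = \<langle>?u, \<iota> (src L g)\<rangle>\<^sub>M \<oplus>\<^sub>M \<langle>\<iota> (tgt L f), ?v\<rangle>\<^sub>M"
    using assms by (intro arrow_part_id) simp_all
  finally show ?thesis .
qed

lemma arrow_part_mor_br_idm [simp]:
  assumes "f \<in> mors L" "x \<in> obs L"
  shows "arrow_part L \<langle>f, \<iota> x\<rangle>\<^sub>M = \<langle>arrow_part L f, \<iota> x\<rangle>\<^sub>M"
    and "arrow_part L \<langle>\<iota> x, f\<rangle>\<^sub>M = \<langle>\<iota> x, arrow_part L f\<rangle>\<^sub>M"
  using assms by (simp_all add: arrow_part_mor_br)

lemma arrow_jac_skew:
  assumes "x \<in> obs L" "y \<in> obs L" "z \<in> obs L"
  shows "arrow_part L (J x y z) = \<ominus>\<^bsub>Mor L\<^esub> arrow_part L (J y x z)"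
    and "arrow_part L (J x y z) = \<ominus>\<^bsub>Mor L\<^esub> arrow_part L (J x z y)"
  using jac_skew assms unfolding skew3_def by blast+

end

context rb_lie_two_algebra
begin

lemma arrow_rb_skew:
  assumes "x \<in> obs L" "y \<in> obs L"
  shows "arrow_part L (\<R> x y) = \<ominus>\<^bsub>Mor L\<^esub> arrow_part L (\<R> y x)"
  using rb_skew assms unfolding skew2_def by blast

lemma arrow_rb_mor [simp]:
  assumes "f \<in> mors L"
  shows "arrow_part L (P\<^sub>1 f) = P\<^sub>1 (arrow_part L f)"
  using assms by (simp add: arrow_part_eq)

end

section \<open>The coherence laws read on arrow parts\<close>

context char0_rb_lie_two_algebra
begin

text \<open>The identity summands of the law have zero arrow part and drop out; their exact form
  matters only for the endpoints to match.\<close>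

lemma arrow_jac_coherence:
  assumes [simp]: "w \<in> obs L" "x \<in> obs L" "y \<in> obs L" "z \<in> obs L"
  defines "j \<equiv> \<lambda>x y z. arrow_part L (J x y z)"
  shows "\<langle>\<iota> w, j x y z\<rangle>\<^sub>M \<oplus>\<^sub>M (\<langle>j w y z, \<iota> x\<rangle>\<^sub>M \<oplus>\<^sub>M (j \<langle>w, y\<rangle>\<^sub>O x z \<oplus>\<^sub>M j w \<langle>x, y\<rangle>\<^sub>O z
      \<oplus>\<^sub>M \<langle>j w x y, \<iota> z\<rangle>\<^sub>M))
    = j w \<langle>x, z\<rangle>\<^sub>O y \<oplus>\<^sub>M j \<langle>w, z\<rangle>\<^sub>O x y \<oplus>\<^sub>M j w x \<langle>y, z\<rangle>\<^sub>O
      \<oplus>\<^sub>M (\<langle>j w x z, \<iota> y\<rangle>\<^sub>M \<oplus>\<^sub>M j \<langle>w, x\<rangle>\<^sub>O y z)"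
proof -
  let ?a1 = "\<langle>\<iota> w, J x y z\<rangle>\<^sub>M \<oplus>\<^sub>M
          \<iota> (\<langle>\<langle>w, y\<rangle>\<^sub>O, \<langle>x, z\<rangle>\<^sub>O\<rangle>\<^sub>O \<oplus>\<^sub>O \<langle>\<langle>w, \<langle>y, z\<rangle>\<^sub>O\<rangle>\<^sub>O, x\<rangle>\<^sub>O \<oplus>\<^sub>O \<langle>\<langle>\<langle>w, z\<rangle>\<^sub>O, y\<rangle>\<^sub>O, x\<rangle>\<^sub>O
             \<oplus>\<^sub>O \<langle>\<langle>w, z\<rangle>\<^sub>O, \<langle>x, y\<rangle>\<^sub>O\<rangle>\<^sub>O)"
    and ?a2 = "\<langle>J w y z, \<iota> x\<rangle>\<^sub>M \<oplus>\<^sub>M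
          \<iota> (\<langle>\<langle>w, y\<rangle>\<^sub>O, \<langle>x, z\<rangle>\<^sub>O\<rangle>\<^sub>O \<oplus>\<^sub>O \<langle>w, \<langle>\<langle>x, y\<rangle>\<^sub>O, z\<rangle>\<^sub>O\<rangle>\<^sub>O \<oplus>\<^sub>O \<langle>\<langle>w, z\<rangle>\<^sub>O, \<langle>x, y\<rangle>\<^sub>O\<rangle>\<^sub>O)"
    and ?a3 = "J \<langle>w, y\<rangle>\<^sub>O x z \<oplus>\<^sub>M J w \<langle>x, y\<rangle>\<^sub>O z" and ?a4 = "\<langle>J w x y, \<iota> z\<rangle>\<^sub>M"
    and ?b1 = "J w \<langle>x, z\<rangle>\<^sub>O y \<oplus>\<^sub>M J \<langle>w, z\<rangle>\<^sub>O x y \<oplus>\<^sub>M J w x \<langle>y, z\<rangle>\<^sub>O"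
    and ?b2 = "\<langle>J w x z, \<iota> y\<rangle>\<^sub>M \<oplus>\<^sub>M \<iota> \<langle>\<langle>w, x\<rangle>\<^sub>O, \<langle>y, z\<rangle>\<^sub>O\<rangle>\<^sub>O"
    and ?b3 = "J \<langle>w, x\<rangle>\<^sub>O y z"
  \<comment> \<open>The coherence law is an equation between composites and does not itself provide
    composability, so the five matching endpoints are computed from the endpoints of the
    Jacobiators.\<close>
  have c: "tgt L ?a4 = src L ?a3" "tgt L ?a3 = src L ?a2" "tgt L ?a2 = src L ?a1"
    "tgt L ?b3 = src L ?b2" "tgt L ?b2 = src L ?b1"
    by (rule Ob_eqI; simp; linarith)+
  have "arrow_part L (?a1 \<diamondop> ?a2 \<diamondop> ?a3 \<diamondop> ?a4) = arrow_part L (?b1 \<diamondop> ?b2 \<diamondop> ?b3)"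
    by (subst jac_coherence) simp_all
  also have "arrow_part L (?a1 \<diamondop> ?a2 \<diamondop> ?a3 \<diamondop> ?a4) = arrow_part L ?a1 \<oplus>\<^sub>M
      (arrow_part L ?a2 \<oplus>\<^sub>M (arrow_part L ?a3 \<oplus>\<^sub>M arrow_part L ?a4))"
    by (rule arrow_cmp4[OF _ _ _ _ c(1-3)]) simp_all
  also have "arrow_part L (?b1 \<diamondop> ?b2 \<diamondop> ?b3)
      = arrow_part L ?b1 \<oplus>\<^sub>M (arrow_part L ?b2 \<oplus>\<^sub>M arrow_part L ?b3)"
    by (rule arrow_cmp3[OF _ _ _ c(4,5)]) simp_all
  finally show ?thesis unfolding j_def by simp
qed

text \<open>As for the Jacobiator law, the identity summands vanish on arrow parts, and the seven
  matching endpoints have to be computed before arrow parts can be added.\<close>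

lemma arrow_rb_coherence:
  assumes [simp]: "x \<in> obs L" "y \<in> obs L" "z \<in> obs L"
  defines "j \<equiv> \<lambda>x y z. arrow_part L (J x y z)" and "r \<equiv> \<lambda>x y. arrow_part L (\<R> x y)"
  shows "P\<^sub>1 \<langle>r x y, \<iota> z\<rangle>\<^sub>M \<oplus>\<^sub>M (P\<^sub>1 (j (P\<^sub>0 x) z (P\<^sub>0 y))
      \<oplus>\<^sub>M (r x \<langle>P\<^sub>0 y, z\<rangle>\<^sub>O \<oplus>\<^sub>M r x \<langle>y, P\<^sub>0 z\<rangle>\<^sub>O \<oplus>\<^sub>M r \<langle>x, P\<^sub>0 z\<rangle>\<^sub>O y \<oplus>\<^sub>M r \<langle>P\<^sub>0 x, z\<rangle>\<^sub>O y
      \<oplus>\<^sub>M (\<langle>\<iota> (P\<^sub>0 x), r y z\<rangle>\<^sub>M \<oplus>\<^sub>M \<langle>r x z, \<iota> (P\<^sub>0 y)\<rangle>\<^sub>M \<oplus>\<^sub>M j (P\<^sub>0 x) (P\<^sub>0 y) (P\<^sub>0 z))))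
    = P\<^sub>1 \<langle>r x z, \<iota> y\<rangle>\<^sub>M \<oplus>\<^sub>M P\<^sub>1 \<langle>\<iota> x, r y z\<rangle>\<^sub>M
      \<oplus>\<^sub>M (P\<^sub>1 (j (P\<^sub>0 x) y (P\<^sub>0 z)) \<oplus>\<^sub>M P\<^sub>1 (j x (P\<^sub>0 y) (P\<^sub>0 z))
      \<oplus>\<^sub>M (r \<langle>P\<^sub>0 x, y\<rangle>\<^sub>O z \<oplus>\<^sub>M r \<langle>x, P\<^sub>0 y\<rangle>\<^sub>O z \<oplus>\<^sub>M \<langle>r x y, \<iota> (P\<^sub>0 z)\<rangle>\<^sub>M))"
proof -
  let ?a1 = "(\<iota> (P\<^sub>0 \<langle>x, P\<^sub>0 \<langle>P\<^sub>0 y, z\<rangle>\<^sub>O\<rangle>\<^sub>O \<oplus>\<^sub>O P\<^sub>0 \<langle>P\<^sub>0 x, \<langle>y, P\<^sub>0 z\<rangle>\<^sub>O\<rangle>\<^sub>O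
    \<oplus>\<^sub>O P\<^sub>0 \<langle>x, P\<^sub>0 \<langle>y, P\<^sub>0 z\<rangle>\<^sub>O\<rangle>\<^sub>O
          \<oplus>\<^sub>O P\<^sub>0 \<langle>P\<^sub>0 \<langle>x, P\<^sub>0 z\<rangle>\<^sub>O, y\<rangle>\<^sub>O \<oplus>\<^sub>O P\<^sub>0 \<langle>\<langle>x, P\<^sub>0 z\<rangle>\<^sub>O, P\<^sub>0 y\<rangle>\<^sub>O
            \<oplus>\<^sub>O P\<^sub>0 \<langle>P\<^sub>0 \<langle>P\<^sub>0 x, z\<rangle>\<^sub>O, y\<rangle>\<^sub>O)
        \<oplus>\<^sub>M P\<^sub>1 \<langle>\<R> x y, \<iota> z\<rangle>\<^sub>M)"
    and ?a2 = "(\<iota> (P\<^sub>0 \<langle>P\<^sub>0 x, \<langle>P\<^sub>0 y, z\<rangle>\<^sub>O\<rangle>\<^sub>O \<oplus>\<^sub>O P\<^sub>0 \<langle>x, P\<^sub>0 \<langle>P\<^sub>0 y, z\<rangle>\<^sub>O\<rangle>\<^sub>O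
          \<oplus>\<^sub>O P\<^sub>0 \<langle>P\<^sub>0 x, \<langle>y, P\<^sub>0 z\<rangle>\<^sub>O\<rangle>\<^sub>O \<oplus>\<^sub>O P\<^sub>0 \<langle>x, P\<^sub>0 \<langle>y, P\<^sub>0 z\<rangle>\<^sub>O\<rangle>\<^sub>O
          \<oplus>\<^sub>O P\<^sub>0 \<langle>P\<^sub>0 \<langle>x, P\<^sub>0 z\<rangle>\<^sub>O, y\<rangle>\<^sub>O \<oplus>\<^sub>O P\<^sub>0 \<langle>\<langle>x, P\<^sub>0 z\<rangle>\<^sub>O, P\<^sub>0 y\<rangle>\<^sub>O
            \<oplus>\<^sub>O P\<^sub>0 \<langle>P\<^sub>0 \<langle>P\<^sub>0 x, z\<rangle>\<^sub>O, y\<rangle>\<^sub>O)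
        \<oplus>\<^sub>M P\<^sub>1 (J (P\<^sub>0 x) z (P\<^sub>0 y)))"
    and ?a3 = "(\<R> x \<langle>P\<^sub>0 y, z\<rangle>\<^sub>O \<oplus>\<^sub>M \<R> x \<langle>y, P\<^sub>0 z\<rangle>\<^sub>O \<oplus>\<^sub>M \<R> \<langle>x, P\<^sub>0 z\<rangle>\<^sub>O y \<oplus>\<^sub>M \<R> \<langle>P\<^sub>0 x, z\<rangle>\<^sub>O y)"
    and ?a4 = "(\<langle>\<iota> (P\<^sub>0 x), \<R> y z\<rangle>\<^sub>M \<oplus>\<^sub>M \<langle>\<R> x z, \<iota> (P\<^sub>0 y)\<rangle>\<^sub>M)"
    and ?a5 = "J (P\<^sub>0 x) (P\<^sub>0 y) (P\<^sub>0 z)"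
    and ?b1 = "(\<iota> (P\<^sub>0 \<langle>P\<^sub>0 \<langle>P\<^sub>0 x, y\<rangle>\<^sub>O, z\<rangle>\<^sub>O \<oplus>\<^sub>O P\<^sub>0 \<langle>P\<^sub>0 \<langle>x, P\<^sub>0 y\<rangle>\<^sub>O, z\<rangle>\<^sub>O
          \<oplus>\<^sub>O P\<^sub>0 \<langle>P\<^sub>0 x, \<langle>y, P\<^sub>0 z\<rangle>\<^sub>O\<rangle>\<^sub>O \<oplus>\<^sub>O P\<^sub>0 \<langle>\<langle>x, P\<^sub>0 z\<rangle>\<^sub>O, P\<^sub>0 y\<rangle>\<^sub>O)
        \<oplus>\<^sub>M P\<^sub>1 \<langle>\<R> x z, \<iota> y\<rangle>\<^sub>M \<oplus>\<^sub>M P\<^sub>1 \<langle>\<iota> x, \<R> y z\<rangle>\<^sub>M)"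
    and ?b2 = "(\<iota> (P\<^sub>0 \<langle>P\<^sub>0 \<langle>P\<^sub>0 x, y\<rangle>\<^sub>O, z\<rangle>\<^sub>O \<oplus>\<^sub>O P\<^sub>0 \<langle>P\<^sub>0 \<langle>x, P\<^sub>0 y\<rangle>\<^sub>O, z\<rangle>\<^sub>O)
        \<oplus>\<^sub>M P\<^sub>1 (J (P\<^sub>0 x) y (P\<^sub>0 z)) \<oplus>\<^sub>M P\<^sub>1 (J x (P\<^sub>0 y) (P\<^sub>0 z)))"
    and ?b3 = "(\<R> \<langle>P\<^sub>0 x, y\<rangle>\<^sub>O z \<oplus>\<^sub>M \<R> \<langle>x, P\<^sub>0 y\<rangle>\<^sub>O z)"
    and ?b4 = "\<langle>\<R> x y, \<iota> (P\<^sub>0 z)\<rangle>\<^sub>M"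
  \<comment> \<open>The target of \<open>J (P\<^sub>0 x) z (P\<^sub>0 y)\<close> contains
    \<open>\<langle>P\<^sub>0 x, \<langle>z, P\<^sub>0 y\<rangle>\<rangle>\<close>, which has to
    cancel the summand that the first factor of the law omits. Skewness of the bracket on objects
    produces this cancellation.\<close>
  have swap: "\<langle>z, P\<^sub>0 y\<rangle>\<^sub>O = \<ominus>\<^bsub>Ob L\<^esub> \<langle>P\<^sub>0 y, z\<rangle>\<^sub>O" by (rule ob_br_swap) simp_all
  have c: "tgt L ?a5 = src L ?a4" "tgt L ?a4 = src L ?a3" "tgt L ?a3 = src L ?a2"
    "tgt L ?a2 = src L ?a1" "tgt L ?b4 = src L ?b3" "tgt L ?b3 = src L ?b2" "tgt L ?b2 = src L ?b1"
    by (rule Ob_eqI; simp add: swap; linarith)+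
  have "arrow_part L (?a1 \<diamondop> ?a2 \<diamondop> ?a3 \<diamondop> ?a4 \<diamondop> ?a5) = arrow_part L (?b1 \<diamondop> ?b2 \<diamondop> ?b3 \<diamondop> ?b4)"
    by (subst rb_coherence) simp_all
  also have "arrow_part L (?a1 \<diamondop> ?a2 \<diamondop> ?a3 \<diamondop> ?a4 \<diamondop> ?a5) = arrow_part L ?a1 \<oplus>\<^sub>M
      (arrow_part L ?a2 \<oplus>\<^sub>M (arrow_part L ?a3 \<oplus>\<^sub>M (arrow_part L ?a4 \<oplus>\<^sub>M arrow_part L ?a5)))"
    by (rule arrow_cmp5[OF _ _ _ _ _ c(1-4)]) simp_all
  also have "arrow_part L (?b1 \<diamondop> ?b2 \<diamondop> ?b3 \<diamondop> ?b4)
      = arrow_part L ?b1 \<oplus>\<^sub>M (arrow_part L ?b2 \<oplus>\<^sub>M (arrow_part L ?b3 \<oplus>\<^sub>M arrow_part L ?b4))"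
    by (rule arrow_cmp4[OF _ _ _ _ c(5-7)]) simp_all
  finally show ?thesis unfolding j_def r_def by simp
qed

end

section \<open>The 2-term algebra of a Lie 2-algebra\<close>

definition arrows where
  "arrows L = {u \<in> mors L. src L u = \<zero>\<^bsub>Ob L\<^esub>}"

text \<open>Degree 1 keeps the operations of the morphism space and only shrinks the carrier to
  \<open>ker s\<close>. Hence no elements have to be encoded, and sums and scalar multiples are
  literally those of morphisms.\<close>

definition linf_of :: "('k, 'v, 'd) rb_lie_two_alg_scheme \<Rightarrow> ('k, 'v) rb_two_term" where
  "linf_of L =
    \<lparr>G0 = Ob L, G1 = (Mor L)\<lparr>carrier := arrows L\<rparr>, diff = tgt L, br00 = ob_br L,
     br01 = (\<lambda>x u. mor_br L (idm L x) u), tern = (\<lambda>x y z. arrow_part L (jac L x y z)),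
     rop0 = rb_ob L, rop1 = rb_mor L, rop2 = (\<lambda>x y. arrow_part L (rb_nat L x y))\<rparr>"

lemma linf_of_simps [simp]:
  "G0 (linf_of L) = Ob L" "carrier (G1 (linf_of L)) = arrows L"
  "add (G1 (linf_of L)) = add (Mor L)" "zero (G1 (linf_of L)) = zero (Mor L)"
  "smult (G1 (linf_of L)) = smult (Mor L)" "diff (linf_of L) = tgt L" "br00 (linf_of L) = ob_br L"
  "br01 (linf_of L) x u = mor_br L (idm L x) u"
    "tern (linf_of L) x y z = arrow_part L (jac L x y z)"
  "rop0 (linf_of L) = rb_ob L" "rop1 (linf_of L) = rb_mor L"
  "rop2 (linf_of L) x y = arrow_part L (rb_nat L x y)"
  by (simp_all add: linf_of_def)

text \<open>Negation is not a field of the record: it is defined as the inverse within the carrier,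
  and so has to be compared again once the carrier shrinks.\<close>

lemma a_inv_restrict_carrier:
  assumes "abelian_group V" "abelian_group (V\<lparr>carrier := U\<rparr>)" "U \<subseteq> carrier V" "u \<in> U"
  shows "\<ominus>\<^bsub>V\<lparr>carrier := U\<rparr>\<^esub> u = \<ominus>\<^bsub>V\<^esub> u"
proof -
  interpret V: abelian_group V by fact
  interpret U: abelian_group "V\<lparr>carrier := U\<rparr>" by fact
  have "\<ominus>\<^bsub>V\<lparr>carrier := U\<rparr>\<^esub> u \<in> U" using U.a_inv_closed[of u] assms(4) by simp
  moreover have "\<ominus>\<^bsub>V\<lparr>carrier := U\<rparr>\<^esub> u \<oplus>\<^bsub>V\<^esub> u = \<zero>\<^bsub>V\<^esub>" using U.l_neg[of u] assms(4) by simp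
  ultimately show ?thesis using assms(3,4) by (intro V.minus_equality[symmetric]) auto
qed

section \<open>The kernel of the source map as a vector space\<close>

context two_vector_space
begin

declare Ob.neg_zero [simp] Mor.neg_zero [simp]

lemma arrows_iff [simp]: "u \<in> arrows L \<longleftrightarrow> u \<in> mors L \<and> src L u = \<zero>\<^bsub>Ob L\<^esub>"
  by (simp add: arrows_def)

lemmas arrow_part_zero [simp] = module_hom_simps(4)[OF Mor_module Mor_module arrow_part_linear]

lemma arrows_vectorspace: "vectorspace K ((Mor L)\<lparr>carrier := arrows L\<rparr>)"
proof -
  interpret M: vectorspace K "Mor L" using mor_space by (simp add: fd_vectorspace_def)
  have "subspace K (arrows L) (Mor L)"
    by (auto simp: subspace_def submodule_def M.vectorspace_axioms Mor_module)
  then show ?thesis by (rule M.subspace_is_vs)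
qed

lemma arrow_part_onto: "arrow_part L \<in> module_hom K (Mor L) ((Mor L)\<lparr>carrier := arrows L\<rparr>)"
  using arrow_part_linear by (auto simp: module_hom_def)

text \<open>The arrow part is a linear projection onto \<open>ker s\<close>, so
  \<open>fin_dim_sum\<close> applies with this map in both places; an element of the kernel is its
  own arrow part plus the arrow part of 0.\<close>

lemma arrows_fd: "fd_vectorspace K ((Mor L)\<lparr>carrier := arrows L\<rparr>)"
  by (rule fin_dim_sum[OF mor_space mor_space arrows_vectorspace arrow_part_onto arrow_part_onto])
    (force intro: bexI[of _ "\<zero>\<^bsub>Mor L\<^esub>"] simp: arrow_part_id)

lemma arrows_neg [simp]:
  "u \<in> arrows L \<Longrightarrow> \<ominus>\<^bsub>(Mor L)\<lparr>carrier := arrows L\<rparr>\<^esub> u = \<ominus>\<^bsub>Mor L\<^esub> u"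
  by (rule a_inv_restrict_carrier[OF Mor.abelian_group_axioms])
    (use arrows_vectorspace in \<open>auto simp: vectorspace_def module_def\<close>)

end

context rb_lie_two_algebra
begin

lemma linf_of_neg [simp]:
  "\<lbrakk>u \<in> mors L; src L u = \<zero>\<^bsub>Ob L\<^esub>\<rbrakk> \<Longrightarrow> \<ominus>\<^bsub>G1 (linf_of L)\<^esub> u = \<ominus>\<^bsub>Mor L\<^esub> u"
  using arrows_neg[of u] by (simp add: linf_of_def)

lemma linf_of_fd: "fd_vectorspace K (G1 (linf_of L))"
  using arrows_fd by (simp add: linf_of_def)

lemma linf_of_diff [simp]:
  "\<lbrakk>v \<in> mors L; src L v = \<zero>\<^bsub>Ob L\<^esub>\<rbrakk> \<Longrightarrow> u \<ominus>\<^bsub>G1 (linf_of L)\<^esub> v = u \<oplus>\<^sub>M \<ominus>\<^bsub>Mor L\<^esub> v"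
  by (simp add: a_minus_def)

end

section \<open>Naturality on arrow parts and the laws of the 2-term algebra\<close>

context char0_rb_lie_two_algebra
begin

text \<open>Naturality of the Jacobiator at two identities and an arrow \<open>u\<close> out of 0.
  By linearity the Jacobiator at the source of \<open>u\<close> is 0, and comparing arrow parts
  leaves the law that expresses \<open>l\<^sub>3\<close> on the image of
  \<open>l\<^sub>1\<close>.\<close>

lemma arrow_jac_tgt:
  assumes [simp]: "x \<in> obs L" "y \<in> obs L" "u \<in> mors L" "src L u = \<zero>\<^bsub>Ob L\<^esub>"
  shows "arrow_part L (J x y (tgt L u)) \<oplus>\<^sub>M \<langle>\<iota> \<langle>x, y\<rangle>\<^sub>O, u\<rangle>\<^sub>M
    = \<langle>\<iota> x, \<langle>\<iota> y, u\<rangle>\<^sub>M\<rangle>\<^sub>M \<oplus>\<^sub>M \<langle>\<langle>\<iota> x, u\<rangle>\<^sub>M, \<iota> y\<rangle>\<^sub>M"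
proof -
  have [simp]: "arrow_part L u = u" by (rule arrow_part_id) simp_all
  have "arrow_part L (J x y (tgt L u) \<diamondop> \<langle>\<langle>\<iota> x, \<iota> y\<rangle>\<^sub>M, u\<rangle>\<^sub>M)
      = arrow_part L ((\<langle>\<iota> x, \<langle>\<iota> y, u\<rangle>\<^sub>M\<rangle>\<^sub>M \<oplus>\<^sub>M \<langle>\<langle>\<iota> x, u\<rangle>\<^sub>M, \<iota> y\<rangle>\<^sub>M) \<diamondop> J x y (src L u))"
    using jac_natural[of "\<iota> x" "\<iota> y" u] by simp
  also have "arrow_part L (J x y (tgt L u) \<diamondop> \<langle>\<langle>\<iota> x, \<iota> y\<rangle>\<^sub>M, u\<rangle>\<^sub>M)
      = arrow_part L (J x y (tgt L u)) \<oplus>\<^sub>M \<langle>\<iota> \<langle>x, y\<rangle>\<^sub>O, u\<rangle>\<^sub>M"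
    by (subst cmp_simps) simp_all
  also have "arrow_part L ((\<langle>\<iota> x, \<langle>\<iota> y, u\<rangle>\<^sub>M\<rangle>\<^sub>M \<oplus>\<^sub>M \<langle>\<langle>\<iota> x, u\<rangle>\<^sub>M, \<iota> y\<rangle>\<^sub>M) \<diamondop> J x y (src L u))
      = \<langle>\<iota> x, \<langle>\<iota> y, u\<rangle>\<^sub>M\<rangle>\<^sub>M \<oplus>\<^sub>M \<langle>\<langle>\<iota> x, u\<rangle>\<^sub>M, \<iota> y\<rangle>\<^sub>M"
    by (subst cmp_simps) simp_all
  finally show ?thesis .
qed

text \<open>Naturality of \<open>\<R>\<close> at an arrow \<open>u\<close> out of 0 and an identity;
  the component at the source vanishes, which leaves the degree-1 Rota-Baxter relation.\<close>

lemma arrow_rb_tgt: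
  assumes [simp]: "x \<in> obs L" "u \<in> mors L" "src L u = \<zero>\<^bsub>Ob L\<^esub>"
  shows "arrow_part L (\<R> (tgt L u) x) \<oplus>\<^sub>M \<langle>P\<^sub>1 u, \<iota> (P\<^sub>0 x)\<rangle>\<^sub>M
    = P\<^sub>1 \<langle>P\<^sub>1 u, \<iota> x\<rangle>\<^sub>M \<oplus>\<^sub>M P\<^sub>1 \<langle>u, \<iota> (P\<^sub>0 x)\<rangle>\<^sub>M"
proof -
  have [simp]: "arrow_part L u = u" by (rule arrow_part_id) simp_all
  have "arrow_part L (\<R> (tgt L u) x \<diamondop> \<langle>P\<^sub>1 u, \<iota> (P\<^sub>0 x)\<rangle>\<^sub>M)
      = arrow_part L ((P\<^sub>1 \<langle>P\<^sub>1 u, \<iota> x\<rangle>\<^sub>M \<oplus>\<^sub>M P\<^sub>1 \<langle>u, \<iota> (P\<^sub>0 x)\<rangle>\<^sub>M) \<diamondop> \<R> (src L u) x)"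
    using rb_natural[of u "\<iota> x"] by simp
  also have "arrow_part L (\<R> (tgt L u) x \<diamondop> \<langle>P\<^sub>1 u, \<iota> (P\<^sub>0 x)\<rangle>\<^sub>M)
      = arrow_part L (\<R> (tgt L u) x) \<oplus>\<^sub>M \<langle>P\<^sub>1 u, \<iota> (P\<^sub>0 x)\<rangle>\<^sub>M"
    by (subst cmp_simps) simp_all
  also have "arrow_part L ((P\<^sub>1 \<langle>P\<^sub>1 u, \<iota> x\<rangle>\<^sub>M \<oplus>\<^sub>M P\<^sub>1 \<langle>u, \<iota> (P\<^sub>0 x)\<rangle>\<^sub>M) \<diamondop> \<R> (src L u) x)
      = P\<^sub>1 \<langle>P\<^sub>1 u, \<iota> x\<rangle>\<^sub>M \<oplus>\<^sub>M P\<^sub>1 \<langle>u, \<iota> (P\<^sub>0 x)\<rangle>\<^sub>M"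
    by (subst cmp_simps) simp_all
  finally show ?thesis .
qed

lemma linf_of_two_term_linf_algebra: "two_term_linf_algebra K (linf_of L)"
  (is "two_term_linf_algebra K ?G")
proof
  show "fd_vectorspace K (G0 ?G)" using ob_space by simp
  show "fd_vectorspace K (G1 ?G)" by (rule linf_of_fd)
  show "diff ?G \<in> module_hom K (G1 ?G) (G0 ?G)"
    by (rule module_homI) simp_all
  show "bilinear_map K (G0 ?G) (G0 ?G) (G0 ?G) (br00 ?G)"
    by (simp add: br.B0_bilinear)
  show "skew2 (G0 ?G) (G0 ?G) (br00 ?G)"
    by (simp add: ob_br_skew)
  show "bilinear_map K (G0 ?G) (G1 ?G) (G1 ?G) (br01 ?G)"
    by (rule bilinear_mapI) simp_all
  show "trilinear_map K (G0 ?G) (G1 ?G) (tern ?G)"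
    unfolding trilinear_map_def by (intro conjI ballI; rule module_homI) simp_all
  show "skew3 (G0 ?G) (G1 ?G) (tern ?G)"
    unfolding skew3_def
  proof (intro ballI conjI)
    fix x y z assume "x \<in> deg0 ?G" "y \<in> deg0 ?G" "z \<in> deg0 ?G"
    then have [simp]: "x \<in> obs L" "y \<in> obs L" "z \<in> obs L" by simp_all
    show "tern ?G x y z = \<ominus>\<^bsub>G1 ?G\<^esub> tern ?G y x z"
      using arrow_jac_skew(1)[of x y z] by simp
    show "tern ?G x y z = \<ominus>\<^bsub>G1 ?G\<^esub> tern ?G x z y"
      using arrow_jac_skew(2)[of x y z] by simp
  qed
next
  fix x u assume "x \<in> deg0 ?G" "u \<in> deg1 ?G"
  then show "l\<^sub>1\<^bsub>?G\<^esub> \<lbrakk>x, u\<rbrakk>\<^sub>0\<^sub>1\<^bsub>?G\<^esub> = \<lbrakk>x, l\<^sub>1\<^bsub>?G\<^esub> u\<rbrakk>\<^sub>0\<^sub>0\<^bsub>?G\<^esub>" by simp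
next
  fix u v assume "u \<in> deg1 ?G" "v \<in> deg1 ?G"
  then show "\<lbrakk>l\<^sub>1\<^bsub>?G\<^esub> u, v\<rbrakk>\<^sub>0\<^sub>1\<^bsub>?G\<^esub> = \<lbrakk>u, l\<^sub>1\<^bsub>?G\<^esub> v\<rbrakk>\<^sub>1\<^sub>0\<^bsub>?G\<^esub>"
    \<comment> \<open>Both sides are the bracket of the two arrows \<open>u\<close> and
      \<open>v\<close> out of 0, evaluated by sliding one or the other to its target.\<close>
    using mor_br_slide_left[of u v] mor_br_slide_right[of u v] mor_br_swap[of u "\<iota> (tgt L v)"]
    by simp
next
  fix x y z assume "x \<in> deg0 ?G" "y \<in> deg0 ?G" "z \<in> deg0 ?G"
  then have [simp]: "x \<in> obs L" "y \<in> obs L" "z \<in> obs L" by simp_all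
  have s: "\<langle>\<langle>x, y\<rangle>\<^sub>O, z\<rangle>\<^sub>O = \<ominus>\<^bsub>Ob L\<^esub> \<langle>z, \<langle>x, y\<rangle>\<^sub>O\<rangle>\<^sub>O" "\<langle>\<langle>x, z\<rangle>\<^sub>O, y\<rangle>\<^sub>O = \<ominus>\<^bsub>Ob L\<^esub> \<langle>y, \<langle>x, z\<rangle>\<^sub>O\<rangle>\<^sub>O"
    "\<langle>z, x\<rangle>\<^sub>O = \<ominus>\<^bsub>Ob L\<^esub> \<langle>x, z\<rangle>\<^sub>O"
    by (rule ob_br_swap; simp)+
  show "l\<^sub>1\<^bsub>?G\<^esub> (l\<^sub>3\<^bsub>?G\<^esub> x y z) = \<lbrakk>x, \<lbrakk>y, z\<rbrakk>\<^sub>0\<^sub>0\<^bsub>?G\<^esub>\<rbrakk>\<^sub>0\<^sub>0\<^bsub>?G\<^esub>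
      \<oplus>\<^sub>0\<^bsub>?G\<^esub> \<lbrakk>z, \<lbrakk>x, y\<rbrakk>\<^sub>0\<^sub>0\<^bsub>?G\<^esub>\<rbrakk>\<^sub>0\<^sub>0\<^bsub>?G\<^esub>
      \<oplus>\<^sub>0\<^bsub>?G\<^esub> \<lbrakk>y, \<lbrakk>z, x\<rbrakk>\<^sub>0\<^sub>0\<^bsub>?G\<^esub>\<rbrakk>\<^sub>0\<^sub>0\<^bsub>?G\<^esub>"
    by (rule Ob_eqI; simp add: s)
next
  fix x y u assume "x \<in> deg0 ?G" "y \<in> deg0 ?G" "u \<in> deg1 ?G"
  then have [simp]: "x \<in> obs L" "y \<in> obs L" "u \<in> mors L" "src L u = \<zero>\<^bsub>Ob L\<^esub>" by simp_all
  have s: "\<langle>\<langle>\<iota> x, u\<rangle>\<^sub>M, \<iota> y\<rangle>\<^sub>M = \<ominus>\<^bsub>Mor L\<^esub> \<langle>\<iota> y, \<langle>\<iota> x, u\<rangle>\<^sub>M\<rangle>\<^sub>M" by (rule mor_br_swap) simp_all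
  show "l\<^sub>3\<^bsub>?G\<^esub> x y (l\<^sub>1\<^bsub>?G\<^esub> u) = \<lbrakk>x, \<lbrakk>y, u\<rbrakk>\<^sub>0\<^sub>1\<^bsub>?G\<^esub>\<rbrakk>\<^sub>0\<^sub>1\<^bsub>?G\<^esub>
      \<oplus>\<^sub>1\<^bsub>?G\<^esub> \<lbrakk>u, \<lbrakk>x, y\<rbrakk>\<^sub>0\<^sub>0\<^bsub>?G\<^esub>\<rbrakk>\<^sub>1\<^sub>0\<^bsub>?G\<^esub>
      \<oplus>\<^sub>1\<^bsub>?G\<^esub> \<lbrakk>y, \<lbrakk>u, x\<rbrakk>\<^sub>1\<^sub>0\<^bsub>?G\<^esub>\<rbrakk>\<^sub>0\<^sub>1\<^bsub>?G\<^esub>"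
  proof (rule Mor_eqI)
    fix h assume [simp]: "h \<in> additive_functionals (Mor L)"
    show "h (l\<^sub>3\<^bsub>?G\<^esub> x y (l\<^sub>1\<^bsub>?G\<^esub> u)) = h (\<lbrakk>x, \<lbrakk>y, u\<rbrakk>\<^sub>0\<^sub>1\<^bsub>?G\<^esub>\<rbrakk>\<^sub>0\<^sub>1\<^bsub>?G\<^esub>
      \<oplus>\<^sub>1\<^bsub>?G\<^esub> \<lbrakk>u, \<lbrakk>x, y\<rbrakk>\<^sub>0\<^sub>0\<^bsub>?G\<^esub>\<rbrakk>\<^sub>1\<^sub>0\<^bsub>?G\<^esub>
      \<oplus>\<^sub>1\<^bsub>?G\<^esub> \<lbrakk>y, \<lbrakk>u, x\<rbrakk>\<^sub>1\<^sub>0\<^bsub>?G\<^esub>\<rbrakk>\<^sub>0\<^sub>1\<^bsub>?G\<^esub>)"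
      using arg_cong[OF arrow_jac_tgt[of x y u], of h] by (simp add: s)
  qed simp_all
next
  fix w x y z assume "w \<in> deg0 ?G" "x \<in> deg0 ?G" "y \<in> deg0 ?G"
    "z \<in> deg0 ?G"
  then have [simp]: "w \<in> obs L" "x \<in> obs L" "y \<in> obs L" "z \<in> obs L" by simp_all
  let ?j = "\<lambda>x y z. arrow_part L (J x y z)"
  \<comment> \<open>Skewness brings every Jacobiator with a bracket among its arguments to the order
    with the bracket first, and the next block puts the object to the left of the arrow. After that
    the two forms of the law differ only by linear rearrangement.\<close>
  have s: "?j w \<langle>x, y\<rangle>\<^sub>O z = \<ominus>\<^bsub>Mor L\<^esub> ?j \<langle>x, y\<rangle>\<^sub>O w z" "?j w \<langle>x, z\<rangle>\<^sub>O y = \<ominus>\<^bsub>Mor L\<^esub> ?j \<langle>x, z\<rangle>\<^sub>O w y"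
    "?j w x \<langle>y, z\<rangle>\<^sub>O = \<ominus>\<^bsub>Mor L\<^esub> ?j w \<langle>y, z\<rangle>\<^sub>O x" "?j w \<langle>y, z\<rangle>\<^sub>O x = \<ominus>\<^bsub>Mor L\<^esub> ?j \<langle>y, z\<rangle>\<^sub>O w x"
    by (rule arrow_jac_skew; simp)+
  have t: "\<langle>?j w y z, \<iota> x\<rangle>\<^sub>M = \<ominus>\<^bsub>Mor L\<^esub> \<langle>\<iota> x, ?j w y z\<rangle>\<^sub>M"
    "\<langle>?j w x y, \<iota> z\<rangle>\<^sub>M = \<ominus>\<^bsub>Mor L\<^esub> \<langle>\<iota> z, ?j w x y\<rangle>\<^sub>M"
    "\<langle>?j w x z, \<iota> y\<rangle>\<^sub>M = \<ominus>\<^bsub>Mor L\<^esub> \<langle>\<iota> y, ?j w x z\<rangle>\<^sub>M"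
    by (rule mor_br_swap; simp)+
  show "(\<lbrakk>w, l\<^sub>3\<^bsub>?G\<^esub> x y z\<rbrakk>\<^sub>0\<^sub>1\<^bsub>?G\<^esub> \<ominus>\<^sub>1\<^bsub>?G\<^esub> \<lbrakk>x, l\<^sub>3\<^bsub>?G\<^esub> w y z\<rbrakk>\<^sub>0\<^sub>1\<^bsub>?G\<^esub>
        \<oplus>\<^sub>1\<^bsub>?G\<^esub> \<lbrakk>y, l\<^sub>3\<^bsub>?G\<^esub> w x z\<rbrakk>\<^sub>0\<^sub>1\<^bsub>?G\<^esub> \<ominus>\<^sub>1\<^bsub>?G\<^esub> \<lbrakk>z, l\<^sub>3\<^bsub>?G\<^esub> w x y\<rbrakk>\<^sub>0\<^sub>1\<^bsub>?G\<^esub>)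
      \<oplus>\<^sub>1\<^bsub>?G\<^esub> (\<ominus>\<^bsub>G1 ?G\<^esub> l\<^sub>3\<^bsub>?G\<^esub> \<lbrakk>w, x\<rbrakk>\<^sub>0\<^sub>0\<^bsub>?G\<^esub> y z
        \<oplus>\<^sub>1\<^bsub>?G\<^esub> l\<^sub>3\<^bsub>?G\<^esub> \<lbrakk>w, y\<rbrakk>\<^sub>0\<^sub>0\<^bsub>?G\<^esub> x z \<ominus>\<^sub>1\<^bsub>?G\<^esub> l\<^sub>3\<^bsub>?G\<^esub> \<lbrakk>w, z\<rbrakk>\<^sub>0\<^sub>0\<^bsub>?G\<^esub> x y
        \<ominus>\<^sub>1\<^bsub>?G\<^esub> l\<^sub>3\<^bsub>?G\<^esub> \<lbrakk>x, y\<rbrakk>\<^sub>0\<^sub>0\<^bsub>?G\<^esub> w z \<oplus>\<^sub>1\<^bsub>?G\<^esub> l\<^sub>3\<^bsub>?G\<^esub> \<lbrakk>x, z\<rbrakk>\<^sub>0\<^sub>0\<^bsub>?G\<^esub> w y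
        \<ominus>\<^sub>1\<^bsub>?G\<^esub> l\<^sub>3\<^bsub>?G\<^esub> \<lbrakk>y, z\<rbrakk>\<^sub>0\<^sub>0\<^bsub>?G\<^esub> w x)
      = \<zero>\<^bsub>G1 ?G\<^esub>" (is "?lhs = _")
  proof (rule Mor_eqI)
    fix h assume [simp]: "h \<in> additive_functionals (Mor L)"
    show "h ?lhs = h \<zero>\<^bsub>G1 ?G\<^esub>"
      using arg_cong[OF arrow_jac_coherence[of w x y z], of h] by (simp add: s t)
  qed simp_all
qed

lemma linf_of_rb_two_term_linf_algebra: "rb_two_term_linf_algebra K (linf_of L)"
  (is "rb_two_term_linf_algebra K ?G")
proof -
  interpret two_term_linf_algebra K ?G by (rule linf_of_two_term_linf_algebra)
  show ?thesis
  proof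
    show "rop0 ?G \<in> module_hom K (G0 ?G) (G0 ?G)"
      by (rule module_homI) simp_all
    show "rop1 ?G \<in> module_hom K (G1 ?G) (G1 ?G)"
      by (rule module_homI) simp_all
    show "bilinear_map K (G0 ?G) (G0 ?G) (G1 ?G) (rop2 ?G)"
      by (rule bilinear_mapI) simp_all
    show "skew2 (G0 ?G) (G1 ?G) (rop2 ?G)"
      unfolding skew2_def
    proof (intro ballI)
      fix x y assume "x \<in> deg0 ?G" "y \<in> deg0 ?G"
      then show "rop2 ?G x y = \<ominus>\<^bsub>G1 ?G\<^esub> rop2 ?G y x"
        using arrow_rb_skew[of x y] by simp
    qed
  next
    fix u assume "u \<in> deg1 ?G"
    then show "l\<^sub>1\<^bsub>?G\<^esub> (R\<^sub>1\<^bsub>?G\<^esub> u) = R\<^sub>0\<^bsub>?G\<^esub> (l\<^sub>1\<^bsub>?G\<^esub> u)" by simp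
  next
    fix x y assume "x \<in> deg0 ?G" "y \<in> deg0 ?G"
    then show "R\<^sub>0\<^bsub>?G\<^esub> (\<lbrakk>R\<^sub>0\<^bsub>?G\<^esub> x, y\<rbrakk>\<^sub>0\<^sub>0\<^bsub>?G\<^esub>
        \<oplus>\<^sub>0\<^bsub>?G\<^esub> \<lbrakk>x, R\<^sub>0\<^bsub>?G\<^esub> y\<rbrakk>\<^sub>0\<^sub>0\<^bsub>?G\<^esub>)
        \<ominus>\<^sub>0\<^bsub>?G\<^esub> \<lbrakk>R\<^sub>0\<^bsub>?G\<^esub> x, R\<^sub>0\<^bsub>?G\<^esub> y\<rbrakk>\<^sub>0\<^sub>0\<^bsub>?G\<^esub>
        = l\<^sub>1\<^bsub>?G\<^esub> (R\<^sub>2\<^bsub>?G\<^esub> x y)"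
      by (simp add: a_minus_def)
  next
    fix u x assume "u \<in> deg1 ?G" "x \<in> deg0 ?G"
    then have [simp]: "x \<in> obs L" "u \<in> mors L" "src L u = \<zero>\<^bsub>Ob L\<^esub>" by simp_all
    have s: "\<langle>P\<^sub>1 u, \<iota> (P\<^sub>0 x)\<rangle>\<^sub>M = \<ominus>\<^bsub>Mor L\<^esub> \<langle>\<iota> (P\<^sub>0 x), P\<^sub>1 u\<rangle>\<^sub>M"
      "\<langle>P\<^sub>1 u, \<iota> x\<rangle>\<^sub>M = \<ominus>\<^bsub>Mor L\<^esub> \<langle>\<iota> x, P\<^sub>1 u\<rangle>\<^sub>M" "\<langle>u, \<iota> (P\<^sub>0 x)\<rangle>\<^sub>M = \<ominus>\<^bsub>Mor L\<^esub> \<langle>\<iota> (P\<^sub>0 x), u\<rangle>\<^sub>M"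
      by (rule mor_br_swap; simp)+
    show "R\<^sub>1\<^bsub>?G\<^esub> (\<lbrakk>R\<^sub>1\<^bsub>?G\<^esub> u, x\<rbrakk>\<^sub>1\<^sub>0\<^bsub>?G\<^esub>
        \<oplus>\<^sub>1\<^bsub>?G\<^esub> \<lbrakk>u, R\<^sub>0\<^bsub>?G\<^esub> x\<rbrakk>\<^sub>1\<^sub>0\<^bsub>?G\<^esub>)
        \<ominus>\<^sub>1\<^bsub>?G\<^esub> \<lbrakk>R\<^sub>1\<^bsub>?G\<^esub> u, R\<^sub>0\<^bsub>?G\<^esub> x\<rbrakk>\<^sub>1\<^sub>0\<^bsub>?G\<^esub>
        = R\<^sub>2\<^bsub>?G\<^esub> (l\<^sub>1\<^bsub>?G\<^esub> u) x" (is "?lhs = ?rhs")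
    proof (rule Mor_eqI)
      fix h assume [simp]: "h \<in> additive_functionals (Mor L)"
      show "h ?lhs = h ?rhs"
        using arg_cong[OF arrow_rb_tgt[of x u], of h] by (simp add: s)
    qed simp_all
  next
    fix x y z assume "x \<in> deg0 ?G" "y \<in> deg0 ?G" "z \<in> deg0 ?G"
    then have [simp]: "x \<in> obs L" "y \<in> obs L" "z \<in> obs L" by simp_all
    let ?j = "\<lambda>x y z. arrow_part L (J x y z)" and ?r = "\<lambda>x y. arrow_part L (\<R> x y)"
    \<comment> \<open>The cyclic sum and the coherence law contain the same terms with permuted
      arguments. The blocks \<open>s\<close>, \<open>o\<close>, \<open>j\<close> and
      \<open>t\<close> choose one representative for each, so that the remaining comparison is
      linear.\<close>
    have s: "?r z x = \<ominus>\<^bsub>Mor L\<^esub> ?r x z"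
      "?r z \<langle>P\<^sub>0 x, y\<rangle>\<^sub>O = \<ominus>\<^bsub>Mor L\<^esub> ?r \<langle>P\<^sub>0 x, y\<rangle>\<^sub>O z"
        "?r z \<langle>x, P\<^sub>0 y\<rangle>\<^sub>O = \<ominus>\<^bsub>Mor L\<^esub> ?r \<langle>x, P\<^sub>0 y\<rangle>\<^sub>O z"
      "?r y \<langle>P\<^sub>0 x, z\<rangle>\<^sub>O = \<ominus>\<^bsub>Mor L\<^esub> ?r \<langle>P\<^sub>0 x, z\<rangle>\<^sub>O y"
        "?r y \<langle>x, P\<^sub>0 z\<rangle>\<^sub>O = \<ominus>\<^bsub>Mor L\<^esub> ?r \<langle>x, P\<^sub>0 z\<rangle>\<^sub>O y"
      by (rule arrow_rb_skew; simp)+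
    have o: "\<langle>P\<^sub>0 y, x\<rangle>\<^sub>O = \<ominus>\<^bsub>Ob L\<^esub> \<langle>x, P\<^sub>0 y\<rangle>\<^sub>O" "\<langle>P\<^sub>0 z, y\<rangle>\<^sub>O = \<ominus>\<^bsub>Ob L\<^esub> \<langle>y, P\<^sub>0 z\<rangle>\<^sub>O"
      "\<langle>P\<^sub>0 z, x\<rangle>\<^sub>O = \<ominus>\<^bsub>Ob L\<^esub> \<langle>x, P\<^sub>0 z\<rangle>\<^sub>O"
      by (rule ob_br_swap; simp)+
    have j: "?j (P\<^sub>0 y) (P\<^sub>0 z) x = \<ominus>\<^bsub>Mor L\<^esub> ?j (P\<^sub>0 y) x (P\<^sub>0 z)"
      "?j (P\<^sub>0 y) x (P\<^sub>0 z) = \<ominus>\<^bsub>Mor L\<^esub> ?j x (P\<^sub>0 y) (P\<^sub>0 z)"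
      "?j (P\<^sub>0 z) (P\<^sub>0 x) y = \<ominus>\<^bsub>Mor L\<^esub> ?j (P\<^sub>0 x) (P\<^sub>0 z) y"
        "?j (P\<^sub>0 x) (P\<^sub>0 z) y = \<ominus>\<^bsub>Mor L\<^esub> ?j (P\<^sub>0 x) y (P\<^sub>0 z)"
      "?j (P\<^sub>0 x) (P\<^sub>0 y) z = \<ominus>\<^bsub>Mor L\<^esub> ?j (P\<^sub>0 x) z (P\<^sub>0 y)"
      by (rule arrow_jac_skew; simp)+
    have t: "\<langle>?r x y, \<iota> z\<rangle>\<^sub>M = \<ominus>\<^bsub>Mor L\<^esub> \<langle>\<iota> z, ?r x y\<rangle>\<^sub>M"
      "\<langle>?r x z, \<iota> y\<rangle>\<^sub>M = \<ominus>\<^bsub>Mor L\<^esub> \<langle>\<iota> y, ?r x z\<rangle>\<^sub>M"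
      "\<langle>?r x z, \<iota> (P\<^sub>0 y)\<rangle>\<^sub>M = \<ominus>\<^bsub>Mor L\<^esub> \<langle>\<iota> (P\<^sub>0 y), ?r x z\<rangle>\<^sub>M"
      "\<langle>?r x y, \<iota> (P\<^sub>0 z)\<rangle>\<^sub>M = \<ominus>\<^bsub>Mor L\<^esub> \<langle>\<iota> (P\<^sub>0 z), ?r x y\<rangle>\<^sub>M"
      by (rule mor_br_swap; simp)+
    show "rop_cyclic_summand ?G x y z \<oplus>\<^sub>1\<^bsub>?G\<^esub> rop_cyclic_summand ?G y z x
        \<oplus>\<^sub>1\<^bsub>?G\<^esub> rop_cyclic_summand ?G z x y
        \<oplus>\<^sub>1\<^bsub>?G\<^esub> l\<^sub>3\<^bsub>?G\<^esub> (R\<^sub>0\<^bsub>?G\<^esub> x) (R\<^sub>0\<^bsub>?G\<^esub> y) (R\<^sub>0\<^bsub>?G\<^esub> z)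
        = \<zero>\<^bsub>G1 ?G\<^esub>" (is "?lhs = _")
    proof (rule Mor_eqI)
      show "?lhs \<in> mors L" by (simp add: rop_cyclic_summand_def a_minus_def[of "Ob L"])
    next
      fix h assume [simp]: "h \<in> additive_functionals (Mor L)"
      show "h ?lhs = h \<zero>\<^bsub>G1 ?G\<^esub>"
        using arg_cong[OF arrow_rb_coherence[of x y z], of h]
        by (simp add: rop_cyclic_summand_def a_minus_def[of "Ob L"] s t o j)
    qed simp_all
  qed
qed

end

section \<open>Homomorphisms\<close>

locale char0_rb_lie_two_pair =
  L: char0_rb_lie_two_algebra K L + L': char0_rb_lie_two_algebra K L'
  for K :: "('k, 'c) ring_scheme"
    and L' :: "('k, 'v) rb_lie_two_alg" (structure)
    and L :: "('k, 'v) rb_lie_two_alg"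

section \<open>From homomorphisms of Lie 2-algebras to 2-term algebras\<close>

locale char0_rb_lie_two_homomorphism =
  char0_rb_lie_two_pair K L' L + rb_lie_two_homomorphism K L' L F0 F1 F2 F3
  for K :: "('k, 'c) ring_scheme"
    and L' :: "('k, 'v) rb_lie_two_alg" (structure)
    and L :: "('k, 'v) rb_lie_two_alg"
    and F0 F1 F2 F3
begin

lemmas F0_simps [simp] = module_hom_simps[OF L.Ob_module L'.Ob_module F0_linear]
lemmas F1_simps [simp] = module_hom_simps[OF L.Mor_module L'.Mor_module F1_linear]
lemmas F2_simps [simp] = bilinear_map_simps[OF L.Ob_module L.Ob_module L'.Mor_module F2_bilinear]
lemmas F3_simps [simp] = module_hom_simps[OF L.Ob_module L'.Mor_module F3_linear]

declare F_src [simp] F_tgt [simp] F_idm [simp]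

lemma src_F2 [simp]: "\<lbrakk>x \<in> obs L; y \<in> obs L\<rbrakk> \<Longrightarrow> src L' (F2 x y) = \<langle>F0 x, F0 y\<rangle>\<^sub>O"
  and tgt_F2 [simp]: "\<lbrakk>x \<in> obs L; y \<in> obs L\<rbrakk> \<Longrightarrow> tgt L' (F2 x y) = F0 \<langle>x, y\<rangle>\<^sub>O\<^bsub>L\<^esub>"
  using F2_between[of x y] by (simp_all add: mor_between_def)

lemma src_F3 [simp]: "x \<in> obs L \<Longrightarrow> src L' (F3 x) = P\<^sub>0 (F0 x)"
  and tgt_F3 [simp]: "x \<in> obs L \<Longrightarrow> tgt L' (F3 x) = F0 (P\<^sub>0\<^bsub>L\<^esub> x)"
  using F3_between[of x] by (simp_all add: mor_between_def)

lemma arrow_F1 [simp]: "f \<in> mors L \<Longrightarrow> arrow_part L' (F1 f) = F1 (arrow_part L f)"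
  by (simp add: L.arrow_part_eq L'.arrow_part_eq)

text \<open>Naturality of \<open>F2\<close> at an identity and an arrow out of 0, where the
  component at the source vanishes by bilinearity. The lemma on \<open>F3\<close> below is obtained
  in the same way.\<close>

lemma arrow_F2_tgt:
  assumes [simp]: "x \<in> obs L" "u \<in> mors L" "src L u = \<zero>\<^bsub>Ob L\<^esub>"
  shows "arrow_part L' (F2 x (tgt L u)) \<oplus>\<^sub>M \<langle>\<iota> (F0 x), F1 u\<rangle>\<^sub>M = F1 \<langle>\<iota>\<^bsub>L\<^esub> x, u\<rangle>\<^sub>M\<^bsub>L\<^esub>"
proof -
  have [simp]: "arrow_part L u = u" by (rule L.arrow_part_id) simp_all
  have "arrow_part L' (F2 x (tgt L u) \<diamondop> \<langle>\<iota> (F0 x), F1 u\<rangle>\<^sub>M)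
      = arrow_part L' (F1 \<langle>\<iota>\<^bsub>L\<^esub> x, u\<rangle>\<^sub>M\<^bsub>L\<^esub> \<diamondop> F2 x (src L u))"
    using F2_natural[of "\<iota>\<^bsub>L\<^esub> x" u] by simp
  also have "arrow_part L' (F2 x (tgt L u) \<diamondop> \<langle>\<iota> (F0 x), F1 u\<rangle>\<^sub>M)
      = arrow_part L' (F2 x (tgt L u)) \<oplus>\<^sub>M \<langle>\<iota> (F0 x), F1 u\<rangle>\<^sub>M"
    by (subst L'.cmp_simps) simp_all
  also have "arrow_part L' (F1 \<langle>\<iota>\<^bsub>L\<^esub> x, u\<rangle>\<^sub>M\<^bsub>L\<^esub> \<diamondop> F2 x (src L u)) = F1 \<langle>\<iota>\<^bsub>L\<^esub> x, u\<rangle>\<^sub>M\<^bsub>L\<^esub>"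
    by (subst L'.cmp_simps) simp_all
  finally show ?thesis .
qed

lemma arrow_F3_tgt:
  assumes [simp]: "u \<in> mors L" "src L u = \<zero>\<^bsub>Ob L\<^esub>"
  shows "arrow_part L' (F3 (tgt L u)) \<oplus>\<^sub>M P\<^sub>1 (F1 u) = F1 (P\<^sub>1\<^bsub>L\<^esub> u)"
proof -
  have [simp]: "arrow_part L u = u" by (rule L.arrow_part_id) simp_all
  have "arrow_part L' (F3 (tgt L u) \<diamondop> P\<^sub>1 (F1 u)) = arrow_part L' (F1 (P\<^sub>1\<^bsub>L\<^esub> u) \<diamondop> F3 (src L u))"
    using F3_natural[of u] by simp
  also have "arrow_part L' (F3 (tgt L u) \<diamondop> P\<^sub>1 (F1 u))
      = arrow_part L' (F3 (tgt L u)) \<oplus>\<^sub>M P\<^sub>1 (F1 u)"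
    by (subst L'.cmp_simps) simp_all
  also have "arrow_part L' (F1 (P\<^sub>1\<^bsub>L\<^esub> u) \<diamondop> F3 (src L u)) = F1 (P\<^sub>1\<^bsub>L\<^esub> u)"
    by (subst L'.cmp_simps) simp_all
  finally show ?thesis .
qed

lemma arrow_F2_coherence:
  assumes [simp]: "x \<in> obs L" "y \<in> obs L" "z \<in> obs L"
  shows "F1 (arrow_part L (J\<^bsub>L\<^esub> x y z)) \<oplus>\<^sub>M (arrow_part L' (F2 \<langle>x, y\<rangle>\<^sub>O\<^bsub>L\<^esub> z)
      \<oplus>\<^sub>M \<langle>arrow_part L' (F2 x y), \<iota> (F0 z)\<rangle>\<^sub>M)
    = arrow_part L' (F2 x \<langle>y, z\<rangle>\<^sub>O\<^bsub>L\<^esub>) \<oplus>\<^sub>M arrow_part L' (F2 \<langle>x, z\<rangle>\<^sub>O\<^bsub>L\<^esub> y)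
      \<oplus>\<^sub>M (\<langle>\<iota> (F0 x), arrow_part L' (F2 y z)\<rangle>\<^sub>M \<oplus>\<^sub>M \<langle>arrow_part L' (F2 x z), \<iota> (F0 y)\<rangle>\<^sub>M
      \<oplus>\<^sub>M arrow_part L' (J (F0 x) (F0 y) (F0 z)))"
proof -
  let ?a1 = "F1 (J\<^bsub>L\<^esub> x y z)" and ?a2 = "F2 \<langle>x, y\<rangle>\<^sub>O\<^bsub>L\<^esub> z" and ?a3 = "\<langle>F2 x y, \<iota> (F0 z)\<rangle>\<^sub>M"
    and ?b1 = "F2 x \<langle>y, z\<rangle>\<^sub>O\<^bsub>L\<^esub> \<oplus>\<^sub>M F2 \<langle>x, z\<rangle>\<^sub>O\<^bsub>L\<^esub> y"
    and ?b2 = "\<langle>\<iota> (F0 x), F2 y z\<rangle>\<^sub>M \<oplus>\<^sub>M \<langle>F2 x z, \<iota> (F0 y)\<rangle>\<^sub>M" and ?b3 = "J (F0 x) (F0 y) (F0 z)"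
  have "arrow_part L' (?a1 \<diamondop> ?a2 \<diamondop> ?a3) = arrow_part L' (?b1 \<diamondop> ?b2 \<diamondop> ?b3)"
    by (subst F2_coherence) simp_all
  also have "arrow_part L' (?a1 \<diamondop> ?a2 \<diamondop> ?a3)
      = arrow_part L' ?a1 \<oplus>\<^sub>M (arrow_part L' ?a2 \<oplus>\<^sub>M arrow_part L' ?a3)"
    by (rule L'.arrow_cmp3) simp_all
  also have "arrow_part L' (?b1 \<diamondop> ?b2 \<diamondop> ?b3)
      = arrow_part L' ?b1 \<oplus>\<^sub>M (arrow_part L' ?b2 \<oplus>\<^sub>M arrow_part L' ?b3)"
    by (rule L'.arrow_cmp3) simp_all
  finally show ?thesis by simp
qed

text \<open>The bracket of the morphisms \<open>F3 x\<close> and \<open>F3 y\<close> contributes two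
  terms, one over the source of \<open>F3 y\<close> and one over the target of \<open>F3 x\<close>.
  Their sum is the \<open>arrow_br\<close> term in the last condition on 2-term
  homomorphisms.\<close>

lemma arrow_F3_coherence:
  assumes [simp]: "x \<in> obs L" "y \<in> obs L"
  defines "a2 \<equiv> \<lambda>x y. arrow_part L' (F2 x y)" and "a3 \<equiv> \<lambda>x. arrow_part L' (F3 x)"
  shows "a3 \<langle>P\<^sub>0\<^bsub>L\<^esub> x, y\<rangle>\<^sub>O\<^bsub>L\<^esub> \<oplus>\<^sub>M a3 \<langle>x, P\<^sub>0\<^bsub>L\<^esub> y\<rangle>\<^sub>O\<^bsub>L\<^esub>
      \<oplus>\<^sub>M (P\<^sub>1 (a2 (P\<^sub>0\<^bsub>L\<^esub> x) y) \<oplus>\<^sub>M P\<^sub>1 (a2 x (P\<^sub>0\<^bsub>L\<^esub> y))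
      \<oplus>\<^sub>M (P\<^sub>1 \<langle>a3 x, \<iota> (F0 y)\<rangle>\<^sub>M \<oplus>\<^sub>M P\<^sub>1 \<langle>\<iota> (F0 x), a3 y\<rangle>\<^sub>M \<oplus>\<^sub>M arrow_part L' (\<R> (F0 x) (F0 y))))
    = F1 (arrow_part L (\<R>\<^bsub>L\<^esub> x y)) \<oplus>\<^sub>M (a2 (P\<^sub>0\<^bsub>L\<^esub> x) (P\<^sub>0\<^bsub>L\<^esub> y)
      \<oplus>\<^sub>M (\<langle>a3 x, \<iota> (P\<^sub>0 (F0 y))\<rangle>\<^sub>M \<oplus>\<^sub>M \<langle>\<iota> (F0 (P\<^sub>0\<^bsub>L\<^esub> x)), a3 y\<rangle>\<^sub>M))"
proof -
  let ?a1 = "F3 \<langle>P\<^sub>0\<^bsub>L\<^esub> x, y\<rangle>\<^sub>O\<^bsub>L\<^esub> \<oplus>\<^sub>M F3 \<langle>x, P\<^sub>0\<^bsub>L\<^esub> y\<rangle>\<^sub>O\<^bsub>L\<^esub>"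
    and ?a2 = "P\<^sub>1 (F2 (P\<^sub>0\<^bsub>L\<^esub> x) y) \<oplus>\<^sub>M P\<^sub>1 (F2 x (P\<^sub>0\<^bsub>L\<^esub> y))"
    and ?a3 = "P\<^sub>1 \<langle>F3 x, \<iota> (F0 y)\<rangle>\<^sub>M \<oplus>\<^sub>M P\<^sub>1 \<langle>\<iota> (F0 x), F3 y\<rangle>\<^sub>M" and ?a4 = "\<R> (F0 x) (F0 y)"
    and ?b1 = "F1 (\<R>\<^bsub>L\<^esub> x y)" and ?b2 = "F2 (P\<^sub>0\<^bsub>L\<^esub> x) (P\<^sub>0\<^bsub>L\<^esub> y)" and ?b3 = "\<langle>F3 x, F3 y\<rangle>\<^sub>M"
  have "arrow_part L' (?a1 \<diamondop> ?a2 \<diamondop> ?a3 \<diamondop> ?a4) = arrow_part L' (?b1 \<diamondop> ?b2 \<diamondop> ?b3)"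
    by (subst F3_coherence) simp_all
  also have "arrow_part L' (?a1 \<diamondop> ?a2 \<diamondop> ?a3 \<diamondop> ?a4) = arrow_part L' ?a1 \<oplus>\<^sub>M
      (arrow_part L' ?a2 \<oplus>\<^sub>M (arrow_part L' ?a3 \<oplus>\<^sub>M arrow_part L' ?a4))"
    by (rule L'.arrow_cmp4) simp_all
  also have "arrow_part L' (?b1 \<diamondop> ?b2 \<diamondop> ?b3)
      = arrow_part L' ?b1 \<oplus>\<^sub>M (arrow_part L' ?b2 \<oplus>\<^sub>M arrow_part L' ?b3)"
    by (rule L'.arrow_cmp3) simp_all
  finally show ?thesis unfolding a2_def a3_def by (simp add: L'.arrow_part_mor_br)
qed

lemma linf_of_homomorphism:
  "rb_linf_homomorphism K (linf_of L') (linf_of L) F0 F1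
    (\<lambda>x y. arrow_part L' (F2 x y)) (\<lambda>x. arrow_part L' (F3 x))"
  (is "rb_linf_homomorphism K ?G' ?G _ _ _ _")
proof
  show "F0 \<in> module_hom K (G0 ?G) (G0 ?G')" by (simp add: F0_linear)
  show "F1 \<in> module_hom K (G1 ?G) (G1 ?G')"
    by (rule module_homI) simp_all
  show "bilinear_map K (G0 ?G) (G0 ?G) (G1 ?G')
      (\<lambda>x y. arrow_part L' (F2 x y))"
    by (rule bilinear_mapI) simp_all
  show "skew2 (G0 ?G) (G1 ?G') (\<lambda>x y. arrow_part L' (F2 x y))"
    unfolding skew2_def
  proof (intro ballI)
    fix x y assume "x \<in> deg0 ?G" "y \<in> deg0 ?G"
    then have xy: "x \<in> obs L" "y \<in> obs L" by simp_all
    have "arrow_part L' (F2 x y) = \<ominus>\<^bsub>Mor L'\<^esub> arrow_part L' (F2 y x)"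
      using F2_skew xy unfolding skew2_def by blast
    with xy show "arrow_part L' (F2 x y) = \<ominus>\<^bsub>G1 ?G'\<^esub> arrow_part L' (F2 y x)"
      by simp
  qed
  show "(\<lambda>x. arrow_part L' (F3 x)) \<in> module_hom K (G0 ?G) (G1 ?G')"
    by (rule module_homI) simp_all
next
  fix u assume "u \<in> deg1 ?G"
  then have [simp]: "u \<in> mors L" "src L u = \<zero>\<^bsub>Ob L\<^esub>" by simp_all
  show "l\<^sub>1\<^bsub>?G'\<^esub> (F1 u) = F0 (l\<^sub>1\<^bsub>?G\<^esub> u)" by simp
  show "arrow_part L' (F3 (l\<^sub>1\<^bsub>?G\<^esub> u))
      = F1 (R\<^sub>1\<^bsub>?G\<^esub> u) \<ominus>\<^sub>1\<^bsub>?G'\<^esub> R\<^sub>1\<^bsub>?G'\<^esub> (F1 u)"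
    by (rule L'.Mor_eqI) (use arrow_F3_tgt[of u, symmetric] in simp_all)
next
  fix x u assume "x \<in> deg0 ?G" "u \<in> deg1 ?G"
  then have [simp]: "x \<in> obs L" "u \<in> mors L" "src L u = \<zero>\<^bsub>Ob L\<^esub>" by simp_all
  show "arrow_part L' (F2 x (l\<^sub>1\<^bsub>?G\<^esub> u))
      = F1 \<lbrakk>x, u\<rbrakk>\<^sub>0\<^sub>1\<^bsub>?G\<^esub> \<ominus>\<^sub>1\<^bsub>?G'\<^esub> \<lbrakk>F0 x, F1 u\<rbrakk>\<^sub>0\<^sub>1\<^bsub>?G'\<^esub>"
    by (rule L'.Mor_eqI) (use arrow_F2_tgt[of x u, symmetric] in simp_all)
next
  fix x assume "x \<in> deg0 ?G"
  then show "l\<^sub>1\<^bsub>?G'\<^esub> (arrow_part L' (F3 x))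
      = \<ominus>\<^bsub>G0 ?G'\<^esub> R\<^sub>0\<^bsub>?G'\<^esub> (F0 x) \<oplus>\<^sub>0\<^bsub>?G'\<^esub> F0 (R\<^sub>0\<^bsub>?G\<^esub> x)"
    by (simp add: L'.Ob.a_comm)
next
  fix x y assume "x \<in> deg0 ?G" "y \<in> deg0 ?G"
  then have [simp]: "x \<in> obs L" "y \<in> obs L" by simp_all
  show "l\<^sub>1\<^bsub>?G'\<^esub> (arrow_part L' (F2 x y))
      = F0 \<lbrakk>x, y\<rbrakk>\<^sub>0\<^sub>0\<^bsub>?G\<^esub> \<ominus>\<^sub>0\<^bsub>?G'\<^esub> \<lbrakk>F0 x, F0 y\<rbrakk>\<^sub>0\<^sub>0\<^bsub>?G'\<^esub>"
    by (simp add: a_minus_def)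
  have s: "\<langle>arrow_part L' (F3 x), \<iota> (F0 y)\<rangle>\<^sub>M = \<ominus>\<^bsub>Mor L'\<^esub> \<langle>\<iota> (F0 y), arrow_part L' (F3 x)\<rangle>\<^sub>M"
    "\<langle>arrow_part L' (F3 x), \<iota> (P\<^sub>0 (F0 y))\<rangle>\<^sub>M = \<ominus>\<^bsub>Mor L'\<^esub> \<langle>\<iota> (P\<^sub>0 (F0 y)), arrow_part L' (F3 x)\<rangle>\<^sub>M"
    by (rule L'.mor_br_swap; simp)+
  let ?\<phi>2 = "\<lambda>x y. arrow_part L' (F2 x y)" and ?\<phi>3 = "\<lambda>x. arrow_part L' (F3 x)"
  show "R\<^sub>2\<^bsub>?G'\<^esub> (F0 x) (F0 y) \<oplus>\<^sub>1\<^bsub>?G'\<^esub> R\<^sub>1\<^bsub>?G'\<^esub> \<lbrakk>?\<phi>3 x, F0 y\<rbrakk>\<^sub>1\<^sub>0\<^bsub>?G'\<^esub>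
        \<oplus>\<^sub>1\<^bsub>?G'\<^esub> R\<^sub>1\<^bsub>?G'\<^esub> \<lbrakk>F0 x, ?\<phi>3 y\<rbrakk>\<^sub>0\<^sub>1\<^bsub>?G'\<^esub>
        \<oplus>\<^sub>1\<^bsub>?G'\<^esub> R\<^sub>1\<^bsub>?G'\<^esub> (?\<phi>2 (R\<^sub>0\<^bsub>?G\<^esub> x) y) \<oplus>\<^sub>1\<^bsub>?G'\<^esub> R\<^sub>1\<^bsub>?G'\<^esub> (?\<phi>2 x (R\<^sub>0\<^bsub>?G\<^esub> y))
        \<oplus>\<^sub>1\<^bsub>?G'\<^esub> ?\<phi>3 \<lbrakk>R\<^sub>0\<^bsub>?G\<^esub> x, y\<rbrakk>\<^sub>0\<^sub>0\<^bsub>?G\<^esub> \<oplus>\<^sub>1\<^bsub>?G'\<^esub> ?\<phi>3 \<lbrakk>x, R\<^sub>0\<^bsub>?G\<^esub> y\<rbrakk>\<^sub>0\<^sub>0\<^bsub>?G\<^esub>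
      = arrow_br ?G' (R\<^sub>0\<^bsub>?G'\<^esub> (F0 x)) (?\<phi>3 x) (R\<^sub>0\<^bsub>?G'\<^esub> (F0 y)) (?\<phi>3 y)
        \<oplus>\<^sub>1\<^bsub>?G'\<^esub> ?\<phi>2 (R\<^sub>0\<^bsub>?G\<^esub> x) (R\<^sub>0\<^bsub>?G\<^esub> y) \<oplus>\<^sub>1\<^bsub>?G'\<^esub> F1 (R\<^sub>2\<^bsub>?G\<^esub> x y)"
    (is "?l = ?r")
  proof (rule L'.Mor_eqI)
    show "?l \<in> mors L'" "?r \<in> mors L'" by (simp_all add: arrow_br_def)
    fix h assume [simp]: "h \<in> additive_functionals (Mor L')"
    show "h ?l = h ?r"
      using arg_cong[OF arrow_F3_coherence[of x y], of h] by (simp add: arrow_br_def s)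
  qed
next
  fix x y z assume "x \<in> deg0 ?G" "y \<in> deg0 ?G" "z \<in> deg0 ?G"
  then have [simp]: "x \<in> obs L" "y \<in> obs L" "z \<in> obs L" by simp_all
  let ?\<phi>2 = "\<lambda>x y. arrow_part L' (F2 x y)"
  have s: "\<langle>?\<phi>2 x y, \<iota> (F0 z)\<rangle>\<^sub>M = \<ominus>\<^bsub>Mor L'\<^esub> \<langle>\<iota> (F0 z), ?\<phi>2 x y\<rangle>\<^sub>M"
    "\<langle>?\<phi>2 x z, \<iota> (F0 y)\<rangle>\<^sub>M = \<ominus>\<^bsub>Mor L'\<^esub> \<langle>\<iota> (F0 y), ?\<phi>2 x z\<rangle>\<^sub>M"
    by (rule L'.mor_br_swap; simp)+
  show "\<lbrakk>?\<phi>2 x y, F0 z\<rbrakk>\<^sub>1\<^sub>0\<^bsub>?G'\<^esub> \<oplus>\<^sub>1\<^bsub>?G'\<^esub> ?\<phi>2 \<lbrakk>x, y\<rbrakk>\<^sub>0\<^sub>0\<^bsub>?G\<^esub> z \<oplus>\<^sub>1\<^bsub>?G'\<^esub> F1 (l\<^sub>3\<^bsub>?G\<^esub> x y z)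
      = l\<^sub>3\<^bsub>?G'\<^esub> (F0 x) (F0 y) (F0 z) \<oplus>\<^sub>1\<^bsub>?G'\<^esub> \<lbrakk>F0 x, ?\<phi>2 y z\<rbrakk>\<^sub>0\<^sub>1\<^bsub>?G'\<^esub>
        \<oplus>\<^sub>1\<^bsub>?G'\<^esub> \<lbrakk>?\<phi>2 x z, F0 y\<rbrakk>\<^sub>1\<^sub>0\<^bsub>?G'\<^esub>
        \<oplus>\<^sub>1\<^bsub>?G'\<^esub> ?\<phi>2 x \<lbrakk>y, z\<rbrakk>\<^sub>0\<^sub>0\<^bsub>?G\<^esub> \<oplus>\<^sub>1\<^bsub>?G'\<^esub> ?\<phi>2 \<lbrakk>x, z\<rbrakk>\<^sub>0\<^sub>0\<^bsub>?G\<^esub> y" (is "?l = ?r")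
  proof (rule L'.Mor_eqI)
    fix h assume [simp]: "h \<in> additive_functionals (Mor L')"
    show "h ?l = h ?r"
      using arg_cong[OF arrow_F2_coherence[of x y z], of h] by (simp add: s)
  qed simp_all
qed

end

section \<open>Lifting homomorphisms of 2-term algebras to Lie 2-algebras\<close>

context two_vector_space
begin

lemma cmp3_simps:
  assumes "a \<in> mors L" "b \<in> mors L" "c \<in> mors L" "tgt L c = src L b" "tgt L b = src L a"
  shows "a \<diamondop> b \<diamondop> c \<in> mors L" "src L (a \<diamondop> b \<diamondop> c) = src L c"
  using assms by (simp_all add: cmp_simps)

lemma cmp4_simps:
  assumes "a \<in> mors L" "b \<in> mors L" "c \<in> mors L" "d \<in> mors L"
    "tgt L d = src L c" "tgt L c = src L b" "tgt L b = src L a"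
  shows "a \<diamondop> b \<diamondop> c \<diamondop> d \<in> mors L" "src L (a \<diamondop> b \<diamondop> c \<diamondop> d) = src L d"
  using assms by (simp_all add: cmp_simps)

end

locale char0_rb_linf_homomorphism =
  char0_rb_lie_two_pair K L' L + rb_linf_homomorphism K "linf_of L'" "linf_of L" \<phi>0 \<phi>1 \<phi>2 \<phi>3
  for K :: "('k, 'c) ring_scheme"
    and L' :: "('k, 'v) rb_lie_two_alg" (structure)
    and L :: "('k, 'v) rb_lie_two_alg"
    and \<phi>0 \<phi>1 \<phi>2 \<phi>3
begin

lemma modules:
  "Module.module K (G1 (linf_of L))" "Module.module K (G1 (linf_of L'))"
  "Module.module K (G0 (linf_of L))" "Module.module K (G0 (linf_of L'))"
  using L.linf_of_fd L'.linf_of_fd by (simp_all add: fd_vectorspace_module L.Ob_module L'.Ob_module)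

lemma \<phi>0_simps [simp]:
  "x \<in> obs L \<Longrightarrow> \<phi>0 x \<in> obs L'"
  "\<lbrakk>x \<in> obs L; y \<in> obs L\<rbrakk> \<Longrightarrow> \<phi>0 (x \<oplus>\<^sub>O\<^bsub>L\<^esub> y) = \<phi>0 x \<oplus>\<^sub>O \<phi>0 y"
  "x \<in> obs L \<Longrightarrow> \<phi>0 (\<ominus>\<^bsub>Ob L\<^esub> x) = \<ominus>\<^bsub>Ob L'\<^esub> \<phi>0 x"
  "\<phi>0 \<zero>\<^bsub>Ob L\<^esub> = \<zero>\<^bsub>Ob L'\<^esub>"
  "\<lbrakk>c \<in> carrier K; x \<in> obs L\<rbrakk> \<Longrightarrow> \<phi>0 (c \<odot>\<^bsub>Ob L\<^esub> x) = c \<odot>\<^bsub>Ob L'\<^esub> \<phi>0 x"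
  using module_hom_simps[OF modules(3,4) \<phi>0_linear] by simp_all

lemma \<phi>1_closed [simp]:
  "\<lbrakk>u \<in> mors L; src L u = \<zero>\<^bsub>Ob L\<^esub>\<rbrakk> \<Longrightarrow> \<phi>1 u \<in> mors L'"
  "\<lbrakk>u \<in> mors L; src L u = \<zero>\<^bsub>Ob L\<^esub>\<rbrakk> \<Longrightarrow> src L' (\<phi>1 u) = \<zero>\<^bsub>Ob L'\<^esub>"
  using module_hom_simps(1)[OF modules(1,2) \<phi>1_linear, of u] by simp_all

lemma \<phi>1_simps [simp]:
  assumes "u \<in> mors L" "src L u = \<zero>\<^bsub>Ob L\<^esub>"
  shows "arrow_part L' (\<phi>1 u) = \<phi>1 u" "tgt L' (\<phi>1 u) = \<phi>0 (tgt L u)"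
    "\<lbrakk>v \<in> mors L; src L v = \<zero>\<^bsub>Ob L\<^esub>\<rbrakk> \<Longrightarrow> \<phi>1 (u \<oplus>\<^sub>M\<^bsub>L\<^esub> v) = \<phi>1 u \<oplus>\<^sub>M \<phi>1 v"
    "c \<in> carrier K \<Longrightarrow> \<phi>1 (c \<odot>\<^bsub>Mor L\<^esub> u) = c \<odot>\<^bsub>Mor L'\<^esub> \<phi>1 u"
  using module_hom_simps(2,5)[OF modules(1,2) \<phi>1_linear] \<phi>_diff[of u] assms
  by (simp_all add: L'.arrow_part_id)

lemma \<phi>1_neg_zero [simp]:
  "\<lbrakk>u \<in> mors L; src L u = \<zero>\<^bsub>Ob L\<^esub>\<rbrakk> \<Longrightarrow> \<phi>1 (\<ominus>\<^bsub>Mor L\<^esub> u) = \<ominus>\<^bsub>Mor L'\<^esub> \<phi>1 u"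
  "\<phi>1 \<zero>\<^bsub>Mor L\<^esub> = \<zero>\<^bsub>Mor L'\<^esub>"
  using module_hom_simps(3,4)[OF modules(1,2) \<phi>1_linear] by simp_all

lemma \<phi>2_closed [simp]:
  "\<lbrakk>x \<in> obs L; y \<in> obs L\<rbrakk> \<Longrightarrow> \<phi>2 x y \<in> mors L'"
  "\<lbrakk>x \<in> obs L; y \<in> obs L\<rbrakk> \<Longrightarrow> src L' (\<phi>2 x y) = \<zero>\<^bsub>Ob L'\<^esub>"
  using bilinear_map_simps(1)[OF modules(3,3,2) \<phi>2_bilinear, of x y] by simp_all

lemma \<phi>2_simps [simp]:
  assumes "x \<in> obs L" "y \<in> obs L"
  shows "arrow_part L' (\<phi>2 x y) = \<phi>2 x y"
    "tgt L' (\<phi>2 x y) = \<phi>0 \<langle>x, y\<rangle>\<^sub>O\<^bsub>L\<^esub> \<oplus>\<^sub>O \<ominus>\<^bsub>Ob L'\<^esub> \<langle>\<phi>0 x, \<phi>0 y\<rangle>\<^sub>O"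
    "x' \<in> obs L \<Longrightarrow> \<phi>2 (x \<oplus>\<^sub>O\<^bsub>L\<^esub> x') y = \<phi>2 x y \<oplus>\<^sub>M \<phi>2 x' y"
    "x' \<in> obs L \<Longrightarrow> \<phi>2 y (x \<oplus>\<^sub>O\<^bsub>L\<^esub> x') = \<phi>2 y x \<oplus>\<^sub>M \<phi>2 y x'"
    "c \<in> carrier K \<Longrightarrow> \<phi>2 (c \<odot>\<^bsub>Ob L\<^esub> x) y = c \<odot>\<^bsub>Mor L'\<^esub> \<phi>2 x y"
    "c \<in> carrier K \<Longrightarrow> \<phi>2 x (c \<odot>\<^bsub>Ob L\<^esub> y) = c \<odot>\<^bsub>Mor L'\<^esub> \<phi>2 x y"
    "\<phi>2 (\<ominus>\<^bsub>Ob L\<^esub> x) y = \<ominus>\<^bsub>Mor L'\<^esub> \<phi>2 x y" "\<phi>2 x (\<ominus>\<^bsub>Ob L\<^esub> y) = \<ominus>\<^bsub>Mor L'\<^esub> \<phi>2 x y"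
    "\<phi>2 x \<zero>\<^bsub>Ob L\<^esub> = \<zero>\<^bsub>Mor L'\<^esub>" "\<phi>2 \<zero>\<^bsub>Ob L\<^esub> x = \<zero>\<^bsub>Mor L'\<^esub>"
  using bilinear_map_simps[OF modules(3,3,2) \<phi>2_bilinear] diff_\<phi>2[of x y] assms
  by (simp_all add: L'.arrow_part_id a_minus_def[of "Ob L'"])

lemma \<phi>2_swap: "\<lbrakk>x \<in> obs L; y \<in> obs L\<rbrakk> \<Longrightarrow> \<phi>2 x y = \<ominus>\<^bsub>Mor L'\<^esub> \<phi>2 y x"
proof -
  assume xy: "x \<in> obs L" "y \<in> obs L"
  then have "\<phi>2 x y = \<ominus>\<^bsub>G1 (linf_of L')\<^esub> \<phi>2 y x"
    using \<phi>2_skew unfolding skew2_def linf_of_simps by blast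
  with xy show ?thesis by simp
qed

lemma \<phi>3_closed [simp]:
  "x \<in> obs L \<Longrightarrow> \<phi>3 x \<in> mors L'" "x \<in> obs L \<Longrightarrow> src L' (\<phi>3 x) = \<zero>\<^bsub>Ob L'\<^esub>"
  using module_hom_simps(1)[OF modules(3,2) \<phi>3_linear, of x] by simp_all

lemma \<phi>3_simps [simp]:
  assumes "x \<in> obs L"
  shows "arrow_part L' (\<phi>3 x) = \<phi>3 x"
    "tgt L' (\<phi>3 x) = \<ominus>\<^bsub>Ob L'\<^esub> P\<^sub>0 (\<phi>0 x) \<oplus>\<^sub>O \<phi>0 (P\<^sub>0\<^bsub>L\<^esub> x)"
    "y \<in> obs L \<Longrightarrow> \<phi>3 (x \<oplus>\<^sub>O\<^bsub>L\<^esub> y) = \<phi>3 x \<oplus>\<^sub>M \<phi>3 y"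
    "c \<in> carrier K \<Longrightarrow> \<phi>3 (c \<odot>\<^bsub>Ob L\<^esub> x) = c \<odot>\<^bsub>Mor L'\<^esub> \<phi>3 x"
    "\<phi>3 (\<ominus>\<^bsub>Ob L\<^esub> x) = \<ominus>\<^bsub>Mor L'\<^esub> \<phi>3 x"
  using module_hom_simps[OF modules(3,2) \<phi>3_linear] diff_\<phi>3[of x] assms
  by (simp_all add: L'.arrow_part_id)

text \<open>The values of the lift are forced: each has the source that its typing requires and the
  arrow part given by \<open>\<phi>1\<close>, \<open>\<phi>2\<close> or
  \<open>\<phi>3\<close>.\<close>

definition F1 where "F1 f = \<iota> (\<phi>0 (src L f)) \<oplus>\<^sub>M \<phi>1 (arrow_part L f)"
definition F2 where "F2 x y = \<iota> \<langle>\<phi>0 x, \<phi>0 y\<rangle>\<^sub>O \<oplus>\<^sub>M \<phi>2 x y"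
definition F3 where "F3 x = \<iota> (P\<^sub>0 (\<phi>0 x)) \<oplus>\<^sub>M \<phi>3 x"

lemma F1_simps [simp]:
  assumes "f \<in> mors L"
  shows "F1 f \<in> mors L'" "src L' (F1 f) = \<phi>0 (src L f)" "tgt L' (F1 f) = \<phi>0 (tgt L f)"
    "arrow_part L' (F1 f) = \<phi>1 (arrow_part L f)"
proof -
  show "F1 f \<in> mors L'" "src L' (F1 f) = \<phi>0 (src L f)" "arrow_part L' (F1 f) = \<phi>1 (arrow_part L f)"
    using assms by (simp_all add: F1_def)
  show "tgt L' (F1 f) = \<phi>0 (tgt L f)"
    by (rule L'.Ob_eqI) (use assms in \<open>simp_all add: F1_def\<close>)
qed

lemma F2_simps [simp]:
  assumes "x \<in> obs L" "y \<in> obs L"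
  shows "F2 x y \<in> mors L'" "src L' (F2 x y) = \<langle>\<phi>0 x, \<phi>0 y\<rangle>\<^sub>O" "tgt L' (F2 x y) = \<phi>0 \<langle>x, y\<rangle>\<^sub>O\<^bsub>L\<^esub>"
    "arrow_part L' (F2 x y) = \<phi>2 x y"
proof -
  show "F2 x y \<in> mors L'" "src L' (F2 x y) = \<langle>\<phi>0 x, \<phi>0 y\<rangle>\<^sub>O" "arrow_part L' (F2 x y) = \<phi>2 x y"
    using assms by (simp_all add: F2_def)
  show "tgt L' (F2 x y) = \<phi>0 \<langle>x, y\<rangle>\<^sub>O\<^bsub>L\<^esub>"
    by (rule L'.Ob_eqI) (use assms in \<open>simp_all add: F2_def\<close>)
qed

lemma F3_simps [simp]:
  assumes "x \<in> obs L"
  shows "F3 x \<in> mors L'" "src L' (F3 x) = P\<^sub>0 (\<phi>0 x)" "tgt L' (F3 x) = \<phi>0 (P\<^sub>0\<^bsub>L\<^esub> x)"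
    "arrow_part L' (F3 x) = \<phi>3 x"
proof -
  show "F3 x \<in> mors L'" "src L' (F3 x) = P\<^sub>0 (\<phi>0 x)" "arrow_part L' (F3 x) = \<phi>3 x"
    using assms by (simp_all add: F3_def)
  show "tgt L' (F3 x) = \<phi>0 (P\<^sub>0\<^bsub>L\<^esub> x)"
    by (rule L'.Ob_eqI) (use assms in \<open>simp_all add: F3_def\<close>)
qed

lemma linear_functor_F: "linear_functor K L L' \<phi>0 F1"
proof
  show "\<phi>0 \<in> module_hom K (Ob L) (Ob L')" using \<phi>0_linear by simp
  show "F1 \<in> module_hom K (Mor L) (Mor L')"
    by (rule module_homI; (rule L'.mor_eqI)?) simp_all
next
  fix g f assume *: "(g, f) \<in> composable_pairs L"
  then have [simp]: "g \<in> mors L" "f \<in> mors L" and c: "tgt L f = src L g"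
    by (simp_all add: L.composable_pairs_iff)
  note s = L.cmp_simps[OF _ _ c] L'.cmp_simps[of "F1 g" "F1 f"]
  show "F1 (g \<diamondop>\<^bsub>L\<^esub> f) = F1 g \<diamondop> F1 f"
    by (rule L'.mor_eqI) (simp_all add: s c)
next
  fix x assume [simp]: "x \<in> obs L"
  show "F1 (\<iota>\<^bsub>L\<^esub> x) = \<iota> (\<phi>0 x)"
    by (rule L'.mor_eqI) simp_all
qed simp_all

lemma lie_two_homomorphism_F: "lie_two_homomorphism K L' L \<phi>0 F1 F2"
proof -
  interpret F: linear_functor K L L' \<phi>0 F1 by (rule linear_functor_F)
  show ?thesis
  proof
    show "bilinear_map K (Ob L) (Ob L) (Mor L') F2"
      by (rule bilinear_mapI; (rule L'.mor_eqI)?) simp_all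
    show "skew2 (Ob L) (Mor L') (\<lambda>x y. arrow_part L' (F2 x y))"
      unfolding skew2_def
    proof (intro ballI)
      fix x y assume "x \<in> obs L" "y \<in> obs L"
      then show "arrow_part L' (F2 x y) = \<ominus>\<^bsub>Mor L'\<^esub> arrow_part L' (F2 y x)"
        using \<phi>2_swap[of x y] by simp
    qed
  next
    fix x y assume "x \<in> obs L" "y \<in> obs L"
    then show "F2 x y \<in> mor_between L' \<langle>\<phi>0 x, \<phi>0 y\<rangle>\<^sub>O (\<phi>0 \<langle>x, y\<rangle>\<^sub>O\<^bsub>L\<^esub>)"
      by (simp add: mor_between_def)
  next
    fix f g assume [simp]: "f \<in> mors L" "g \<in> mors L"
    let ?u = "arrow_part L f" and ?v = "arrow_part L g"
    note s = L'.cmp_simps[of "F2 (tgt L f) (tgt L g)" "\<langle>F1 f, F1 g\<rangle>\<^sub>M"]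
      L'.cmp_simps[of "F1 \<langle>f, g\<rangle>\<^sub>M\<^bsub>L\<^esub>" "F2 (src L f) (src L g)"]
    have t: "\<langle>?u, \<iota>\<^bsub>L\<^esub> (src L g)\<rangle>\<^sub>M\<^bsub>L\<^esub> = \<ominus>\<^bsub>Mor L\<^esub> \<langle>\<iota>\<^bsub>L\<^esub> (src L g), ?u\<rangle>\<^sub>M\<^bsub>L\<^esub>"
      by (rule L.mor_br_swap) simp_all
    have t': "\<langle>\<phi>1 ?u, \<iota> (\<phi>0 (src L g))\<rangle>\<^sub>M = \<ominus>\<^bsub>Mor L'\<^esub> \<langle>\<iota> (\<phi>0 (src L g)), \<phi>1 ?u\<rangle>\<^sub>M"
      by (rule L'.mor_br_swap) simp_all
    have sw: "\<phi>2 (src L g) (tgt L f) = \<ominus>\<^bsub>Mor L'\<^esub> \<phi>2 (tgt L f) (src L g)"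
      "\<phi>2 (src L g) (src L f) = \<ominus>\<^bsub>Mor L'\<^esub> \<phi>2 (src L f) (src L g)"
      by (rule \<phi>2_swap; simp)+
    show "F2 (tgt L f) (tgt L g) \<diamondop> \<langle>F1 f, F1 g\<rangle>\<^sub>M = F1 \<langle>f, g\<rangle>\<^sub>M\<^bsub>L\<^esub> \<diamondop> F2 (src L f) (src L g)"
    proof (rule L'.mor_eqI)
      show "arrow_part L' (F2 (tgt L f) (tgt L g) \<diamondop> \<langle>F1 f, F1 g\<rangle>\<^sub>M)
          = arrow_part L' (F1 \<langle>f, g\<rangle>\<^sub>M\<^bsub>L\<^esub> \<diamondop> F2 (src L f) (src L g))" (is "?l = ?r")
      proof (rule L'.Mor_eqI)
        show "?l \<in> mors L'" "?r \<in> mors L'" by (simp_all add: s)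
        fix h assume [simp]: "h \<in> additive_functionals (Mor L')"
        show "h ?l = h ?r"
          \<comment> \<open>The arrow part of a bracket is taken over the target of \<open>f\<close>
            in one summand and over the source of \<open>g\<close> in the other. Accordingly the
            compatibility of \<open>\<phi>2\<close> with \<open>l\<^sub>1\<close> is used at these
            two objects, once for each arrow part.\<close>
          using arg_cong[OF \<phi>2_diff[of "tgt L f" ?v], of h]
            arg_cong[OF \<phi>2_diff[of "src L g" ?u], of h]
          by (simp add: s L.arrow_part_mor_br L'.arrow_part_mor_br t t' sw)
      qed
    qed (simp_all add: s)
  next
    fix x y z assume [simp]: "x \<in> obs L" "y \<in> obs L" "z \<in> obs L"
    let ?a1 = "F1 (J\<^bsub>L\<^esub> x y z)" and ?a2 = "F2 \<langle>x, y\<rangle>\<^sub>O\<^bsub>L\<^esub> z" and ?a3 = "\<langle>F2 x y, \<iota> (\<phi>0 z)\<rangle>\<^sub>M"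
      and ?b1 = "F2 x \<langle>y, z\<rangle>\<^sub>O\<^bsub>L\<^esub> \<oplus>\<^sub>M F2 \<langle>x, z\<rangle>\<^sub>O\<^bsub>L\<^esub> y"
      and ?b2 = "\<langle>\<iota> (\<phi>0 x), F2 y z\<rangle>\<^sub>M \<oplus>\<^sub>M \<langle>F2 x z, \<iota> (\<phi>0 y)\<rangle>\<^sub>M" and ?b3 = "J (\<phi>0 x) (\<phi>0 y) (\<phi>0 z)"
    have a: "?a1 \<in> mors L'" "?a2 \<in> mors L'" "?a3 \<in> mors L'" "tgt L' ?a3 = src L' ?a2"
      "tgt L' ?a2 = src L' ?a1"
      and b: "?b1 \<in> mors L'" "?b2 \<in> mors L'" "?b3 \<in> mors L'" "tgt L' ?b3 = src L' ?b2"
        "tgt L' ?b2 = src L' ?b1"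
      by simp_all
    note s = L'.cmp3_simps[OF a] L'.cmp3_simps[OF b] L'.arrow_cmp3[OF a] L'.arrow_cmp3[OF b]
    have t: "\<langle>\<phi>2 x y, \<iota> (\<phi>0 z)\<rangle>\<^sub>M = \<ominus>\<^bsub>Mor L'\<^esub> \<langle>\<iota> (\<phi>0 z), \<phi>2 x y\<rangle>\<^sub>M"
      "\<langle>\<phi>2 x z, \<iota> (\<phi>0 y)\<rangle>\<^sub>M = \<ominus>\<^bsub>Mor L'\<^esub> \<langle>\<iota> (\<phi>0 y), \<phi>2 x z\<rangle>\<^sub>M"
      by (rule L'.mor_br_swap; simp)+
    show "?a1 \<diamondop> ?a2 \<diamondop> ?a3 = ?b1 \<diamondop> ?b2 \<diamondop> ?b3"
    proof (rule L'.mor_eqI)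
      show "arrow_part L' (?a1 \<diamondop> ?a2 \<diamondop> ?a3) = arrow_part L' (?b1 \<diamondop> ?b2 \<diamondop> ?b3)" (is "?l = ?r")
      proof (rule L'.Mor_eqI)
        show "?l \<in> mors L'" "?r \<in> mors L'" by (simp_all add: s)
        fix h assume [simp]: "h \<in> additive_functionals (Mor L')"
        show "h ?l = h ?r"
          unfolding s using arg_cong[OF \<phi>2_coherence[of x y z], of h] by (simp add: t)
      qed
    qed (simp_all add: s)
  qed
qed

lemma rb_lie_two_homomorphism_F: "rb_lie_two_homomorphism K L' L \<phi>0 F1 F2 F3"
proof -
  interpret F: lie_two_homomorphism K L' L \<phi>0 F1 F2 by (rule lie_two_homomorphism_F)
  show ?thesis
  proof
    show "F3 \<in> module_hom K (Ob L) (Mor L')"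
      by (rule module_homI; (rule L'.mor_eqI)?) simp_all
  next
    fix x assume "x \<in> obs L"
    then show "F3 x \<in> mor_between L' (P\<^sub>0 (\<phi>0 x)) (\<phi>0 (P\<^sub>0\<^bsub>L\<^esub> x))"
      by (simp add: mor_between_def)
  next
    fix f assume [simp]: "f \<in> mors L"
    note s = L'.cmp_simps[of "F3 (tgt L f)" "P\<^sub>1 (F1 f)"] L'.cmp_simps[of "F1 (P\<^sub>1\<^bsub>L\<^esub> f)"
      "F3 (src L f)"]
    show "F3 (tgt L f) \<diamondop> P\<^sub>1 (F1 f) = F1 (P\<^sub>1\<^bsub>L\<^esub> f) \<diamondop> F3 (src L f)"
    proof (rule L'.mor_eqI)
      show "arrow_part L' (F3 (tgt L f) \<diamondop> P\<^sub>1 (F1 f))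
        = arrow_part L' (F1 (P\<^sub>1\<^bsub>L\<^esub> f) \<diamondop> F3 (src L f))"
        (is "?l = ?r")
      proof (rule L'.Mor_eqI)
        show "?l \<in> mors L'" "?r \<in> mors L'" by (simp_all add: s)
        fix h assume [simp]: "h \<in> additive_functionals (Mor L')"
        show "h ?l = h ?r"
          using arg_cong[OF \<phi>3_diff[of "arrow_part L f"], of h] by (simp add: s)
      qed
    qed (simp_all add: s)
  next
    fix x y assume [simp]: "x \<in> obs L" "y \<in> obs L"
    let ?a1 = "F3 \<langle>P\<^sub>0\<^bsub>L\<^esub> x, y\<rangle>\<^sub>O\<^bsub>L\<^esub> \<oplus>\<^sub>M F3 \<langle>x, P\<^sub>0\<^bsub>L\<^esub> y\<rangle>\<^sub>O\<^bsub>L\<^esub>"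
      and ?a2 = "P\<^sub>1 (F2 (P\<^sub>0\<^bsub>L\<^esub> x) y) \<oplus>\<^sub>M P\<^sub>1 (F2 x (P\<^sub>0\<^bsub>L\<^esub> y))"
      and ?a3 = "P\<^sub>1 \<langle>F3 x, \<iota> (\<phi>0 y)\<rangle>\<^sub>M \<oplus>\<^sub>M P\<^sub>1 \<langle>\<iota> (\<phi>0 x), F3 y\<rangle>\<^sub>M" and ?a4 = "\<R> (\<phi>0 x) (\<phi>0 y)"
      and ?b1 = "F1 (\<R>\<^bsub>L\<^esub> x y)" and ?b2 = "F2 (P\<^sub>0\<^bsub>L\<^esub> x) (P\<^sub>0\<^bsub>L\<^esub> y)" and ?b3 = "\<langle>F3 x, F3 y\<rangle>\<^sub>M"
    have a: "?a1 \<in> mors L'" "?a2 \<in> mors L'" "?a3 \<in> mors L'" "?a4 \<in> mors L'"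
      "tgt L' ?a4 = src L' ?a3" "tgt L' ?a3 = src L' ?a2" "tgt L' ?a2 = src L' ?a1"
      and b: "?b1 \<in> mors L'" "?b2 \<in> mors L'" "?b3 \<in> mors L'" "tgt L' ?b3 = src L' ?b2"
        "tgt L' ?b2 = src L' ?b1"
      by simp_all
    note s = L'.cmp4_simps[OF a] L'.cmp3_simps[OF b] L'.arrow_cmp4[OF a] L'.arrow_cmp3[OF b]
    have t: "\<langle>\<phi>3 x, \<iota> (\<phi>0 y)\<rangle>\<^sub>M = \<ominus>\<^bsub>Mor L'\<^esub> \<langle>\<iota> (\<phi>0 y), \<phi>3 x\<rangle>\<^sub>M"
      "\<langle>\<phi>3 x, \<iota> (P\<^sub>0 (\<phi>0 y))\<rangle>\<^sub>M = \<ominus>\<^bsub>Mor L'\<^esub> \<langle>\<iota> (P\<^sub>0 (\<phi>0 y)), \<phi>3 x\<rangle>\<^sub>M"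
      by (rule L'.mor_br_swap; simp)+
    show "?a1 \<diamondop> ?a2 \<diamondop> ?a3 \<diamondop> ?a4 = ?b1 \<diamondop> ?b2 \<diamondop> ?b3"
    proof (rule L'.mor_eqI)
      show "arrow_part L' (?a1 \<diamondop> ?a2 \<diamondop> ?a3 \<diamondop> ?a4) = arrow_part L' (?b1 \<diamondop> ?b2 \<diamondop> ?b3)" (is "?l = ?r")
      proof (rule L'.Mor_eqI)
        show "?l \<in> mors L'" "?r \<in> mors L'" by (simp_all add: s)
        fix h assume [simp]: "h \<in> additive_functionals (Mor L')"
        show "h ?l = h ?r"
          \<comment> \<open>The target of \<open>F3 x\<close> is
            \<open>P\<^sub>0 (\<phi>0 x)\<close> displaced by \<open>l\<^sub>1 (\<phi>3 x)\<close>,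
            so the arrow part of the bracket of \<open>F3 x\<close> and \<open>F3 y\<close> agrees
            with \<open>arrow_br\<close>.\<close>
          unfolding s using arg_cong[OF \<phi>3_coherence[of x y], of h]
          by (simp add: t arrow_br_def L'.arrow_part_mor_br)
      qed
    qed (simp_all add: s)
  qed
qed

end

section \<open>Composition of homomorphisms of 2-term algebras\<close>

lemma module_hom_cong:
  assumes "Module.module K V" "f \<in> module_hom K V W" "\<And>x. x \<in> carrier V \<Longrightarrow> g x = f x"
  shows "g \<in> module_hom K V W"
proof -
  interpret V: Module.module K V by fact
  show ?thesis using assms(2,3) by (auto simp: module_hom_def)
qed

lemma bilinear_map_cong:
  assumes "Module.module K U" "Module.module K V" "bilinear_map K U V W f"
    and "\<And>x y. \<lbrakk>x \<in> carrier U; y \<in> carrier V\<rbrakk> \<Longrightarrow> g x y = f x y"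
  shows "bilinear_map K U V W g"
  using assms(3,4) unfolding bilinear_map_def
  by (auto intro: module_hom_cong[OF assms(1)] module_hom_cong[OF assms(2)])

lemma skew2_cong:
  assumes "skew2 V W f" "\<And>x y. \<lbrakk>x \<in> carrier V; y \<in> carrier V\<rbrakk> \<Longrightarrow> g x y = f x y"
  shows "skew2 V W g"
  using assms unfolding skew2_def by metis

context two_term_linf_algebra
begin

lemma G0_module: "Module.module K (G0 G)"
  using G0_space by (rule fd_vectorspace_module)

lemma G1_module: "Module.module K (G1 G)"
  using G1_space by (rule fd_vectorspace_module)

sublocale G0: Module.module K "G0 G" by (rule G0_module)
sublocale G1: Module.module K "G1 G" by (rule G1_module)

lemmas diff_simps [simp] = module_hom_simps[OF G1_module G0_module diff_linear]
lemmas br00_simps [simp] = bilinear_map_simps[OF G0_module G0_module G0_module br00_bilinear]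
lemmas br01_simps [simp] = bilinear_map_simps[OF G0_module G1_module G1_module br01_bilinear]
lemmas tern_simps [simp] = trilinear_map_simps[OF G0_module G1_module tern_trilinear]

lemmas G0_functional_simps [simp] =
  additive_functional_add[where V = "G0 G"]
  additive_functional_zero[OF _ G0.abelian_group_axioms]
  additive_functional_neg[OF _ G0.abelian_group_axioms]
lemmas G1_functional_simps [simp] =
  additive_functional_add[where V = "G1 G"]
  additive_functional_zero[OF _ G1.abelian_group_axioms]
  additive_functional_neg[OF _ G1.abelian_group_axioms]

declare G0.neg_zero [simp] G1.neg_zero [simp]

lemma br00_swap: "\<lbrakk>x \<in> deg0 G; y \<in> deg0 G\<rbrakk> \<Longrightarrow> \<lbrakk>x, y\<rbrakk>\<^sub>0\<^sub>0 = \<ominus>\<^bsub>G0 G\<^esub> \<lbrakk>y, x\<rbrakk>\<^sub>0\<^sub>0"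
  using br00_skew unfolding skew2_def by blast

lemma tern_swap:
  assumes "x \<in> deg0 G" "y \<in> deg0 G" "z \<in> deg0 G"
  shows "l\<^sub>3 x y z = \<ominus>\<^bsub>G1 G\<^esub> l\<^sub>3 y x z" "l\<^sub>3 x y z = \<ominus>\<^bsub>G1 G\<^esub> l\<^sub>3 x z y"
  using tern_skew assms unfolding skew3_def by blast+

end

context rb_two_term_linf_algebra
begin

lemmas rop0_simps [simp] = module_hom_simps[OF G0_module G0_module rop0_linear]
lemmas rop1_simps [simp] = module_hom_simps[OF G1_module G1_module rop1_linear]
lemmas rop2_simps [simp] = bilinear_map_simps[OF G0_module G0_module G1_module rop2_bilinear]

lemma rop2_swap: "\<lbrakk>x \<in> deg0 G; y \<in> deg0 G\<rbrakk> \<Longrightarrow> R\<^sub>2 x y = \<ominus>\<^bsub>G1 G\<^esub> R\<^sub>2 y x"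
  using rop2_skew unfolding skew2_def by blast

end

text \<open>All conditions evaluate the four maps on carriers only. This allows homomorphisms to be
  cut off outside the carriers by \<open>restrict_maps\<close>; the analogue for Lie 2-algebras
  follows.\<close>

lemma rb_linf_homomorphism_cong:
  assumes "rb_two_term_linf_algebra K G" "rb_linf_homomorphism K G' G \<phi>0 \<phi>1 \<phi>2 \<phi>3"
    and [simp]: "\<And>x. x \<in> deg0 G \<Longrightarrow> \<psi>0 x = \<phi>0 x" "\<And>u. u \<in> deg1 G \<Longrightarrow> \<psi>1 u = \<phi>1 u"
      "\<And>x y. \<lbrakk>x \<in> deg0 G; y \<in> deg0 G\<rbrakk> \<Longrightarrow> \<psi>2 x y = \<phi>2 x y"
      "\<And>x. x \<in> deg0 G \<Longrightarrow> \<psi>3 x = \<phi>3 x"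
  shows "rb_linf_homomorphism K G' G \<psi>0 \<psi>1 \<psi>2 \<psi>3"
proof -
  interpret G: rb_two_term_linf_algebra K G by fact
  interpret \<phi>: rb_linf_homomorphism K G' G \<phi>0 \<phi>1 \<phi>2 \<phi>3 by fact
  show ?thesis
  proof
    show "\<psi>0 \<in> module_hom K (G0 G) (G0 G')"
      by (rule module_hom_cong[OF G.G0_module \<phi>.\<phi>0_linear]) simp
    show "\<psi>1 \<in> module_hom K (G1 G) (G1 G')"
      by (rule module_hom_cong[OF G.G1_module \<phi>.\<phi>1_linear]) simp
    show "\<psi>3 \<in> module_hom K (G0 G) (G1 G')"
      by (rule module_hom_cong[OF G.G0_module \<phi>.\<phi>3_linear]) simp
    show "bilinear_map K (G0 G) (G0 G) (G1 G') \<psi>2"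
      by (rule bilinear_map_cong[OF G.G0_module G.G0_module \<phi>.\<phi>2_bilinear]) simp
    show "skew2 (G0 G) (G1 G') \<psi>2"
      by (rule skew2_cong[OF \<phi>.\<phi>2_skew]) simp
  qed (simp_all add: \<phi>.\<phi>_diff \<phi>.diff_\<phi>2 \<phi>.\<phi>2_diff \<phi>.\<phi>2_coherence \<phi>.diff_\<phi>3 \<phi>.\<phi>3_diff \<phi>.\<phi>3_coherence)
qed

lemma rb_lie_two_homomorphism_cong:
  assumes "rb_lie_two_algebra K L" "rb_lie_two_homomorphism K L' L F0 F1 F2 F3"
    and [simp]: "\<And>x. x \<in> obs L \<Longrightarrow> E0 x = F0 x" "\<And>u. u \<in> mors L \<Longrightarrow> E1 u = F1 u"
      "\<And>x y. \<lbrakk>x \<in> obs L; y \<in> obs L\<rbrakk> \<Longrightarrow> E2 x y = F2 x y"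
      "\<And>x. x \<in> obs L \<Longrightarrow> E3 x = F3 x"
  shows "rb_lie_two_homomorphism K L' L E0 E1 E2 E3"
proof -
  interpret L: rb_lie_two_algebra K L by fact
  interpret F: rb_lie_two_homomorphism K L' L F0 F1 F2 F3 by fact
  show ?thesis
  proof
    show "E0 \<in> module_hom K (Ob L) (Ob L')"
      by (rule module_hom_cong[OF L.Ob_module F.F0_linear]) simp
    show "E1 \<in> module_hom K (Mor L) (Mor L')"
      by (rule module_hom_cong[OF L.Mor_module F.F1_linear]) simp
    show "E3 \<in> module_hom K (Ob L) (Mor L')"
      by (rule module_hom_cong[OF L.Ob_module F.F3_linear]) simp
    show "bilinear_map K (Ob L) (Ob L) (Mor L') E2"
      by (rule bilinear_map_cong[OF L.Ob_module L.Ob_module F.F2_bilinear]) simp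
    show "skew2 (Ob L) (Mor L') (\<lambda>x y. arrow_part L' (E2 x y))"
      by (rule skew2_cong[OF F.F2_skew]) simp
  next
    fix g f assume "(g, f) \<in> composable_pairs L"
    then show "E1 (g \<diamondop>\<^bsub>L\<^esub> f) = E1 g \<diamondop>\<^bsub>L'\<^esub> E1 f"
      using F.F_cmp[of g f] by (simp add: L.composable_pairs_iff L.cmp_simps)
  qed (simp_all add: F.F_src F.F_tgt F.F_idm F.F2_between F.F2_natural F.F2_coherence
      F.F3_between F.F3_natural F.F3_coherence)
qed

locale char0_rb_two_term = rb_two_term_linf_algebra K G
  for K :: "('k, 'c) ring_scheme" and G :: "('k, 'v) rb_two_term" (structure) +
  assumes char0: "char_zero K"
begin

lemma G0_eqI:
  assumes "x \<in> deg0 G" "y \<in> deg0 G" "\<And>h. h \<in> additive_functionals (G0 G) \<Longrightarrow> h x = h y"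
  shows "x = y"
  using eq_by_additive_functionals[OF G0_space char0] assms by blast

lemma G1_eqI:
  assumes "u \<in> deg1 G" "v \<in> deg1 G" "\<And>h. h \<in> additive_functionals (G1 G) \<Longrightarrow> h u = h v"
  shows "u = v"
  using eq_by_additive_functionals[OF G1_space char0] assms by blast

lemma id_homomorphism:
  "rb_linf_homomorphism K G G (\<lambda>x. x) (\<lambda>u. u) (\<lambda>x y. \<zero>\<^bsub>G1 G\<^esub>) (\<lambda>x. \<zero>\<^bsub>G1 G\<^esub>)"
proof
  show "(\<lambda>x. x) \<in> module_hom K (G0 G) (G0 G)" "(\<lambda>u. u) \<in> module_hom K (G1 G) (G1 G)"
    "(\<lambda>x. \<zero>\<^bsub>G1 G\<^esub>) \<in> module_hom K (G0 G) (G1 G)"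
    by (rule module_homI; simp)+
  show "bilinear_map K (G0 G) (G0 G) (G1 G) (\<lambda>x y. \<zero>\<^bsub>G1 G\<^esub>)"
    by (rule bilinear_mapI; simp)
  show "skew2 (G0 G) (G1 G) (\<lambda>x y. \<zero>\<^bsub>G1 G\<^esub>)" by (simp add: skew2_def)
next
  fix x y z assume "x \<in> deg0 G" "y \<in> deg0 G" "z \<in> deg0 G"
  then show "\<lbrakk>\<zero>\<^bsub>G1 G\<^esub>, z\<rbrakk>\<^sub>1\<^sub>0 \<oplus>\<^sub>1 \<zero>\<^bsub>G1 G\<^esub> \<oplus>\<^sub>1 l\<^sub>3 x y z
      = l\<^sub>3 x y z \<oplus>\<^sub>1 \<lbrakk>x, \<zero>\<^bsub>G1 G\<^esub>\<rbrakk>\<^sub>0\<^sub>1 \<oplus>\<^sub>1 \<lbrakk>\<zero>\<^bsub>G1 G\<^esub>, y\<rbrakk>\<^sub>1\<^sub>0 \<oplus>\<^sub>1 \<zero>\<^bsub>G1 G\<^esub> \<oplus>\<^sub>1 \<zero>\<^bsub>G1 G\<^esub>" by simp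
qed (simp_all add: a_minus_def G0.r_neg G1.r_neg G0.l_neg arrow_br_def)

end

section \<open>Composites of homomorphisms of 2-term algebras\<close>

locale char0_linf_hom =
  G: char0_rb_two_term K G + G': char0_rb_two_term K G' + rb_linf_homomorphism K G' G \<phi>0 \<phi>1 \<phi>2 \<phi>3
  for K :: "('k, 'c) ring_scheme"
    and G' :: "('k, 'v) rb_two_term" (structure)
    and G :: "('k, 'v) rb_two_term"
    and \<phi>0 \<phi>1 \<phi>2 \<phi>3
begin

lemmas \<phi>0_simps [simp] = module_hom_simps[OF G.G0_module G'.G0_module \<phi>0_linear]
lemmas \<phi>1_simps [simp] = module_hom_simps[OF G.G1_module G'.G1_module \<phi>1_linear]
lemmas \<phi>2_simps [simp] = bilinear_map_simps[OF G.G0_module G.G0_module G'.G1_module \<phi>2_bilinear]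
lemmas \<phi>3_simps [simp] = module_hom_simps[OF G.G0_module G'.G1_module \<phi>3_linear]

lemma \<phi>2_swap: "\<lbrakk>x \<in> deg0 G; y \<in> deg0 G\<rbrakk> \<Longrightarrow> \<phi>2 x y = \<ominus>\<^bsub>G1 G'\<^esub> \<phi>2 y x"
  using \<phi>2_skew unfolding skew2_def by blast

end

locale char0_linf_hom_pair =
  \<phi>: char0_linf_hom K G' G \<phi>0 \<phi>1 \<phi>2 \<phi>3 + \<psi>: char0_linf_hom K G'' G' \<psi>0 \<psi>1 \<psi>2 \<psi>3
  for K :: "('k, 'c) ring_scheme"
    and G'' :: "('k, 'v) rb_two_term" (structure)
    and G' :: "('k, 'v) rb_two_term"
    and G :: "('k, 'v) rb_two_term"
    and \<phi>0 \<phi>1 \<phi>2 \<phi>3 \<psi>0 \<psi>1 \<psi>2 \<psi>3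
begin

text \<open>Each condition combines the condition on \<open>\<phi>\<close>, pushed forward by
  \<open>\<psi>0\<close> or \<open>\<psi>1\<close>, with the condition on \<open>\<psi>\<close> at
  the images under \<open>\<phi>\<close>. The terms in which both homomorphisms meet are handled by
  the compatibility of \<open>\<psi>2\<close> and \<open>\<psi>3\<close> with the
  differential.\<close>

lemma comp_homomorphism:
  "rb_linf_homomorphism K G'' G (\<lambda>x. \<psi>0 (\<phi>0 x)) (\<lambda>u. \<psi>1 (\<phi>1 u))
    (\<lambda>x y. \<psi>2 (\<phi>0 x) (\<phi>0 y) \<oplus>\<^sub>1 \<psi>1 (\<phi>2 x y)) (\<lambda>x. \<psi>3 (\<phi>0 x) \<oplus>\<^sub>1 \<psi>1 (\<phi>3 x))"
proof
  show "(\<lambda>x. \<psi>0 (\<phi>0 x)) \<in> module_hom K (G0 G) (G0 G'')"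
    "(\<lambda>u. \<psi>1 (\<phi>1 u)) \<in> module_hom K (G1 G) (G1 G'')"
    "(\<lambda>x. \<psi>3 (\<phi>0 x) \<oplus>\<^sub>1 \<psi>1 (\<phi>3 x)) \<in> module_hom K (G0 G) (G1 G'')"
    by (rule module_homI; simp add: \<psi>.G'.G1.a_ac \<psi>.G'.G1.smult_r_distr)+
  show "bilinear_map K (G0 G) (G0 G) (G1 G'') (\<lambda>x y. \<psi>2 (\<phi>0 x) (\<phi>0 y) \<oplus>\<^sub>1 \<psi>1 (\<phi>2 x y))"
    by (rule bilinear_mapI; simp add: \<psi>.G'.G1.a_ac \<psi>.G'.G1.smult_r_distr)
  show "skew2 (G0 G) (G1 G'') (\<lambda>x y. \<psi>2 (\<phi>0 x) (\<phi>0 y) \<oplus>\<^sub>1 \<psi>1 (\<phi>2 x y))"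
    unfolding skew2_def
  proof (intro ballI)
    fix x y assume [simp]: "x \<in> deg0 G" "y \<in> deg0 G"
    have "\<psi>2 (\<phi>0 x) (\<phi>0 y) = \<ominus>\<^bsub>G1 G''\<^esub> \<psi>2 (\<phi>0 y) (\<phi>0 x)" by (rule \<psi>.\<phi>2_swap) simp_all
    moreover have "\<phi>2 x y = \<ominus>\<^bsub>G1 G'\<^esub> \<phi>2 y x" by (rule \<phi>.\<phi>2_swap) simp_all
    ultimately show "\<psi>2 (\<phi>0 x) (\<phi>0 y) \<oplus>\<^sub>1 \<psi>1 (\<phi>2 x y)
        = \<ominus>\<^bsub>G1 G''\<^esub> (\<psi>2 (\<phi>0 y) (\<phi>0 x) \<oplus>\<^sub>1 \<psi>1 (\<phi>2 y x))"
      by (simp add: \<psi>.G'.G1.minus_add)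
  qed
next
  fix u assume [simp]: "u \<in> deg1 G"
  show "l\<^sub>1 (\<psi>1 (\<phi>1 u)) = \<psi>0 (\<phi>0 (l\<^sub>1\<^bsub>G\<^esub> u))" by (simp add: \<phi>.\<phi>_diff \<psi>.\<phi>_diff)
  show "\<psi>3 (\<phi>0 (l\<^sub>1\<^bsub>G\<^esub> u)) \<oplus>\<^sub>1 \<psi>1 (\<phi>3 (l\<^sub>1\<^bsub>G\<^esub> u)) = \<psi>1 (\<phi>1 (R\<^sub>1\<^bsub>G\<^esub> u)) \<ominus>\<^sub>1 R\<^sub>1 (\<psi>1 (\<phi>1 u))"
    \<comment> \<open>Reading \<open>\<phi>0 (l\<^sub>1 u)\<close> as
      \<open>l\<^sub>1 (\<phi>1 u)\<close> puts the argument in the image of the differential, where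
      the condition on \<open>\<psi>3\<close> applies. The next condition uses the same reading for
      \<open>\<psi>2\<close>.\<close>
    by (rule \<psi>.G'.G1_eqI)
      (simp_all add: \<phi>.\<phi>3_diff \<psi>.\<phi>3_diff a_minus_def flip: \<phi>.\<phi>_diff)
next
  fix x u assume [simp]: "x \<in> deg0 G" "u \<in> deg1 G"
  show "\<psi>2 (\<phi>0 x) (\<phi>0 (l\<^sub>1\<^bsub>G\<^esub> u)) \<oplus>\<^sub>1 \<psi>1 (\<phi>2 x (l\<^sub>1\<^bsub>G\<^esub> u))
      = \<psi>1 (\<phi>1 \<lbrakk>x, u\<rbrakk>\<^sub>0\<^sub>1\<^bsub>G\<^esub>) \<ominus>\<^sub>1 \<lbrakk>\<psi>0 (\<phi>0 x), \<psi>1 (\<phi>1 u)\<rbrakk>\<^sub>0\<^sub>1"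
    by (rule \<psi>.G'.G1_eqI)
      (simp_all add: \<phi>.\<phi>2_diff \<psi>.\<phi>2_diff a_minus_def flip: \<phi>.\<phi>_diff)
next
  fix x assume [simp]: "x \<in> deg0 G"
  show "l\<^sub>1 (\<psi>3 (\<phi>0 x) \<oplus>\<^sub>1 \<psi>1 (\<phi>3 x)) = \<ominus>\<^bsub>G0 G''\<^esub> R\<^sub>0 (\<psi>0 (\<phi>0 x)) \<oplus>\<^sub>0 \<psi>0 (\<phi>0 (R\<^sub>0\<^bsub>G\<^esub> x))"
    by (rule \<psi>.G'.G0_eqI) (simp_all add: \<psi>.\<phi>_diff \<phi>.diff_\<phi>3 \<psi>.diff_\<phi>3)
next
  fix x y assume [simp]: "x \<in> deg0 G" "y \<in> deg0 G"
  show "l\<^sub>1 (\<psi>2 (\<phi>0 x) (\<phi>0 y) \<oplus>\<^sub>1 \<psi>1 (\<phi>2 x y))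
      = \<psi>0 (\<phi>0 \<lbrakk>x, y\<rbrakk>\<^sub>0\<^sub>0\<^bsub>G\<^esub>) \<ominus>\<^sub>0 \<lbrakk>\<psi>0 (\<phi>0 x), \<psi>0 (\<phi>0 y)\<rbrakk>\<^sub>0\<^sub>0"
    by (rule \<psi>.G'.G0_eqI) (simp_all add: \<psi>.\<phi>_diff \<phi>.diff_\<phi>2 \<psi>.diff_\<phi>2 a_minus_def)
  let ?\<chi>2 = "\<lambda>x y. \<psi>2 (\<phi>0 x) (\<phi>0 y) \<oplus>\<^sub>1 \<psi>1 (\<phi>2 x y)" and ?\<chi>3 = "\<lambda>x. \<psi>3 (\<phi>0 x) \<oplus>\<^sub>1 \<psi>1 (\<phi>3 x)"
  show "R\<^sub>2 (\<psi>0 (\<phi>0 x)) (\<psi>0 (\<phi>0 y)) \<oplus>\<^sub>1 R\<^sub>1 \<lbrakk>?\<chi>3 x, \<psi>0 (\<phi>0 y)\<rbrakk>\<^sub>1\<^sub>0 \<oplus>\<^sub>1 R\<^sub>1 \<lbrakk>\<psi>0 (\<phi>0 x), ?\<chi>3 y\<rbrakk>\<^sub>0\<^sub>1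
      \<oplus>\<^sub>1 R\<^sub>1 (?\<chi>2 (R\<^sub>0\<^bsub>G\<^esub> x) y) \<oplus>\<^sub>1 R\<^sub>1 (?\<chi>2 x (R\<^sub>0\<^bsub>G\<^esub> y))
      \<oplus>\<^sub>1 ?\<chi>3 \<lbrakk>R\<^sub>0\<^bsub>G\<^esub> x, y\<rbrakk>\<^sub>0\<^sub>0\<^bsub>G\<^esub> \<oplus>\<^sub>1 ?\<chi>3 \<lbrakk>x, R\<^sub>0\<^bsub>G\<^esub> y\<rbrakk>\<^sub>0\<^sub>0\<^bsub>G\<^esub>
    = arrow_br G'' (R\<^sub>0 (\<psi>0 (\<phi>0 x))) (?\<chi>3 x) (R\<^sub>0 (\<psi>0 (\<phi>0 y))) (?\<chi>3 y)
      \<oplus>\<^sub>1 ?\<chi>2 (R\<^sub>0\<^bsub>G\<^esub> x) (R\<^sub>0\<^bsub>G\<^esub> y) \<oplus>\<^sub>1 \<psi>1 (\<phi>1 (R\<^sub>2\<^bsub>G\<^esub> x y))" (is "?l = ?r")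
  proof (rule \<psi>.G'.G1_eqI)
    show "?l \<in> deg1 G''" "?r \<in> deg1 G''" by (simp_all add: arrow_br_def)
    fix h assume [simp]: "h \<in> additive_functionals (G1 G'')"
    let ?a = "\<phi>0 x" and ?b = "\<phi>0 y" and ?X = "R\<^sub>0\<^bsub>G\<^esub> x" and ?Y = "R\<^sub>0\<^bsub>G\<^esub> y"
    let ?RA = "R\<^sub>0\<^bsub>G'\<^esub> ?a" and ?RB = "R\<^sub>0\<^bsub>G'\<^esub> ?b"
    have s: "\<psi>2 ?b (\<phi>0 ?X) = \<ominus>\<^bsub>G1 G''\<^esub> \<psi>2 (\<phi>0 ?X) ?b" "\<psi>2 ?b ?RA = \<ominus>\<^bsub>G1 G''\<^esub> \<psi>2 ?RA ?b"
      "\<psi>2 ?RB (\<phi>0 ?X) = \<ominus>\<^bsub>G1 G''\<^esub> \<psi>2 (\<phi>0 ?X) ?RB" "\<psi>2 ?RB ?RA = \<ominus>\<^bsub>G1 G''\<^esub> \<psi>2 ?RA ?RB"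
      by (rule \<psi>.\<phi>2_swap; simp)+
    have t: "\<lbrakk>?b, \<phi>0 ?X\<rbrakk>\<^sub>0\<^sub>0\<^bsub>G'\<^esub> = \<ominus>\<^bsub>G0 G'\<^esub> \<lbrakk>\<phi>0 ?X, ?b\<rbrakk>\<^sub>0\<^sub>0\<^bsub>G'\<^esub>"
      "\<lbrakk>?b, ?RA\<rbrakk>\<^sub>0\<^sub>0\<^bsub>G'\<^esub> = \<ominus>\<^bsub>G0 G'\<^esub> \<lbrakk>?RA, ?b\<rbrakk>\<^sub>0\<^sub>0\<^bsub>G'\<^esub>"
      by (rule \<phi>.G'.br00_swap; simp)+
    note simps = s t arrow_br_def a_minus_def \<phi>.diff_\<phi>3 \<psi>.diff_\<phi>3 \<psi>.\<phi>_diff \<phi>.diff_\<phi>2 \<phi>.G'.diff_br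
    \<comment> \<open>The law of \<open>\<phi>\<close>, carried to the last algebra by
      \<open>\<psi>1\<close>.\<close>
    have c1: "h (\<psi>1 (R\<^sub>2\<^bsub>G'\<^esub> ?a ?b \<oplus>\<^sub>1\<^bsub>G'\<^esub> R\<^sub>1\<^bsub>G'\<^esub> \<lbrakk>\<phi>3 x, ?b\<rbrakk>\<^sub>1\<^sub>0\<^bsub>G'\<^esub>
      \<oplus>\<^sub>1\<^bsub>G'\<^esub> R\<^sub>1\<^bsub>G'\<^esub> \<lbrakk>?a, \<phi>3 y\<rbrakk>\<^sub>0\<^sub>1\<^bsub>G'\<^esub>
        \<oplus>\<^sub>1\<^bsub>G'\<^esub> R\<^sub>1\<^bsub>G'\<^esub> (\<phi>2 ?X y) \<oplus>\<^sub>1\<^bsub>G'\<^esub> R\<^sub>1\<^bsub>G'\<^esub> (\<phi>2 x ?Y)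
        \<oplus>\<^sub>1\<^bsub>G'\<^esub> \<phi>3 \<lbrakk>?X, y\<rbrakk>\<^sub>0\<^sub>0\<^bsub>G\<^esub> \<oplus>\<^sub>1\<^bsub>G'\<^esub> \<phi>3 \<lbrakk>x, ?Y\<rbrakk>\<^sub>0\<^sub>0\<^bsub>G\<^esub>))
      = h (\<psi>1 (arrow_br G' ?RA (\<phi>3 x) ?RB (\<phi>3 y) \<oplus>\<^sub>1\<^bsub>G'\<^esub> \<phi>2 ?X ?Y \<oplus>\<^sub>1\<^bsub>G'\<^esub> \<phi>1 (R\<^sub>2\<^bsub>G\<^esub> x y)))"
      by (subst \<phi>.\<phi>3_coherence) simp_all
    note c2 = arg_cong[OF \<psi>.\<phi>3_coherence[of ?a ?b], of h]
    \<comment> \<open>Carrying the law of \<open>\<phi>\<close> forward leaves terms in which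
      \<open>\<psi>1\<close> stands outside \<open>R\<^sub>1\<close>. The relation for
      \<open>\<psi>3\<close> on boundaries exchanges the two at each degree-1 element that occurs
      there.\<close>
    note c3 = arg_cong[OF \<psi>.\<phi>3_diff[of "\<phi>2 ?X y"], of h] arg_cong[OF \<psi>.\<phi>3_diff[of "\<phi>2 x ?Y"], of h]
      arg_cong[OF \<psi>.\<phi>3_diff[of "\<lbrakk>?b, \<phi>3 x\<rbrakk>\<^sub>0\<^sub>1\<^bsub>G'\<^esub>"], of h]
      arg_cong[OF \<psi>.\<phi>3_diff[of "\<lbrakk>?a, \<phi>3 y\<rbrakk>\<^sub>0\<^sub>1\<^bsub>G'\<^esub>"], of h]
    \<comment> \<open>In the same way \<open>\<psi>1\<close> is moved inside the brackets with
      \<open>\<phi>3 x\<close> and \<open>\<phi>3 y\<close>, at the price of values of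
      \<open>\<psi>2\<close> on boundaries.\<close>
    note c4 = arg_cong[OF \<psi>.\<phi>2_diff[of ?b "\<phi>3 x"], of "\<lambda>t. h (R\<^sub>1 t)"]
      arg_cong[OF \<psi>.\<phi>2_diff[of ?a "\<phi>3 y"], of "\<lambda>t. h (R\<^sub>1 t)"]
      arg_cong[OF \<psi>.\<phi>2_diff[of "\<phi>0 ?X" "\<phi>3 y"], of h] arg_cong[OF \<psi>.\<phi>2_diff[of ?RB "\<phi>3 x"], of h]
    \<comment> \<open>Expanding \<open>arrow_br\<close> for the sums
      \<open>\<psi>3 (\<phi>0 x) + \<psi>1 (\<phi>3 x)\<close> and its analogue in \<open>y\<close>
      yields a mixed bracket of \<open>\<psi>1 (\<phi>3 x)\<close> with
      \<open>\<psi>3 (\<phi>0 y)\<close>; the differential has to be moved across it.\<close>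
    note c5 = arg_cong[OF \<psi>.G'.br_diff[of "\<psi>1 (\<phi>3 x)" "\<psi>3 ?b"], of h]
    show "h ?l = h ?r"
      using c1 c2 c3 c4 c5 by (simp add: simps)
  qed
next
  fix x y z assume [simp]: "x \<in> deg0 G" "y \<in> deg0 G" "z \<in> deg0 G"
  let ?\<chi>2 = "\<lambda>x y. \<psi>2 (\<phi>0 x) (\<phi>0 y) \<oplus>\<^sub>1 \<psi>1 (\<phi>2 x y)"
  show "\<lbrakk>?\<chi>2 x y, \<psi>0 (\<phi>0 z)\<rbrakk>\<^sub>1\<^sub>0 \<oplus>\<^sub>1 ?\<chi>2 \<lbrakk>x, y\<rbrakk>\<^sub>0\<^sub>0\<^bsub>G\<^esub> z \<oplus>\<^sub>1 \<psi>1 (\<phi>1 (l\<^sub>3\<^bsub>G\<^esub> x y z))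
      = l\<^sub>3 (\<psi>0 (\<phi>0 x)) (\<psi>0 (\<phi>0 y)) (\<psi>0 (\<phi>0 z)) \<oplus>\<^sub>1 \<lbrakk>\<psi>0 (\<phi>0 x), ?\<chi>2 y z\<rbrakk>\<^sub>0\<^sub>1
        \<oplus>\<^sub>1 \<lbrakk>?\<chi>2 x z, \<psi>0 (\<phi>0 y)\<rbrakk>\<^sub>1\<^sub>0 \<oplus>\<^sub>1 ?\<chi>2 x \<lbrakk>y, z\<rbrakk>\<^sub>0\<^sub>0\<^bsub>G\<^esub> \<oplus>\<^sub>1 ?\<chi>2 \<lbrakk>x, z\<rbrakk>\<^sub>0\<^sub>0\<^bsub>G\<^esub> y" (is "?l = ?r")
  proof (rule \<psi>.G'.G1_eqI)
    fix h assume [simp]: "h \<in> additive_functionals (G1 G'')"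
    have s: "\<psi>2 (\<phi>0 z) (\<phi>0 \<lbrakk>x, y\<rbrakk>\<^sub>0\<^sub>0\<^bsub>G\<^esub>) = \<ominus>\<^bsub>G1 G''\<^esub> \<psi>2 (\<phi>0 \<lbrakk>x, y\<rbrakk>\<^sub>0\<^sub>0\<^bsub>G\<^esub>) (\<phi>0 z)"
      "\<psi>2 (\<phi>0 z) \<lbrakk>\<phi>0 x, \<phi>0 y\<rbrakk>\<^sub>0\<^sub>0\<^bsub>G'\<^esub> = \<ominus>\<^bsub>G1 G''\<^esub> \<psi>2 \<lbrakk>\<phi>0 x, \<phi>0 y\<rbrakk>\<^sub>0\<^sub>0\<^bsub>G'\<^esub> (\<phi>0 z)"
      "\<psi>2 (\<phi>0 y) (\<phi>0 \<lbrakk>x, z\<rbrakk>\<^sub>0\<^sub>0\<^bsub>G\<^esub>) = \<ominus>\<^bsub>G1 G''\<^esub> \<psi>2 (\<phi>0 \<lbrakk>x, z\<rbrakk>\<^sub>0\<^sub>0\<^bsub>G\<^esub>) (\<phi>0 y)"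
      "\<psi>2 (\<phi>0 y) \<lbrakk>\<phi>0 x, \<phi>0 z\<rbrakk>\<^sub>0\<^sub>0\<^bsub>G'\<^esub> = \<ominus>\<^bsub>G1 G''\<^esub> \<psi>2 \<lbrakk>\<phi>0 x, \<phi>0 z\<rbrakk>\<^sub>0\<^sub>0\<^bsub>G'\<^esub> (\<phi>0 y)"
      by (rule \<psi>.\<phi>2_swap; simp)+
    have c1: "h (\<psi>1 (\<lbrakk>\<phi>2 x y, \<phi>0 z\<rbrakk>\<^sub>1\<^sub>0\<^bsub>G'\<^esub> \<oplus>\<^sub>1\<^bsub>G'\<^esub> \<phi>2 \<lbrakk>x, y\<rbrakk>\<^sub>0\<^sub>0\<^bsub>G\<^esub> z \<oplus>\<^sub>1\<^bsub>G'\<^esub> \<phi>1 (l\<^sub>3\<^bsub>G\<^esub> x y z)))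
      = h (\<psi>1 (l\<^sub>3\<^bsub>G'\<^esub> (\<phi>0 x) (\<phi>0 y) (\<phi>0 z) \<oplus>\<^sub>1\<^bsub>G'\<^esub> \<lbrakk>\<phi>0 x, \<phi>2 y z\<rbrakk>\<^sub>0\<^sub>1\<^bsub>G'\<^esub>
        \<oplus>\<^sub>1\<^bsub>G'\<^esub> \<lbrakk>\<phi>2 x z, \<phi>0 y\<rbrakk>\<^sub>1\<^sub>0\<^bsub>G'\<^esub>
        \<oplus>\<^sub>1\<^bsub>G'\<^esub> \<phi>2 x \<lbrakk>y, z\<rbrakk>\<^sub>0\<^sub>0\<^bsub>G\<^esub> \<oplus>\<^sub>1\<^bsub>G'\<^esub> \<phi>2 \<lbrakk>x, z\<rbrakk>\<^sub>0\<^sub>0\<^bsub>G\<^esub> y))"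
      by (subst \<phi>.\<phi>2_coherence) simp_all
    note c2 = arg_cong[OF \<psi>.\<phi>2_coherence[of "\<phi>0 x" "\<phi>0 y" "\<phi>0 z"], of h]
    \<comment> \<open>These are the three brackets with a value of \<open>\<phi>2\<close> in the law
      of \<open>\<phi>\<close>. Moving \<open>\<psi>1\<close> inside them produces the brackets
      required for the composite and values of \<open>\<psi>2\<close> on boundaries, which cancel
      against the law of \<open>\<psi>\<close>.\<close>
    note c3 = arg_cong[OF \<psi>.\<phi>2_diff[of "\<phi>0 z" "\<phi>2 x y"], of h]
      arg_cong[OF \<psi>.\<phi>2_diff[of "\<phi>0 x" "\<phi>2 y z"], of h]
      arg_cong[OF \<psi>.\<phi>2_diff[of "\<phi>0 y" "\<phi>2 x z"], of h]
    show "h ?l = h ?r"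
      using c1 c2 c3 by (simp add: s \<phi>.diff_\<phi>2 a_minus_def)
  qed simp_all
qed

end

section \<open>The Lie 2-algebra of a 2-term algebra\<close>

text \<open>\<open>pr x u\<close> encodes the arrow \<open>u : x \<rightarrow> x + l\<^sub>1 u\<close> as an element of \<open>'v\<close>; \<open>p0\<close> and \<open>p1\<close> decode it.\<close>

definition pair_space ::
  "('v \<Rightarrow> 'v \<Rightarrow> 'v) \<Rightarrow> ('v \<Rightarrow> 'v) \<Rightarrow> ('v \<Rightarrow> 'v) \<Rightarrow> ('k, 'v) module \<Rightarrow> ('k, 'v) module \<Rightarrow> ('k, 'v) module"
  where "pair_space pr p0 p1 V W = V
    \<lparr>carrier := {pr x u | x u. x \<in> carrier V \<and> u \<in> carrier W},
     zero := pr \<zero>\<^bsub>V\<^esub> \<zero>\<^bsub>W\<^esub>,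
     add := (\<lambda>f g. pr (p0 f \<oplus>\<^bsub>V\<^esub> p0 g) (p1 f \<oplus>\<^bsub>W\<^esub> p1 g)),
     smult := (\<lambda>c f. pr (c \<odot>\<^bsub>V\<^esub> p0 f) (c \<odot>\<^bsub>W\<^esub> p1 f))\<rparr>"

text \<open>A morphism is fixed by its source and arrow part, so the Jacobiator and the Rota-Baxter
  transformation pair the source demanded by their typing with \<open>l\<^sub>3\<close> and
  \<open>R\<^sub>2\<close>.\<close>

definition lie_two_of ::
  "('v \<Rightarrow> 'v \<Rightarrow> 'v) \<Rightarrow> ('v \<Rightarrow> 'v) \<Rightarrow> ('v \<Rightarrow> 'v) \<Rightarrow> ('k, 'v) rb_two_term \<Rightarrow> ('k, 'v) rb_lie_two_alg"
  where "lie_two_of pr p0 p1 G =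
    \<lparr>Ob = G0 G, Mor = pair_space pr p0 p1 (G0 G) (G1 G), src = p0,
     tgt = (\<lambda>f. p0 f \<oplus>\<^sub>0 l\<^sub>1 (p1 f)), idm = (\<lambda>x. pr x \<zero>\<^bsub>G1 G\<^esub>),
     cmp = (\<lambda>g f. pr (p0 f) (p1 g \<oplus>\<^sub>1 p1 f)), ob_br = br00 G,
     mor_br = (\<lambda>f g. pr \<lbrakk>p0 f, p0 g\<rbrakk>\<^sub>0\<^sub>0 (arrow_br G (p0 f) (p1 f) (p0 g) (p1 g))),
     jac = (\<lambda>x y z. pr \<lbrakk>\<lbrakk>x, y\<rbrakk>\<^sub>0\<^sub>0, z\<rbrakk>\<^sub>0\<^sub>0 (l\<^sub>3 x y z)),
     rb_ob = rop0 G, rb_mor = (\<lambda>f. pr (R\<^sub>0 (p0 f)) (R\<^sub>1 (p1 f))),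
     rb_nat = (\<lambda>x y. pr \<lbrakk>R\<^sub>0 x, R\<^sub>0 y\<rbrakk>\<^sub>0\<^sub>0 (R\<^sub>2 x y))\<rparr>" for G (structure)

text \<open>The encoding is constrained only on the two carriers. This is weak enough to be
  satisfied both by a bijection of an infinite type with its square and by a degenerate encoding of
  zero spaces.\<close>

locale paired_rb_two_term = char0_rb_two_term K G
  for K :: "('k, 'c) ring_scheme" and G :: "('k, 'v) rb_two_term" (structure) +
  fixes pr :: "'v \<Rightarrow> 'v \<Rightarrow> 'v" and p0 p1 :: "'v \<Rightarrow> 'v"
  assumes p0_pr [simp]: "\<lbrakk>x \<in> deg0 G; u \<in> deg1 G\<rbrakk> \<Longrightarrow> p0 (pr x u) = x"
    and p1_pr [simp]: "\<lbrakk>x \<in> deg0 G; u \<in> deg1 G\<rbrakk> \<Longrightarrow> p1 (pr x u) = u"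
begin

abbreviation L where "L \<equiv> lie_two_of pr p0 p1 G"

lemma L_simps [simp]:
  "Ob L = G0 G" "src L = p0" "tgt L f = p0 f \<oplus>\<^sub>0 l\<^sub>1 (p1 f)" "idm L x = pr x \<zero>\<^bsub>G1 G\<^esub>"
  "cmp L g f = pr (p0 f) (p1 g \<oplus>\<^sub>1 p1 f)" "ob_br L = br00 G"
  "mor_br L f g = pr \<lbrakk>p0 f, p0 g\<rbrakk>\<^sub>0\<^sub>0 (arrow_br G (p0 f) (p1 f) (p0 g) (p1 g))"
  "jac L x y z = pr \<lbrakk>\<lbrakk>x, y\<rbrakk>\<^sub>0\<^sub>0, z\<rbrakk>\<^sub>0\<^sub>0 (l\<^sub>3 x y z)"
  "rb_ob L = rop0 G" "rb_mor L f = pr (R\<^sub>0 (p0 f)) (R\<^sub>1 (p1 f))"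
  "rb_nat L x y = pr \<lbrakk>R\<^sub>0 x, R\<^sub>0 y\<rbrakk>\<^sub>0\<^sub>0 (R\<^sub>2 x y)"
  "\<zero>\<^bsub>Mor L\<^esub> = pr \<zero>\<^bsub>G0 G\<^esub> \<zero>\<^bsub>G1 G\<^esub>" "f \<oplus>\<^bsub>Mor L\<^esub> g = pr (p0 f \<oplus>\<^sub>0 p0 g) (p1 f \<oplus>\<^sub>1 p1 g)"
  "c \<odot>\<^bsub>Mor L\<^esub> f = pr (c \<odot>\<^bsub>G0 G\<^esub> p0 f) (c \<odot>\<^bsub>G1 G\<^esub> p1 f)"
  by (simp_all add: lie_two_of_def pair_space_def)

lemma pr_closed [simp]: "\<lbrakk>x \<in> deg0 G; u \<in> deg1 G\<rbrakk> \<Longrightarrow> pr x u \<in> mors L"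
  by (auto simp: lie_two_of_def pair_space_def)

lemma mors_cases:
  assumes "f \<in> mors L"
  obtains x u where "x \<in> deg0 G" "u \<in> deg1 G" "f = pr x u"
  using assms by (auto simp: lie_two_of_def pair_space_def)

lemma p_closed [simp]:
  assumes "f \<in> mors L"
  shows "p0 f \<in> deg0 G" "p1 f \<in> deg1 G" "pr (p0 f) (p1 f) = f"
proof -
  obtain x u where xu: "x \<in> deg0 G" "u \<in> deg1 G" and f: "f = pr x u"
    using assms by (rule mors_cases)
  show "p0 f \<in> deg0 G" "p1 f \<in> deg1 G" "pr (p0 f) (p1 f) = f"
    unfolding f using xu by simp_all
qed

lemma L_eqI:
  assumes "f \<in> mors L" "g \<in> mors L" "p0 f = p0 g" "p1 f = p1 g"
  shows "f = g"
  using p_closed(3)[OF assms(1)] p_closed(3)[OF assms(2)] assms(3,4) by metis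

lemma arrow_br_closed [simp]:
  "\<lbrakk>a \<in> deg0 G; u \<in> deg1 G; b \<in> deg0 G; v \<in> deg1 G\<rbrakk> \<Longrightarrow> arrow_br G a u b v \<in> deg1 G"
  by (simp add: arrow_br_def)

lemma L_vectorspace: "vectorspace K (Mor L)"
proof (rule vs_criteria)
  show "field K" using G0_space by (simp add: fd_vectorspace_def vectorspace_def)
  show "\<forall>f\<in>mors L. \<exists>g\<in>mors L. f \<oplus>\<^bsub>Mor L\<^esub> g = \<zero>\<^bsub>Mor L\<^esub>"
  proof
    fix f assume "f \<in> mors L"
    then show "\<exists>g\<in>mors L. f \<oplus>\<^bsub>Mor L\<^esub> g = \<zero>\<^bsub>Mor L\<^esub>"
      by (intro bexI[of _ "pr (\<ominus>\<^bsub>G0 G\<^esub> p0 f) (\<ominus>\<^bsub>G1 G\<^esub> p1 f)"]) (simp_all add: G0.r_neg G1.r_neg)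
  qed
qed (auto simp: G0.a_ac G1.a_ac G0.smult_assoc1 G1.smult_assoc1 G0.smult_l_distr G1.smult_l_distr
    G0.smult_r_distr G1.smult_r_distr)

lemma L_neg [simp]: "f \<in> mors L \<Longrightarrow> \<ominus>\<^bsub>Mor L\<^esub> f = pr (\<ominus>\<^bsub>G0 G\<^esub> p0 f) (\<ominus>\<^bsub>G1 G\<^esub> p1 f)"
proof -
  interpret M: vectorspace K "Mor L" by (rule L_vectorspace)
  assume "f \<in> mors L"
  then show ?thesis
    by (intro M.minus_equality) (simp_all add: G0.l_neg G1.l_neg)
qed

lemma L_arrow_part [simp]: "f \<in> mors L \<Longrightarrow> arrow_part L f = pr \<zero>\<^bsub>G0 G\<^esub> (p1 f)"
  by (simp add: arrow_part_def a_minus_def G0.r_neg)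

text \<open>The inverse starts at the target and has the negated arrow part. Invertibility of the
  Jacobiator and of the Rota-Baxter transformation comes from here.\<close>

lemma L_invertible:
  assumes [simp]: "f \<in> mors L"
  shows "invertible_mor L f"
  unfolding invertible_mor_def mor_between_def
  by (intro conjI bexI[of _ "pr (p0 f \<oplus>\<^sub>0 l\<^sub>1 (p1 f)) (\<ominus>\<^bsub>G1 G\<^esub> p1 f)"])
    (simp_all add: G1.l_neg G1.r_neg G0.a_assoc G0.r_neg)

lemma L_two_vector_space: "two_vector_space K L"
proof
  show "fd_vectorspace K (Ob L)" using G0_space by simp
  have hom: "(\<lambda>x. pr x \<zero>\<^bsub>G1 G\<^esub>) \<in> module_hom K (G0 G) (Mor L)"
    by (rule module_homI) simp_all
  show "fd_vectorspace K (Mor L)"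
  proof (rule fin_dim_sum[OF G0_space G1_space L_vectorspace hom])
    show "(\<lambda>u. pr \<zero>\<^bsub>G0 G\<^esub> u) \<in> module_hom K (G1 G) (Mor L)"
      by (rule module_homI) simp_all
  next
    fix f assume f: "f \<in> mors L"
    then show "\<exists>x\<in>deg0 G. \<exists>u\<in>deg1 G. f = pr x \<zero>\<^bsub>G1 G\<^esub> \<oplus>\<^bsub>Mor L\<^esub> pr \<zero>\<^bsub>G0 G\<^esub> u"
      by (intro bexI[of _ "p0 f"] bexI[of _ "p1 f"]) simp_all
  qed
  show "src L \<in> module_hom K (Mor L) (Ob L)"
    by (rule module_homI) simp_all
  show "tgt L \<in> module_hom K (Mor L) (Ob L)"
    by (rule module_homI) (simp_all add: G0.a_ac G0.smult_r_distr)
  show "idm L \<in> module_hom K (Ob L) (Mor L)"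
    by (rule module_homI) simp_all
  show "(\<lambda>(g, f). g \<diamondop>\<^bsub>L\<^esub> f)
      \<in> module_hom K ((direct_sum (Mor L) (Mor L))\<lparr>carrier := composable_pairs L\<rparr>) (Mor L)"
    by (rule module_homI)
      (auto simp: composable_pairs_def direct_sum_def G0.a_ac G1.a_ac G0.smult_r_distr
        G1.smult_r_distr)
next
  fix g f assume "(g, f) \<in> composable_pairs L"
  then have "g \<in> mors L" "f \<in> mors L" "p0 g = p0 f \<oplus>\<^sub>0 l\<^sub>1 (p1 f)"
    by (auto simp: composable_pairs_def)
  then show "tgt L (g \<diamondop>\<^bsub>L\<^esub> f) = tgt L g" by (simp add: G0.a_ac)
qed (auto simp: composable_pairs_def G1.a_ac G0.a_ac)

lemma L_bilinear_functor: "bilinear_functor K L (ob_br L) (mor_br L)"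
proof
  show "bilinear_map K (Ob L) (Ob L) (Ob L) (ob_br L)" by (simp add: br00_bilinear)
  show "bilinear_map K (Mor L) (Mor L) (Mor L) (mor_br L)"
    by (rule bilinear_mapI; (rule L_eqI)?; (simp; fail)?; rule G1_eqI)
      (simp_all add: arrow_br_def G1.smult_r_distr G1.smult_r_minus)
next
  fix f g assume [simp]: "f \<in> mors L" "g \<in> mors L"
  show "src L (mor_br L f g) = ob_br L (src L f) (src L g)" by simp
  have s: "\<lbrakk>l\<^sub>1 (p1 f), p0 g\<rbrakk>\<^sub>0\<^sub>0 = \<ominus>\<^bsub>G0 G\<^esub> \<lbrakk>p0 g, l\<^sub>1 (p1 f)\<rbrakk>\<^sub>0\<^sub>0" by (rule br00_swap) simp_all
  show "tgt L (mor_br L f g) = ob_br L (tgt L f) (tgt L g)"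
    by (rule G0_eqI) (simp_all add: arrow_br_def s diff_br)
next
  fix x y assume "x \<in> obs L" "y \<in> obs L"
  then show "mor_br L (idm L x) (idm L y) = idm L (ob_br L x y)"
    by (simp add: arrow_br_def)
next
  fix f' f g' g assume "(f', f) \<in> composable_pairs L" "(g', g) \<in> composable_pairs L"
  then have [simp]: "f \<in> mors L" "g \<in> mors L" "f' \<in> mors L" "g' \<in> mors L"
    "p0 f' = p0 f \<oplus>\<^sub>0 l\<^sub>1 (p1 f)" "p0 g' = p0 g \<oplus>\<^sub>0 l\<^sub>1 (p1 g)"
    by (auto simp: composable_pairs_def)
  show "mor_br L (cmp L f' f) (cmp L g' g) = cmp L (mor_br L f' g') (mor_br L f g)"
  proof (rule L_eqI)
    show "p1 (mor_br L (cmp L f' f) (cmp L g' g)) = p1 (cmp L (mor_br L f' g') (mor_br L f g))"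
      (is "?l = ?r")
    proof (rule G1_eqI)
      fix h assume [simp]: "h \<in> additive_functionals (G1 G)"
      show "h ?l = h ?r"
        \<comment> \<open>Expanding both sides of the interchange law leaves one discrepancy: the
          bracket of the arrow parts of \<open>f'\<close> and \<open>g\<close>, with the
          differential on one factor or on the other.\<close>
        using arg_cong[OF br_diff[of "p1 f'" "p1 g"], of h] by (simp add: arrow_br_def)
    qed simp_all
  qed simp_all
qed

lemma L_lie_two_algebra: "lie_two_algebra K L"
proof (intro lie_two_algebra.intro lie_two_algebra_axioms.intro L_two_vector_space
    L_bilinear_functor, goal_cases)
  show "skew2 (Ob L) (Ob L) (ob_br L)" using br00_skew by simp
  show "skew2 (Mor L) (Mor L) (mor_br L)"
    unfolding skew2_def
  proof (intro ballI, rule L_eqI)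
    fix f g assume [simp]: "f \<in> mors L" "g \<in> mors L"
    have "\<lbrakk>p0 f, p0 g\<rbrakk>\<^sub>0\<^sub>0 = \<ominus>\<^bsub>G0 G\<^esub> \<lbrakk>p0 g, p0 f\<rbrakk>\<^sub>0\<^sub>0" by (rule br00_swap) simp_all
    then show "p0 (mor_br L f g) = p0 (\<ominus>\<^bsub>Mor L\<^esub> mor_br L g f)" by simp
    show "p1 (mor_br L f g) = p1 (\<ominus>\<^bsub>Mor L\<^esub> mor_br L g f)" (is "?l = ?r")
    proof (rule G1_eqI)
      fix h assume [simp]: "h \<in> additive_functionals (G1 G)"
      show "h ?l = h ?r"
        \<comment> \<open>The formula for \<open>arrow_br\<close> favours the target of its first
          argument, so skewness is not visible term by term; exchanging the differential between the
          two arrow parts restores it.\<close>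
        using arg_cong[OF br_diff[of "p1 f" "p1 g"], of h] by (simp add: arrow_br_def)
    qed simp_all
  qed simp_all
  show "trilinear_map K (Ob L) (Mor L) (jac L)"
    unfolding trilinear_map_def by (intro conjI ballI; rule module_homI) simp_all
  show "skew3 (Ob L) (Mor L) (\<lambda>x y z. arrow_part L (jac L x y z))"
    unfolding skew3_def
  proof (intro ballI conjI)
    fix x y z assume "x \<in> obs L" "y \<in> obs L" "z \<in> obs L"
    then have [simp]: "x \<in> deg0 G" "y \<in> deg0 G" "z \<in> deg0 G" by simp_all
    show "arrow_part L (jac L x y z) = \<ominus>\<^bsub>Mor L\<^esub> arrow_part L (jac L y x z)"
      using tern_swap(1)[of x y z] by simp
    show "arrow_part L (jac L x y z) = \<ominus>\<^bsub>Mor L\<^esub> arrow_part L (jac L x z y)"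
      using tern_swap(2)[of x y z] by simp
  qed
next
  fix x y z assume "x \<in> obs L" "y \<in> obs L" "z \<in> obs L"
  then have [simp]: "x \<in> deg0 G" "y \<in> deg0 G" "z \<in> deg0 G" by simp_all
  show "jac L x y z \<in> mor_between L (ob_br L (ob_br L x y) z)
      (ob_br L x (ob_br L y z) \<oplus>\<^sub>O\<^bsub>L\<^esub> ob_br L (ob_br L x z) y)"
  proof -
    have s: "\<lbrakk>\<lbrakk>x, y\<rbrakk>\<^sub>0\<^sub>0, z\<rbrakk>\<^sub>0\<^sub>0 = \<ominus>\<^bsub>G0 G\<^esub> \<lbrakk>z, \<lbrakk>x, y\<rbrakk>\<^sub>0\<^sub>0\<rbrakk>\<^sub>0\<^sub>0"
      "\<lbrakk>\<lbrakk>x, z\<rbrakk>\<^sub>0\<^sub>0, y\<rbrakk>\<^sub>0\<^sub>0 = \<ominus>\<^bsub>G0 G\<^esub> \<lbrakk>y, \<lbrakk>x, z\<rbrakk>\<^sub>0\<^sub>0\<rbrakk>\<^sub>0\<^sub>0"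
      "\<lbrakk>z, x\<rbrakk>\<^sub>0\<^sub>0 = \<ominus>\<^bsub>G0 G\<^esub> \<lbrakk>x, z\<rbrakk>\<^sub>0\<^sub>0"
      by (rule br00_swap; simp)+
    have "\<lbrakk>\<lbrakk>x, y\<rbrakk>\<^sub>0\<^sub>0, z\<rbrakk>\<^sub>0\<^sub>0 \<oplus>\<^sub>0 l\<^sub>1 (l\<^sub>3 x y z) = \<lbrakk>x, \<lbrakk>y, z\<rbrakk>\<^sub>0\<^sub>0\<rbrakk>\<^sub>0\<^sub>0 \<oplus>\<^sub>0 \<lbrakk>\<lbrakk>x, z\<rbrakk>\<^sub>0\<^sub>0, y\<rbrakk>\<^sub>0\<^sub>0"
      by (rule G0_eqI) (simp_all add: diff_tern s)
    then show ?thesis by (simp add: mor_between_def)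
  qed
  show "invertible_mor L (jac L x y z)" by (rule L_invertible) simp
next
  fix f g h assume [simp]: "f \<in> mors L" "g \<in> mors L" "h \<in> mors L"
  show "cmp L (jac L (tgt L f) (tgt L g) (tgt L h)) (mor_br L (mor_br L f g) h)
    = cmp L (mor_br L f (mor_br L g h) \<oplus>\<^sub>M\<^bsub>L\<^esub> mor_br L (mor_br L f h) g)
        (jac L (src L f) (src L g) (src L h))"
  proof (rule L_eqI)
    show "p1 (cmp L (jac L (tgt L f) (tgt L g) (tgt L h)) (mor_br L (mor_br L f g) h))
      = p1 (cmp L (mor_br L f (mor_br L g h) \<oplus>\<^sub>M\<^bsub>L\<^esub> mor_br L (mor_br L f h) g)
        (jac L (src L f) (src L g) (src L h)))" (is "?l = ?r")
    proof (rule G1_eqI)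
      let ?a = "p0 f" and ?b = "p0 g" and ?c = "p0 h" and ?u = "p1 f" and ?v = "p1 g"
        and ?w = "p1 h"
      let ?A = "?a \<oplus>\<^sub>0 l\<^sub>1 ?u" and ?B = "?b \<oplus>\<^sub>0 l\<^sub>1 ?v"
      have s: "l\<^sub>3 ?a (l\<^sub>1 ?v) ?c = \<ominus>\<^bsub>G1 G\<^esub> l\<^sub>3 ?a ?c (l\<^sub>1 ?v)"
        "l\<^sub>3 (l\<^sub>1 ?u) (l\<^sub>1 ?v) ?c = \<ominus>\<^bsub>G1 G\<^esub> l\<^sub>3 (l\<^sub>1 ?u) ?c (l\<^sub>1 ?v)"
        "l\<^sub>3 (l\<^sub>1 ?u) ?b ?c = \<ominus>\<^bsub>G1 G\<^esub> l\<^sub>3 ?b (l\<^sub>1 ?u) ?c"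
          "l\<^sub>3 ?b (l\<^sub>1 ?u) ?c = \<ominus>\<^bsub>G1 G\<^esub> l\<^sub>3 ?b ?c (l\<^sub>1 ?u)"
        by (rule tern_swap; simp)+
      have t: "\<lbrakk>?b, l\<^sub>1 ?u\<rbrakk>\<^sub>0\<^sub>0 = \<ominus>\<^bsub>G0 G\<^esub> \<lbrakk>l\<^sub>1 ?u, ?b\<rbrakk>\<^sub>0\<^sub>0"
        "\<lbrakk>?c, l\<^sub>1 ?u\<rbrakk>\<^sub>0\<^sub>0 = \<ominus>\<^bsub>G0 G\<^esub> \<lbrakk>l\<^sub>1 ?u, ?c\<rbrakk>\<^sub>0\<^sub>0"
        by (rule br00_swap; simp)+
      fix k assume [simp]: "k \<in> additive_functionals (G1 G)"
      show "k ?l = k ?r"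
        \<comment> \<open>Passage from the sources to the targets is made one argument at a time: by
          trilinearity the change of \<open>l\<^sub>3\<close> is the sum of its values at
          \<open>(A, B, l\<^sub>1 w)\<close>, \<open>(A, l\<^sub>1 v, c)\<close> and
          \<open>(l\<^sub>1 u, b, c)\<close>. The differential is exchanged once more in the double
          bracket of \<open>v\<close> and \<open>w\<close>.\<close>
        using arg_cong[OF tern_diff[of ?A ?B ?w], of k] arg_cong[OF tern_diff[of ?A ?c ?v], of k]
          arg_cong[OF tern_diff[of ?b ?c ?u], of k] arg_cong[OF br_diff[of ?v "\<lbrakk>?A, ?w\<rbrakk>\<^sub>0\<^sub>1"], of k]
        by (simp add: arrow_br_def s t diff_br)
    qed simp_all
  qed simp_all
next
  \<comment> \<open>The Jacobiator coherence law. On second components all identity summands are 0,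
    which leaves the four-variable law of the 2-term algebra.\<close>
  case (8 w x y z)
  then have [simp]: "w \<in> deg0 G" "x \<in> deg0 G" "y \<in> deg0 G" "z \<in> deg0 G" by simp_all
  have s: "l\<^sub>3 w \<lbrakk>x, y\<rbrakk>\<^sub>0\<^sub>0 z = \<ominus>\<^bsub>G1 G\<^esub> l\<^sub>3 \<lbrakk>x, y\<rbrakk>\<^sub>0\<^sub>0 w z"
    "l\<^sub>3 w \<lbrakk>x, z\<rbrakk>\<^sub>0\<^sub>0 y = \<ominus>\<^bsub>G1 G\<^esub> l\<^sub>3 \<lbrakk>x, z\<rbrakk>\<^sub>0\<^sub>0 w y"
    "l\<^sub>3 w x \<lbrakk>y, z\<rbrakk>\<^sub>0\<^sub>0 = \<ominus>\<^bsub>G1 G\<^esub> l\<^sub>3 w \<lbrakk>y, z\<rbrakk>\<^sub>0\<^sub>0 x"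
      "l\<^sub>3 w \<lbrakk>y, z\<rbrakk>\<^sub>0\<^sub>0 x = \<ominus>\<^bsub>G1 G\<^esub> l\<^sub>3 \<lbrakk>y, z\<rbrakk>\<^sub>0\<^sub>0 w x"
    by (rule tern_swap; simp)+
  show ?case (is "?f = ?g")
  proof (rule L_eqI)
    show "p1 ?f = p1 ?g"
    proof (rule G1_eqI)
      fix h assume [simp]: "h \<in> additive_functionals (G1 G)"
      show "h (p1 ?f) = h (p1 ?g)"
        using arg_cong[OF tern_coherence[of w x y z], of h]
          by (simp add: arrow_br_def s a_minus_def)
    qed simp_all
  qed simp_all
qed

end

section \<open>The Rota-Baxter structure on pairs and the comparison with the given algebra\<close>

context paired_rb_two_term
begin

lemma L_rb_functor: "linear_functor K L L (rb_ob L) (rb_mor L)"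
proof
  show "rb_ob L \<in> module_hom K (Ob L) (Ob L)" by (simp add: rop0_linear)
  show "rb_mor L \<in> module_hom K (Mor L) (Mor L)" by (rule module_homI) simp_all
qed (auto simp: composable_pairs_def diff_rop)

lemma L_rb_lie_two_algebra: "rb_lie_two_algebra K L"
proof (intro rb_lie_two_algebra.intro rb_lie_two_algebra_axioms.intro L_lie_two_algebra
    L_rb_functor, goal_cases)
  show "bilinear_map K (Ob L) (Ob L) (Mor L) (rb_nat L)"
    by (rule bilinear_mapI) simp_all
  show "skew2 (Ob L) (Mor L) (\<lambda>x y. arrow_part L (rb_nat L x y))"
    unfolding skew2_def
  proof (intro ballI)
    fix x y assume "x \<in> obs L" "y \<in> obs L"
    then show "arrow_part L (rb_nat L x y) = \<ominus>\<^bsub>Mor L\<^esub> arrow_part L (rb_nat L y x)"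
      using rop2_swap[of x y] by simp
  qed
next
  fix x y assume "x \<in> obs L" "y \<in> obs L"
  then have [simp]: "x \<in> deg0 G" "y \<in> deg0 G" by simp_all
  have "\<lbrakk>R\<^sub>0 x, R\<^sub>0 y\<rbrakk>\<^sub>0\<^sub>0 \<oplus>\<^sub>0 l\<^sub>1 (R\<^sub>2 x y) = R\<^sub>0 \<lbrakk>R\<^sub>0 x, y\<rbrakk>\<^sub>0\<^sub>0 \<oplus>\<^sub>0 R\<^sub>0 \<lbrakk>x, R\<^sub>0 y\<rbrakk>\<^sub>0\<^sub>0"
    by (rule G0_eqI) (simp_all add: a_minus_def flip: rop_br00)
  then show "rb_nat L x y \<in> mor_between L (ob_br L (rb_ob L x) (rb_ob L y))
      (rb_ob L (ob_br L (rb_ob L x) y) \<oplus>\<^sub>O\<^bsub>L\<^esub> rb_ob L (ob_br L x (rb_ob L y)))"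
    by (simp add: mor_between_def)
  show "invertible_mor L (rb_nat L x y)" by (rule L_invertible) simp
next
  fix f g assume [simp]: "f \<in> mors L" "g \<in> mors L"
  show "cmp L (rb_nat L (tgt L f) (tgt L g)) (mor_br L (rb_mor L f) (rb_mor L g))
    = cmp L (rb_mor L (mor_br L (rb_mor L f) g) \<oplus>\<^sub>M\<^bsub>L\<^esub> rb_mor L (mor_br L f (rb_mor L g)))
        (rb_nat L (src L f) (src L g))" (is "?f = ?g")
  proof (rule L_eqI)
    show "p1 ?f = p1 ?g"
    proof (rule G1_eqI)
      let ?u = "p1 f" and ?v = "p1 g" and ?A = "p0 f \<oplus>\<^sub>0 l\<^sub>1 (p1 f)"
      have s: "R\<^sub>2 (p0 f) (l\<^sub>1 ?v) = \<ominus>\<^bsub>G1 G\<^esub> R\<^sub>2 (l\<^sub>1 ?v) (p0 f)"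
        "R\<^sub>2 (l\<^sub>1 ?u) (l\<^sub>1 ?v) = \<ominus>\<^bsub>G1 G\<^esub> R\<^sub>2 (l\<^sub>1 ?v) (l\<^sub>1 ?u)"
        by (rule rop2_swap; simp)+
      fix h assume [simp]: "h \<in> additive_functionals (G1 G)"
      show "h (p1 ?f) = h (p1 ?g)"
        \<comment> \<open>Again one argument changes at a time: the difference of
          \<open>R\<^sub>2\<close> between targets and sources is its value at
          \<open>(l\<^sub>1 u, b)\<close> plus its value at \<open>(A, l\<^sub>1 v)\<close>, with
          \<open>b\<close> the source of \<open>g\<close> and \<open>A\<close> the target of
          \<open>f\<close>.\<close>
        using arg_cong[OF rop_br10[of ?u "p0 g"], of h] arg_cong[OF rop_br10[of ?v ?A], of h]
        by (simp add: arrow_br_def s a_minus_def diff_rop)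
    qed simp_all
  qed simp_all
next
  \<comment> \<open>The Rota-Baxter coherence law. Skewness normalises the arguments exactly as in
    the opposite direction, and the law becomes the cyclic identity for
    \<open>R\<^sub>2\<close>.\<close>
  case (6 x y z)
  then have [simp]: "x \<in> deg0 G" "y \<in> deg0 G" "z \<in> deg0 G" by simp_all
  have s: "R\<^sub>2 z x = \<ominus>\<^bsub>G1 G\<^esub> R\<^sub>2 x z"
    "R\<^sub>2 z \<lbrakk>R\<^sub>0 x, y\<rbrakk>\<^sub>0\<^sub>0 = \<ominus>\<^bsub>G1 G\<^esub> R\<^sub>2 \<lbrakk>R\<^sub>0 x, y\<rbrakk>\<^sub>0\<^sub>0 z"
      "R\<^sub>2 z \<lbrakk>x, R\<^sub>0 y\<rbrakk>\<^sub>0\<^sub>0 = \<ominus>\<^bsub>G1 G\<^esub> R\<^sub>2 \<lbrakk>x, R\<^sub>0 y\<rbrakk>\<^sub>0\<^sub>0 z"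
    "R\<^sub>2 y \<lbrakk>R\<^sub>0 x, z\<rbrakk>\<^sub>0\<^sub>0 = \<ominus>\<^bsub>G1 G\<^esub> R\<^sub>2 \<lbrakk>R\<^sub>0 x, z\<rbrakk>\<^sub>0\<^sub>0 y"
      "R\<^sub>2 y \<lbrakk>x, R\<^sub>0 z\<rbrakk>\<^sub>0\<^sub>0 = \<ominus>\<^bsub>G1 G\<^esub> R\<^sub>2 \<lbrakk>x, R\<^sub>0 z\<rbrakk>\<^sub>0\<^sub>0 y"
    by (rule rop2_swap; simp)+
  have o: "\<lbrakk>R\<^sub>0 y, x\<rbrakk>\<^sub>0\<^sub>0 = \<ominus>\<^bsub>G0 G\<^esub> \<lbrakk>x, R\<^sub>0 y\<rbrakk>\<^sub>0\<^sub>0" "\<lbrakk>R\<^sub>0 z, y\<rbrakk>\<^sub>0\<^sub>0 = \<ominus>\<^bsub>G0 G\<^esub> \<lbrakk>y, R\<^sub>0 z\<rbrakk>\<^sub>0\<^sub>0"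
    "\<lbrakk>R\<^sub>0 z, x\<rbrakk>\<^sub>0\<^sub>0 = \<ominus>\<^bsub>G0 G\<^esub> \<lbrakk>x, R\<^sub>0 z\<rbrakk>\<^sub>0\<^sub>0"
    by (rule br00_swap; simp)+
  have j: "l\<^sub>3 (R\<^sub>0 y) (R\<^sub>0 z) x = \<ominus>\<^bsub>G1 G\<^esub> l\<^sub>3 (R\<^sub>0 y) x (R\<^sub>0 z)"
    "l\<^sub>3 (R\<^sub>0 y) x (R\<^sub>0 z) = \<ominus>\<^bsub>G1 G\<^esub> l\<^sub>3 x (R\<^sub>0 y) (R\<^sub>0 z)"
    "l\<^sub>3 (R\<^sub>0 z) (R\<^sub>0 x) y = \<ominus>\<^bsub>G1 G\<^esub> l\<^sub>3 (R\<^sub>0 x) (R\<^sub>0 z) y"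
      "l\<^sub>3 (R\<^sub>0 x) (R\<^sub>0 z) y = \<ominus>\<^bsub>G1 G\<^esub> l\<^sub>3 (R\<^sub>0 x) y (R\<^sub>0 z)"
    "l\<^sub>3 (R\<^sub>0 x) (R\<^sub>0 y) z = \<ominus>\<^bsub>G1 G\<^esub> l\<^sub>3 (R\<^sub>0 x) z (R\<^sub>0 y)"
    by (rule tern_swap; simp)+
  show ?case (is "?f = ?g")
  proof (rule L_eqI)
    show "p1 ?f = p1 ?g"
    proof (rule G1_eqI)
      fix h assume [simp]: "h \<in> additive_functionals (G1 G)"
      show "h (p1 ?f) = h (p1 ?g)"
        using arg_cong[OF rop_coherence[of x y z], of h]
        by (simp add: rop_cyclic_summand_def arrow_br_def s o j a_minus_def)
    qed simp_all
  qed simp_all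
qed

lemma L_char0: "char0_rb_lie_two_algebra K L"
  by (intro char0_rb_lie_two_algebra.intro char0_rb_lie_two_algebra_axioms.intro
      L_rb_lie_two_algebra char0)

text \<open>On the kernel of the source map the first component of a pair is 0, so \<open>p1\<close>
  and the inclusion used next are mutually inverse. Both respect all operations strictly, which is
  why their quadratic and third components are 0.\<close>

lemma proj_homomorphism:
  "rb_linf_homomorphism K G (linf_of L) (\<lambda>x. x) p1 (\<lambda>x y. \<zero>\<^bsub>G1 G\<^esub>) (\<lambda>x. \<zero>\<^bsub>G1 G\<^esub>)"
proof -
  interpret L: char0_rb_lie_two_algebra K L by (rule L_char0)
  show ?thesis
  proof
    show "(\<lambda>x. x) \<in> module_hom K (G0 (linf_of L)) (G0 G)"
      "p1 \<in> module_hom K (G1 (linf_of L)) (G1 G)"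
      "(\<lambda>x. \<zero>\<^bsub>G1 G\<^esub>) \<in> module_hom K (G0 (linf_of L)) (G1 G)"
      by (rule module_homI; simp)+
    show "bilinear_map K (G0 (linf_of L)) (G0 (linf_of L)) (G1 G) (\<lambda>x y. \<zero>\<^bsub>G1 G\<^esub>)"
      by (rule bilinear_mapI; simp)
    show "skew2 (G0 (linf_of L)) (G1 G) (\<lambda>x y. \<zero>\<^bsub>G1 G\<^esub>)" by (simp add: skew2_def)
  qed (simp_all add: arrow_br_def a_minus_def G0.r_neg G1.r_neg G0.l_neg)
qed

lemma incl_homomorphism:
  "rb_linf_homomorphism K (linf_of L) G (\<lambda>x. x) (\<lambda>u. pr \<zero>\<^bsub>G0 G\<^esub> u) (\<lambda>x y. \<zero>\<^bsub>Mor L\<^esub>) (\<lambda>x. \<zero>\<^bsub>Mor L\<^esub>)"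
proof -
  interpret L: char0_rb_lie_two_algebra K L by (rule L_char0)
  show ?thesis
  proof
    show "(\<lambda>x. x) \<in> module_hom K (G0 G) (G0 (linf_of L))"
      "(\<lambda>u. pr \<zero>\<^bsub>G0 G\<^esub> u) \<in> module_hom K (G1 G) (G1 (linf_of L))"
      "(\<lambda>x. \<zero>\<^bsub>Mor L\<^esub>) \<in> module_hom K (G0 G) (G1 (linf_of L))"
      by (rule module_homI; simp)+
    show "bilinear_map K (G0 G) (G0 G) (G1 (linf_of L)) (\<lambda>x y. \<zero>\<^bsub>Mor L\<^esub>)"
      by (rule bilinear_mapI; simp)
    show "skew2 (G0 G) (G1 (linf_of L)) (\<lambda>x y. \<zero>\<^bsub>Mor L\<^esub>)" by (simp add: skew2_def)
  qed (simp_all add: arrow_br_def a_minus_def G0.r_neg G1.r_neg G0.l_neg)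
qed

end

text \<open>An additive functional takes the value \<open>n * h x\<close> at the \<open>n\<close>-th
  multiple of \<open>x\<close>. Finitely many vectors give finitely many such values, so
  \<open>h x\<close> is 0 for every functional.\<close>

lemma finite_vectorspace_trivial:
  assumes V: "fd_vectorspace K V" "char_zero K" and fin: "finite (carrier V)" and x: "x \<in> carrier V"
  shows "x = \<zero>\<^bsub>V\<^esub>"
proof -
  interpret Module.module K V using V(1) by (rule fd_vectorspace_module)
  show ?thesis
  proof (rule eq_by_additive_functionals[OF V x])
    fix h assume h: "h \<in> additive_functionals V"
    note [simp] = additive_functional_add[OF h]
      additive_functional_zero[OF h M.abelian_group_axioms]
    have mult: "h ([n] \<cdot>\<^bsub>V\<^esub> x) = of_nat n * h x" for n :: nat
      using x by (induction n) (simp_all add: algebra_simps)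
    have "range (\<lambda>n. of_nat n * h x) \<subseteq> h ` carrier V"
      using x by (auto simp flip: mult)
    then have "finite (range (\<lambda>n. of_nat n * h x))" using fin finite_subset by blast
    then have "\<not> inj_on (\<lambda>n. of_nat n * h x) UNIV" using finite_imageD infinite_UNIV_nat by blast
    then have "h x = 0" by (auto simp: inj_on_def)
    then show "h x = h \<zero>\<^bsub>V\<^esub>" by simp
  qed simp
qed

text \<open>The morphisms of the Lie 2-algebra of \<open>G\<close> must live in the type of the carriers of \<open>G\<close>. This
  is possible: an infinite type absorbs its square, and over a finite one every space is \<open>0\<close>.\<close>

lemma ex_pairing:
  fixes V W :: "('k, 'v) module"
  assumes "fd_vectorspace K V" "fd_vectorspace K W" "char_zero K"
  shows "\<exists>pr p0 p1. \<forall>x \<in> carrier V. \<forall>u \<in> carrier W. p0 (pr x u :: 'v) = x \<and> p1 (pr x u) = u"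
proof (cases "finite (UNIV :: 'v set)")
  case True
  then have "finite (carrier V)" "finite (carrier W)" by (meson finite_subset subset_UNIV)+
  then have "\<forall>x \<in> carrier V. \<forall>u \<in> carrier W. \<zero>\<^bsub>V\<^esub> = x \<and> \<zero>\<^bsub>W\<^esub> = u"
    using assms finite_vectorspace_trivial by metis
  then show ?thesis
    \<comment> \<open>Both spaces are zero, so the only pair to be decoded is the pair of zeros and
      constant decoders are correct.\<close>
    by (intro exI[of _ "\<lambda>x u. x"] exI[of _ "\<lambda>_. \<zero>\<^bsub>V\<^esub>"] exI[of _ "\<lambda>_. \<zero>\<^bsub>W\<^esub>"])
next
  case False
  then obtain f :: "'v \<times> 'v \<Rightarrow> 'v" where f: "bij_betw f (UNIV \<times> UNIV) UNIV"
    using card_of_Times_same_infinite[of "UNIV :: 'v set"] card_of_ordIso by blast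
  have "the_inv f (f p) = p" for p
    using f by (simp add: bij_betw_def the_inv_f_f)
  then show ?thesis
    by (intro exI[of _ "\<lambda>x u. f (x, u)"] exI[of _ "\<lambda>w. fst (the_inv f w)"]
      exI[of _ "\<lambda>w. snd (the_inv f w)"])
      simp
qed

section \<open>The equivalence\<close>

lemma restrict_maps_simps [simp]:
  "x \<in> A \<Longrightarrow> map0 (restrict_maps A B F) x = map0 F x"
  "u \<in> B \<Longrightarrow> map1 (restrict_maps A B F) u = map1 F u"
  "\<lbrakk>x \<in> A; y \<in> A\<rbrakk> \<Longrightarrow> map2 (restrict_maps A B F) x y = map2 F x y"
  "x \<in> A \<Longrightarrow> map3 (restrict_maps A B F) x = map3 F x"
  by (simp_all add: restrict_maps_def)

lemma restrict_maps_eqI: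
  assumes "\<And>x. x \<in> A \<Longrightarrow> map0 F x = map0 F' x" "\<And>u. u \<in> B \<Longrightarrow> map1 F u = map1 F' u"
    and "\<And>x y. \<lbrakk>x \<in> A; y \<in> A\<rbrakk> \<Longrightarrow> map2 F x y = map2 F' x y"
    and "\<And>x. x \<in> A \<Longrightarrow> map3 F x = map3 F' x"
  shows "restrict_maps A B F = restrict_maps A B F'"
  using assms by (auto simp: restrict_maps_def fun_eq_iff)

lemma restrict_maps_idem [simp]:
  "restrict_maps A B (restrict_maps A B F) = restrict_maps A B F"
  by (rule restrict_maps_eqI) simp_all

lemma TwoTermRBL_simps:
  "cat_obj (TwoTermRBL K) = {G. rb_two_term_linf_algebra K G}"
  "cat_id (TwoTermRBL K) G = restrict_maps (deg0 G) (deg1 G)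
     \<lparr>map0 = (\<lambda>x. x), map1 = (\<lambda>u. u), map2 = (\<lambda>x y. \<zero>\<^bsub>G1 G\<^esub>), map3 = (\<lambda>x. \<zero>\<^bsub>G1 G\<^esub>)\<rparr>"
  "cat_comp (TwoTermRBL K) G G' G'' \<psi> \<phi> = restrict_maps (deg0 G) (deg1 G)
     \<lparr>map0 = (\<lambda>x. map0 \<psi> (map0 \<phi> x)), map1 = (\<lambda>u. map1 \<psi> (map1 \<phi> u)),
      map2 = (\<lambda>x y. map2 \<psi> (map0 \<phi> x) (map0 \<phi> y) \<oplus>\<^sub>1\<^bsub>G''\<^esub> map1 \<psi> (map2 \<phi> x y)),
      map3 = (\<lambda>x. map3 \<psi> (map0 \<phi> x) \<oplus>\<^sub>1\<^bsub>G''\<^esub> map1 \<psi> (map3 \<phi> x))\<rparr>"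
  by (simp_all add: TwoTermRBL_def)

lemma RBLie2Alg_simps:
  "cat_obj (RBLie2Alg K) = {L. rb_lie_two_algebra K L}"
  "cat_id (RBLie2Alg K) L = restrict_maps (obs L) (mors L)
     \<lparr>map0 = (\<lambda>x. x), map1 = (\<lambda>f. f), map2 = (\<lambda>x y. \<iota>\<^bsub>L\<^esub> \<langle>x, y\<rangle>\<^sub>O\<^bsub>L\<^esub>),
      map3 = (\<lambda>x. \<iota>\<^bsub>L\<^esub> (P\<^sub>0\<^bsub>L\<^esub> x))\<rparr>"
  "cat_comp (RBLie2Alg K) L L' L'' G F = restrict_maps (obs L) (mors L)
     \<lparr>map0 = (\<lambda>x. map0 G (map0 F x)), map1 = (\<lambda>f. map1 G (map1 F f)),
      map2 = (\<lambda>x y. map1 G (map2 F x y) \<diamondop>\<^bsub>L''\<^esub> map2 G (map0 F x) (map0 F y)),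
      map3 = (\<lambda>x. map1 G (map3 F x) \<diamondop>\<^bsub>L''\<^esub> map3 G (map0 F x))\<rparr>"
  by (simp_all add: RBLie2Alg_def)

lemma TwoTermRBL_homI:
  assumes "rb_two_term_linf_algebra K G"
    and "rb_linf_homomorphism K G' G (map0 \<phi>) (map1 \<phi>) (map2 \<phi>) (map3 \<phi>)"
  shows "restrict_maps (deg0 G) (deg1 G) \<phi> \<in> cat_hom (TwoTermRBL K) G G'"
  using rb_linf_homomorphism_cong[OF assms] by (simp add: TwoTermRBL_def)

lemma RBLie2Alg_homI:
  assumes "rb_lie_two_algebra K L"
    and "rb_lie_two_homomorphism K L' L (map0 F) (map1 F) (map2 F) (map3 F)"
  shows "restrict_maps (obs L) (mors L) F \<in> cat_hom (RBLie2Alg K) L L'"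
  using rb_lie_two_homomorphism_cong[OF assms] by (simp add: RBLie2Alg_def)

lemma TwoTermRBL_homD:
  assumes "\<phi> \<in> cat_hom (TwoTermRBL K) G G'" "char_zero K"
    and "G \<in> cat_obj (TwoTermRBL K)" "G' \<in> cat_obj (TwoTermRBL K)"
  shows "char0_linf_hom K G' G (map0 \<phi>) (map1 \<phi>) (map2 \<phi>) (map3 \<phi>)"
    and "restrict_maps (deg0 G) (deg1 G) \<phi> = \<phi>"
  using assms by (auto simp: TwoTermRBL_def char0_linf_hom_def char0_rb_two_term_def
      char0_rb_two_term_axioms_def)

lemma RBLie2Alg_homD:
  assumes "F \<in> cat_hom (RBLie2Alg K) L L'" "char_zero K"
    and "L \<in> cat_obj (RBLie2Alg K)" "L' \<in> cat_obj (RBLie2Alg K)"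
  shows "char0_rb_lie_two_homomorphism K L' L (map0 F) (map1 F) (map2 F) (map3 F)"
    and "restrict_maps (obs L) (mors L) F = F"
  using assms by (auto simp: RBLie2Alg_def char0_rb_lie_two_homomorphism_def
      char0_rb_lie_two_pair_def char0_rb_lie_two_algebra_def char0_rb_lie_two_algebra_axioms_def)

text \<open>The closure clauses rest on \<open>id_homomorphism\<close> and
  \<open>comp_homomorphism\<close>. The unit and associativity laws are equations of restricted
  maps, checked component by component on the carriers.\<close>

lemma category_TwoTermRBL:
  fixes K :: "('k, 'c) ring_scheme"
  assumes K: "char_zero K"
  shows "category (TwoTermRBL K :: (('k, 'v) rb_two_term, 'v hom_maps) cat)" (is "category ?D")
proof
  fix G :: "('k, 'v) rb_two_term" assume "G \<in> cat_obj ?D"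
  then interpret G: char0_rb_two_term K G
    by (simp add: TwoTermRBL_simps char0_rb_two_term_def char0_rb_two_term_axioms_def K)
  show "cat_id ?D G \<in> cat_hom ?D G G"
    unfolding TwoTermRBL_simps
    by (rule TwoTermRBL_homI) (simp_all add: G.rb_two_term_linf_algebra_axioms G.id_homomorphism)
next
  fix G G' G'' :: "('k, 'v) rb_two_term" and \<phi> \<psi>
  assume *: "G \<in> cat_obj ?D" "G' \<in> cat_obj ?D" "G'' \<in> cat_obj ?D"
    "\<phi> \<in> cat_hom ?D G G'" "\<psi> \<in> cat_hom ?D G' G''"
  interpret \<phi>: char0_linf_hom K G' G "map0 \<phi>" "map1 \<phi>" "map2 \<phi>" "map3 \<phi>"
    using * K by (intro TwoTermRBL_homD)
  interpret \<psi>: char0_linf_hom K G'' G' "map0 \<psi>" "map1 \<psi>" "map2 \<psi>" "map3 \<psi>"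
    using * K by (intro TwoTermRBL_homD)
  interpret char0_linf_hom_pair K G'' G' G "map0 \<phi>" "map1 \<phi>" "map2 \<phi>" "map3 \<phi>"
    "map0 \<psi>" "map1 \<psi>" "map2 \<psi>" "map3 \<psi>" ..
  show "cat_comp ?D G G' G'' \<psi> \<phi> \<in> cat_hom ?D G G''"
    unfolding TwoTermRBL_simps
    by (rule TwoTermRBL_homI) (simp_all add: \<phi>.G.rb_two_term_linf_algebra_axioms comp_homomorphism)
next
  fix G G' :: "('k, 'v) rb_two_term" and \<phi>
  assume *: "G \<in> cat_obj ?D" "G' \<in> cat_obj ?D" "\<phi> \<in> cat_hom ?D G G'"
  interpret \<phi>: char0_linf_hom K G' G "map0 \<phi>" "map1 \<phi>" "map2 \<phi>" "map3 \<phi>"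
    using * K by (intro TwoTermRBL_homD)
  have r: "restrict_maps (deg0 G) (deg1 G) \<phi> = \<phi>"
    using * K by (intro TwoTermRBL_homD)
  have "cat_comp ?D G G' G' (cat_id ?D G') \<phi> = restrict_maps (deg0 G) (deg1 G) \<phi>"
    unfolding TwoTermRBL_simps by (rule restrict_maps_eqI) simp_all
  then show "cat_comp ?D G G' G' (cat_id ?D G') \<phi> = \<phi>" unfolding r .
  have "cat_comp ?D G G G' \<phi> (cat_id ?D G) = restrict_maps (deg0 G) (deg1 G) \<phi>"
    unfolding TwoTermRBL_simps by (rule restrict_maps_eqI) simp_all
  then show "cat_comp ?D G G G' \<phi> (cat_id ?D G) = \<phi>" unfolding r .
next
  fix G G' G'' G''' :: "('k, 'v) rb_two_term" and \<phi> \<psi> \<chi>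
  assume *: "G \<in> cat_obj ?D" "G' \<in> cat_obj ?D" "G'' \<in> cat_obj ?D" "G''' \<in> cat_obj ?D"
    "\<phi> \<in> cat_hom ?D G G'" "\<psi> \<in> cat_hom ?D G' G''" "\<chi> \<in> cat_hom ?D G'' G'''"
  interpret \<phi>: char0_linf_hom K G' G "map0 \<phi>" "map1 \<phi>" "map2 \<phi>" "map3 \<phi>"
    using * K by (intro TwoTermRBL_homD)
  interpret \<psi>: char0_linf_hom K G'' G' "map0 \<psi>" "map1 \<psi>" "map2 \<psi>" "map3 \<psi>"
    using * K by (intro TwoTermRBL_homD)
  interpret \<chi>: char0_linf_hom K G''' G'' "map0 \<chi>" "map1 \<chi>" "map2 \<chi>" "map3 \<chi>"
    using * K by (intro TwoTermRBL_homD)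
  show "cat_comp ?D G G' G''' (cat_comp ?D G' G'' G''' \<chi> \<psi>) \<phi>
      = cat_comp ?D G G'' G''' \<chi> (cat_comp ?D G G' G'' \<psi> \<phi>)"
    unfolding TwoTermRBL_simps by (rule restrict_maps_eqI) (simp_all add: \<chi>.G'.G1.a_assoc)
qed

text \<open>Restricting \<open>map1\<close> to the arrows out of 0 loses no information, because a
  functor is determined on identities by its map on objects. The next definition rebuilds the full
  map from this.\<close>

definition linf_map where
  "linf_map L L' F = restrict_maps (obs L) (arrows L)
    \<lparr>map0 = map0 F, map1 = map1 F, map2 = (\<lambda>x y. arrow_part L' (map2 F x y)),
     map3 = (\<lambda>x. arrow_part L' (map3 F x))\<rparr>"

definition lie_two_map where
  "lie_two_map L L' \<phi> = restrict_maps (obs L) (mors L)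
    \<lparr>map0 = map0 \<phi>, map1 = (\<lambda>f. \<iota>\<^bsub>L'\<^esub> (map0 \<phi> (src L f)) \<oplus>\<^sub>M\<^bsub>L'\<^esub> map1 \<phi> (arrow_part L f)),
     map2 = (\<lambda>x y. \<iota>\<^bsub>L'\<^esub> \<langle>map0 \<phi> x, map0 \<phi> y\<rangle>\<^sub>O\<^bsub>L'\<^esub> \<oplus>\<^sub>M\<^bsub>L'\<^esub> map2 \<phi> x y),
     map3 = (\<lambda>x. \<iota>\<^bsub>L'\<^esub> (P\<^sub>0\<^bsub>L'\<^esub> (map0 \<phi> x)) \<oplus>\<^sub>M\<^bsub>L'\<^esub> map3 \<phi> x)\<rparr>"

text \<open>Essential surjectivity. The preimage is the Lie 2-algebra on pairs for an encoding that
  depends on \<open>G\<close>; the isomorphism forgets the zero first component.\<close>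

lemma ex_linf_of_iso:
  fixes G :: "('k, 'v) rb_two_term"
  assumes K: "char_zero K" and G: "G \<in> cat_obj (TwoTermRBL K)"
  shows "\<exists>L \<in> cat_obj (RBLie2Alg K). \<exists>\<phi>. cat_iso (TwoTermRBL K) (linf_of L) G \<phi>"
proof -
  interpret G: char0_rb_two_term K G
    using G by (simp add: TwoTermRBL_simps char0_rb_two_term_def char0_rb_two_term_axioms_def K)
  obtain pr :: "'v \<Rightarrow> 'v \<Rightarrow> 'v" and p0 p1 where
    pr: "\<forall>x \<in> deg0 G. \<forall>u \<in> deg1 G. p0 (pr x u) = x \<and> p1 (pr x u) = u"
    using ex_pairing[OF G.G0_space G.G1_space K] by blast
  interpret paired_rb_two_term K G pr p0 p1
    by unfold_locales (rule pr[rule_format, THEN conjunct1]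
      pr[rule_format, THEN conjunct2]; assumption)+
  interpret L: char0_rb_lie_two_algebra K L by (rule L_char0)
  let ?D = "TwoTermRBL K"
  let ?\<phi> = "restrict_maps (deg0 (linf_of L)) (deg1 (linf_of L))
    \<lparr>map0 = (\<lambda>x. x), map1 = p1, map2 = (\<lambda>x y. \<zero>\<^bsub>G1 G\<^esub>), map3 = (\<lambda>x. \<zero>\<^bsub>G1 G\<^esub>)\<rparr>"
  let ?\<psi> = "restrict_maps (deg0 G) (deg1 G)
    \<lparr>map0 = (\<lambda>x. x), map1 = (\<lambda>u. pr \<zero>\<^bsub>G0 G\<^esub> u), map2 = (\<lambda>x y. \<zero>\<^bsub>Mor L\<^esub>), map3 = (\<lambda>x. \<zero>\<^bsub>Mor L\<^esub>)\<rparr>"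
  have "?\<phi> \<in> cat_hom ?D (linf_of L) G"
    by (rule TwoTermRBL_homI)
      (simp_all add: L.linf_of_rb_two_term_linf_algebra proj_homomorphism del: L_simps)
  moreover have "?\<psi> \<in> cat_hom ?D G (linf_of L)"
    by (rule TwoTermRBL_homI)
      (simp_all add: G.rb_two_term_linf_algebra_axioms incl_homomorphism del: L_simps)
  moreover have "pr \<zero>\<^bsub>G0 G\<^esub> (p1 u) = u" if "u \<in> arrows L" for u
    using that p_closed(3)[of u] by simp
  then have "cat_comp ?D (linf_of L) G (linf_of L) ?\<psi> ?\<phi> = cat_id ?D (linf_of L)"
    unfolding TwoTermRBL_simps by (intro restrict_maps_eqI) simp_all
  moreover have "cat_comp ?D G (linf_of L) G ?\<phi> ?\<psi> = cat_id ?D G"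
    unfolding TwoTermRBL_simps by (intro restrict_maps_eqI) simp_all
  ultimately have "cat_iso ?D (linf_of L) G ?\<phi>"
    unfolding cat_iso_def by blast
  moreover have "L \<in> cat_obj (RBLie2Alg K)"
    by (simp add: RBLie2Alg_simps L_rb_lie_two_algebra)
  ultimately show ?thesis by blast
qed

theorem theorem3p7:
  fixes K :: "('k, 'c) ring_scheme"
  assumes "algebraically_closed K" and "char_zero K"
  shows "equivalent_categories
    (RBLie2Alg K :: (('k, 'v) rb_lie_two_alg, 'v hom_maps) cat)
    (TwoTermRBL K :: (('k, 'v) rb_two_term, 'v hom_maps) cat)"
    (is "equivalent_categories ?C ?D")
proof (rule equivalent_categoriesI[where T = linf_of and Tm = linf_map and Um = lie_two_map])
  \<comment> \<open>The category laws are needed only on this side; those of the other category are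
    produced by the pull-back along \<open>linf_of\<close>.\<close>
  show "category ?D" using assms(2) by (rule category_TwoTermRBL)
  have obj: "linf_of L \<in> cat_obj ?D" if "L \<in> cat_obj ?C" for L
  proof -
    interpret char0_rb_lie_two_algebra K L
      using that assms(2)
      by (simp add: RBLie2Alg_simps char0_rb_lie_two_algebra_def
        char0_rb_lie_two_algebra_axioms_def)
    show ?thesis by (simp add: TwoTermRBL_simps linf_of_rb_two_term_linf_algebra)
  qed
  show "linf_of L \<in> cat_obj ?D" if "L \<in> cat_obj ?C" for L using that by (rule obj)
  show "\<exists>L \<in> cat_obj ?C. \<exists>\<phi>. cat_iso ?D (linf_of L) G \<phi>" if "G \<in> cat_obj ?D" for G
    using assms(2) that by (rule ex_linf_of_iso)
next
  fix L L' :: "('k, 'v) rb_lie_two_alg" and F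
  assume *: "L \<in> cat_obj ?C" "L' \<in> cat_obj ?C" "F \<in> cat_hom ?C L L'"
  interpret char0_rb_lie_two_homomorphism K L' L "map0 F" "map1 F" "map2 F" "map3 F"
    using * assms(2) by (intro RBLie2Alg_homD)
  have r: "restrict_maps (obs L) (mors L) F = F" using * assms(2) by (intro RBLie2Alg_homD)
  show "linf_map L L' F \<in> cat_hom ?D (linf_of L) (linf_of L')"
    using TwoTermRBL_homI[OF L.linf_of_rb_two_term_linf_algebra, of "linf_of L'"
        "\<lparr>map0 = map0 F, map1 = map1 F, map2 = (\<lambda>x y. arrow_part L' (map2 F x y)),
          map3 = (\<lambda>x. arrow_part L' (map3 F x))\<rparr>"] linf_of_homomorphism
    by (simp add: linf_map_def)
  \<comment> \<open>Each component of \<open>F\<close> is recovered from its source, which the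
    homomorphism axioms prescribe, and its arrow part, which \<open>linf_map\<close>
    retains.\<close>
  have 1: "\<iota>\<^bsub>L'\<^esub> (map0 F (src L f)) \<oplus>\<^sub>M\<^bsub>L'\<^esub> map1 F (arrow_part L f) = map1 F f"
    if "f \<in> mors L" for f
    using L'.decomp[of "map1 F f"] that by simp
  have 2: "\<iota>\<^bsub>L'\<^esub> \<langle>map0 F x, map0 F y\<rangle>\<^sub>O\<^bsub>L'\<^esub> \<oplus>\<^sub>M\<^bsub>L'\<^esub> arrow_part L' (map2 F x y) = map2 F x y"
    if "x \<in> obs L" "y \<in> obs L" for x y
    using L'.decomp[of "map2 F x y"] that by simp
  have 3: "\<iota>\<^bsub>L'\<^esub> (P\<^sub>0\<^bsub>L'\<^esub> (map0 F x)) \<oplus>\<^sub>M\<^bsub>L'\<^esub> arrow_part L' (map3 F x) = map3 F x"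
    if "x \<in> obs L" for x
    using L'.decomp[of "map3 F x"] that by simp
  have "lie_two_map L L' (linf_map L L' F) = restrict_maps (obs L) (mors L) F"
    unfolding lie_two_map_def linf_map_def by (rule restrict_maps_eqI) (simp_all add: 1 2 3)
  then show "lie_two_map L L' (linf_map L L' F) = F" using r by simp
next
  fix L L' :: "('k, 'v) rb_lie_two_alg" and \<phi>
  assume *: "L \<in> cat_obj ?C" "L' \<in> cat_obj ?C" "\<phi> \<in> cat_hom ?D (linf_of L) (linf_of L')"
  interpret L: char0_rb_lie_two_algebra K L
    using * assms(2)
    by (simp add: RBLie2Alg_simps char0_rb_lie_two_algebra_def char0_rb_lie_two_algebra_axioms_def)
  interpret L': char0_rb_lie_two_algebra K L'
    using * assms(2)
    by (simp add: RBLie2Alg_simps char0_rb_lie_two_algebra_def char0_rb_lie_two_algebra_axioms_def)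
  interpret char0_rb_linf_homomorphism K L' L "map0 \<phi>" "map1 \<phi>" "map2 \<phi>" "map3 \<phi>"
    using * L.char0_rb_lie_two_algebra_axioms L'.char0_rb_lie_two_algebra_axioms
    by (simp add: TwoTermRBL_def char0_rb_linf_homomorphism_def char0_rb_lie_two_pair_def)
  have r: "restrict_maps (obs L) (arrows L) \<phi> = \<phi>" using * by (simp add: TwoTermRBL_def)
  show "lie_two_map L L' \<phi> \<in> cat_hom ?C L L'"
    unfolding lie_two_map_def
    using rb_lie_two_homomorphism_F
    by (intro RBLie2Alg_homI) (simp_all add: L.rb_lie_two_algebra_axioms F1_def[abs_def]
      F2_def[abs_def] F3_def[abs_def])
  have "linf_map L L' (lie_two_map L L' \<phi>) = restrict_maps (obs L) (arrows L) \<phi>"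
    unfolding lie_two_map_def linf_map_def
    by (rule restrict_maps_eqI) (simp_all add: L.arrow_part_id)
  then show "linf_map L L' (lie_two_map L L' \<phi>) = \<phi>" using r by simp
next
  fix L :: "('k, 'v) rb_lie_two_alg" assume "L \<in> cat_obj ?C"
  then interpret char0_rb_lie_two_algebra K L
    using assms(2)
    by (simp add: RBLie2Alg_simps char0_rb_lie_two_algebra_def char0_rb_lie_two_algebra_axioms_def)
  \<comment> \<open>A zero arrow part lifts to an identity morphism, so the zero components of the
    identity on the 2-term side become the identity transformations.\<close>
  show "cat_id ?C L = lie_two_map L L (cat_id ?D (linf_of L))"
    unfolding RBLie2Alg_simps TwoTermRBL_simps lie_two_map_def
    by (rule restrict_maps_eqI) (simp_all flip: decomp)
next
  fix L L' L'' :: "('k, 'v) rb_lie_two_alg" and F E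
  assume *: "L \<in> cat_obj ?C" "L' \<in> cat_obj ?C" "L'' \<in> cat_obj ?C"
    "F \<in> cat_hom ?C L L'" "E \<in> cat_hom ?C L' L''"
  interpret F: char0_rb_lie_two_homomorphism K L' L "map0 F" "map1 F" "map2 F" "map3 F"
    using * assms(2) by (intro RBLie2Alg_homD)
  interpret E: char0_rb_lie_two_homomorphism K L'' L' "map0 E" "map1 E" "map2 E" "map3 E"
    using * assms(2) by (intro RBLie2Alg_homD)
  have 1: "map1 E (map1 F f)
      = \<iota>\<^bsub>L''\<^esub> (map0 E (map0 F (src L f))) \<oplus>\<^sub>M\<^bsub>L''\<^esub> map1 E (map1 F (arrow_part L f))"
    if "f \<in> mors L" for f
    using E.L'.decomp[of "map1 E (map1 F f)"] that by simp
  \<comment> \<open>The composite transformation starts where the second homomorphism prescribes,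
    and its arrow part is a sum of two. This sum is the composition formula of 2-term homomorphisms
    with the summands exchanged.\<close>
  have 2: "map1 E (map2 F x y) \<diamondop>\<^bsub>L''\<^esub> map2 E (map0 F x) (map0 F y)
      = \<iota>\<^bsub>L''\<^esub> \<langle>map0 E (map0 F x), map0 E (map0 F y)\<rangle>\<^sub>O\<^bsub>L''\<^esub>
        \<oplus>\<^sub>M\<^bsub>L''\<^esub> (arrow_part L'' (map2 E (map0 F x) (map0 F y))
          \<oplus>\<^sub>M\<^bsub>L''\<^esub> map1 E (arrow_part L' (map2 F x y)))"
    if [simp]: "x \<in> obs L" "y \<in> obs L" for x y
  proof -
    note s = E.L'.cmp_simps[of "map1 E (map2 F x y)" "map2 E (map0 F x) (map0 F y)"]
    show ?thesis
      using E.L'.decomp[of "map1 E (map2 F x y) \<diamondop>\<^bsub>L''\<^esub> map2 E (map0 F x) (map0 F y)"]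
      by (simp add: s E.L'.Mor.a_comm)
  qed
  have 3: "map1 E (map3 F x) \<diamondop>\<^bsub>L''\<^esub> map3 E (map0 F x)
      = \<iota>\<^bsub>L''\<^esub> (P\<^sub>0\<^bsub>L''\<^esub> (map0 E (map0 F x)))
        \<oplus>\<^sub>M\<^bsub>L''\<^esub> (arrow_part L'' (map3 E (map0 F x)) \<oplus>\<^sub>M\<^bsub>L''\<^esub> map1 E (arrow_part L' (map3 F x)))"
    if [simp]: "x \<in> obs L" for x
  proof -
    note s = E.L'.cmp_simps[of "map1 E (map3 F x)" "map3 E (map0 F x)"]
    show ?thesis
      using E.L'.decomp[of "map1 E (map3 F x) \<diamondop>\<^bsub>L''\<^esub> map3 E (map0 F x)"]
      by (simp add: s E.L'.Mor.a_comm)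
  qed
  show "cat_comp ?C L L' L'' E F = lie_two_map L L''
      (cat_comp ?D (linf_of L) (linf_of L') (linf_of L'') (linf_map L' L'' E) (linf_map L L' F))"
    unfolding RBLie2Alg_simps TwoTermRBL_simps lie_two_map_def linf_map_def
    by (rule restrict_maps_eqI) (simp_all add: 2 3 flip: 1)
qed

end
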